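(* Let $H$ be a cancellative commutative monoid and let $r$ be a modular finitary ideal system on $H$. The following are equivalent. (1) $H$ is an $r$-SP-monoid, i.e. every $r$-ideal is a finite $r$-product of radical $r$-ideals of $H$. (2) $\dim_r(H)\leq 1$ and each $r$-invertible $r$-ideal is an $r$-product of radical $r$-ideals. (3) $\dim_r(H)\leq 1$ and each nontrivial prime $r$-ideal contains an $r$-invertible radical $r$-ideal. (4) Each $r$-ideal is an $r$-product of radical $r$-ideals $J_1\subseteq\cdots\subseteq J_n$; and for nontrivial $r$-ideals these are unique when required to be proper (with $H$ the empty $r$-product). (5) The radical of each nontrivial $r$-finitely generated $r$-ideal is $r$-invertible. (6) The $C$-lattice $\mathcal{I}_r(H)$ is isomorphic, as a multiplicative lattice, to $U_b(r\text{-}\max^{-1}(H))$. (7) $H$ is an $r$-Prüfer monoid and the radical of every $r$-finitely generated $r$-ideal is $r$-finitely generated.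
   Context: $H$ is a multiplicative commutative monoid with more than one element, and $z(H)$ is the set of $z\in H$ with $xz=z$ for all $x\in H$. $H$ is cancellative if every $x\in H\setminus z(H)$ is a cancellative element. An ideal system on $H$ is a map $r:\mathbb{P}(H)\to\mathbb{P}(H)$, $X\mapsto X_r$, on the power set such that for all $X,Y\subseteq H$, $c\in H$: (A) $XH\cup z(H)\subseteq X_r$; (B) $X\subseteq Y_r$ implies $X_r\subseteq Y_r$; (C) $cX_r=(cX)_r$. It is finitary if $X_r=\bigcup_{E\subseteq X,|E|<\infty}E_r$ for all $X$. $X$ is an $r$-ideal if $X_r=X$. $r$ is modular if $(I\cup J)_r\cap N\subseteq(I\cup(J\cap N))_r$ for all $r$-ideals $I,J,N$ with $I\subseteq N$. The $r$-product of $r$-ideals $I,J$ is $(IJ)_r$ (and similarly for finitely many). A cancellative element $x\in H$ is regular if $(xA)_r=xA_r$ for all $A\subseteq H$. An $r$-ideal $I$ is proper if $I\neq H$; nontrivial if $z(H)\subsetneq I$; regular if it contains a regular element; $r$-invertible if $(IJ)_r=yH$ for some $J\subseteq H$ and some regular $y\in H$; $r$-finitely generated if $I=E_r$ for some finite $E\subseteq I$; radical if $x^n\in I$ with $n\geq 1$ implies $x\in I$; prime if $I\neq H$ and $xy\in I$ implies $x\in I$ or $y\in I$; $r$-maximal if it is maximal among proper $r$-ideals. The radical of $I$ is $\{x\in H\mid x^n\in I\text{ for some }n\geq1\}$. $H$ is an $r$-Prüfer monoid if every regular $r$-finitely generated $r$-ideal is $r$-invertible. $\mathcal{I}_r(H)$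 is the multiplicative lattice of all $r$-ideals, ordered by inclusion with $r$-multiplication $(I,J)\mapsto(IJ)_r$ and bottom element $\emptyset_r$. (A $C$-lattice is a multiplicative lattice in which the compact elements contain the top element, are closed under products, and generate every element by joins.) $\dim_r(H)$ is $n-1$, where $n$ is the number of members of the longest chain of prime elements of $\mathcal{I}_r(H)$, i.e. of $r$-ideals $P\neq H$ such that for $r$-ideals $I,J$, $(IJ)_r\subseteq P$ implies $I\subseteq P$ or $J\subseteq P$ (the bottom element $\emptyset_r$ is allowed). $r\text{-}\max^{-1}(H)$ is the set of all $r$-maximal $r$-ideals with the inverse topology, having as basis of open sets the sets $\{M\mid I\subseteq M\}$ with $I$ an $r$-finitely generated $r$-ideal; it is Hausdorff. An isomorphism of multiplicative lattices is an order isomorphism that is also a monoid isomorphism. For a Hausdorff space $X$, $U(X)$ is the monoid, under pointwise addition, of functions $f:X\to\mathbb{N}_0$ such that $f^{-1}([k,\infty))$ is compact for all $k\geq 1$ (the compactly supported upper semicontinuous functions), ordered by $f\leq_d g$ iff $f(x)\geq g(x)$ for all $x\in X$. $U_b(X)=U(X)\cup\{b\}$, where $b:X\to\mathbb{N}_0\cup\{\infty\}$, $b(x)=\infty$ for all $x\in X$, is appended as bottom element, with $b+f=f+b=b$ for all $f$. The monoid operation of $U_b(X)$ as a multiplicative lattice is $+$ and its top element is the zero function.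
   Formalization: Item (6) is claimed equivalent only when the bottom r-ideal ∅_r is not r-maximal; if it is (e.g. a group with zero adjoined), the only r-ideals are ∅_r and H, so (1) holds but (6) fails, U_b of a one-point space being infinite. *)

theory Defs
  imports "HOL-Analysis.Analysis" "HOL-Library.Set_Algebras" "HOL-Library.Extended_Real"
begin

text \<open>
  The monoid \<open>H\<close> is a type of class \<^class>\<open>comm_monoid_mult\<close>, so \<open>H = UNIV\<close>. Products of subsets
  are those of \<^theory>\<open>HOL-Library.Set_Algebras\<close>: \<open>A * B\<close> is the complex product \<open>AB\<close> and
  \<open>x *o A\<close> is \<open>xA\<close>.
\<close>

definition absorbing :: "'a::comm_monoid_mult set" where
  "absorbing = {z. \<forall>x. x * z = z}"

definition cancellative :: "'a::comm_monoid_mult \<Rightarrow> bool" where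
  "cancellative x \<longleftrightarrow> (\<forall>y z. x * y = x * z \<longrightarrow> y = z)"

definition ideal_system :: "('a::comm_monoid_mult set \<Rightarrow> 'a set) \<Rightarrow> bool" where
  "ideal_system r \<longleftrightarrow>
     (\<forall>X. X * UNIV \<union> absorbing \<subseteq> r X) \<and>
     (\<forall>X Y. X \<subseteq> r Y \<longrightarrow> r X \<subseteq> r Y) \<and>
     (\<forall>c X. c *o r X = r (c *o X))"

definition finitary :: "('a set \<Rightarrow> 'a set) \<Rightarrow> bool" where
  "finitary r \<longleftrightarrow> (\<forall>X. r X = (\<Union>E\<in>{E. E \<subseteq> X \<and> finite E}. r E))"

definition r_ideal :: "('a set \<Rightarrow> 'a set) \<Rightarrow> 'a set \<Rightarrow> bool" where
  "r_ideal r I \<longleftrightarrow> r I = I"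

definition modular :: "('a set \<Rightarrow> 'a set) \<Rightarrow> bool" where
  "modular r \<longleftrightarrow>
     (\<forall>I J N. r_ideal r I \<and> r_ideal r J \<and> r_ideal r N \<and> I \<subseteq> N \<longrightarrow>
        r (I \<union> J) \<inter> N \<subseteq> r (I \<union> (J \<inter> N)))"

text \<open>The empty product of subsets is \<open>{1}\<close>, so the empty \<open>r\<close>-product is \<open>r {1} = H\<close>.\<close>

definition r_prod :: "('a::comm_monoid_mult set \<Rightarrow> 'a set) \<Rightarrow> 'a set list \<Rightarrow> 'a set" where
  "r_prod r Js = r (prod_list Js)"

definition regular_elem :: "('a::comm_monoid_mult set \<Rightarrow> 'a set) \<Rightarrow> 'a \<Rightarrow> bool" where
  "regular_elem r x \<longleftrightarrow> cancellative x \<and> (\<forall>A. r (x *o A) = x *o r A)"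

definition nontrivial :: "'a::comm_monoid_mult set \<Rightarrow> bool" where
  "nontrivial I \<longleftrightarrow> absorbing \<subset> I"

definition regular_r_ideal :: "('a::comm_monoid_mult set \<Rightarrow> 'a set) \<Rightarrow> 'a set \<Rightarrow> bool" where
  "regular_r_ideal r I \<longleftrightarrow> r_ideal r I \<and> (\<exists>x\<in>I. regular_elem r x)"

definition r_invertible :: "('a::comm_monoid_mult set \<Rightarrow> 'a set) \<Rightarrow> 'a set \<Rightarrow> bool" where
  "r_invertible r I \<longleftrightarrow>
     r_ideal r I \<and> (\<exists>J y. regular_elem r y \<and> r (I * J) = y *o UNIV)"

definition r_fin_gen :: "('a set \<Rightarrow> 'a set) \<Rightarrow> 'a set \<Rightarrow> bool" where
  "r_fin_gen r I \<longleftrightarrow> r_ideal r I \<and> (\<exists>E. finite E \<and> E \<subseteq> I \<and> I = r E)"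

definition radical_r_ideal :: "('a::comm_monoid_mult set \<Rightarrow> 'a set) \<Rightarrow> 'a set \<Rightarrow> bool" where
  "radical_r_ideal r I \<longleftrightarrow> r_ideal r I \<and> (\<forall>x n. n \<ge> (1::nat) \<and> x ^ n \<in> I \<longrightarrow> x \<in> I)"

definition radical :: "'a::comm_monoid_mult set \<Rightarrow> 'a set" where
  "radical I = {x. \<exists>n\<ge>(1::nat). x ^ n \<in> I}"

definition prime_r_ideal :: "('a::comm_monoid_mult set \<Rightarrow> 'a set) \<Rightarrow> 'a set \<Rightarrow> bool" where
  "prime_r_ideal r P \<longleftrightarrow>
     r_ideal r P \<and> P \<noteq> UNIV \<and> (\<forall>x y. x * y \<in> P \<longrightarrow> x \<in> P \<or> y \<in> P)"

definition r_SP_monoid :: "('a::comm_monoid_mult set \<Rightarrow> 'a set) \<Rightarrow> bool" where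
  "r_SP_monoid r \<longleftrightarrow>
     (\<forall>I. r_ideal r I \<longrightarrow> (\<exists>Js. (\<forall>J\<in>set Js. radical_r_ideal r J) \<and> I = r_prod r Js))"

definition r_Prufer_monoid :: "('a::comm_monoid_mult set \<Rightarrow> 'a set) \<Rightarrow> bool" where
  "r_Prufer_monoid r \<longleftrightarrow> (\<forall>I. regular_r_ideal r I \<and> r_fin_gen r I \<longrightarrow> r_invertible r I)"

definition lattice_prime :: "('a::comm_monoid_mult set \<Rightarrow> 'a set) \<Rightarrow> 'a set \<Rightarrow> bool" where
  "lattice_prime r P \<longleftrightarrow>
     r_ideal r P \<and> P \<noteq> UNIV \<and>
     (\<forall>I J. r_ideal r I \<and> r_ideal r J \<and> r (I * J) \<subseteq> P \<longrightarrow> I \<subseteq> P \<or> J \<subseteq> P)"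

text \<open>
  Finite chains suffice, since an infinite chain has finite subchains of every size. The dimension
  is \<open>\<infinity>\<close> if the lengths of chains are unbounded and \<open>-1\<close> if there are no prime elements at all
  (this occurs when \<open>r {} = H\<close>), which is why it is extended real valued.
\<close>

definition r_dim :: "('a::comm_monoid_mult set \<Rightarrow> 'a set) \<Rightarrow> ereal" where
  "r_dim r =
     ereal_of_enat
       (SUP C\<in>{C. finite C \<and> (\<forall>P\<in>C. lattice_prime r P) \<and> (\<forall>P\<in>C. \<forall>Q\<in>C. P \<subseteq> Q \<or> Q \<subseteq> P)}.
          enat (card C)) - 1"

definition r_max :: "('a set \<Rightarrow> 'a set) \<Rightarrow> 'a set set" where
  "r_max r =
     {M. r_ideal r M \<and> M \<noteq> UNIV \<and> (\<forall>N. r_ideal r N \<and> N \<noteq> UNIV \<and> M \<subseteq> N \<longrightarrow> N = M)}"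

text \<open>
  The generating family is a base: it contains the whole space (take \<open>I = r {}\<close>), and the
  intersection of the members given by \<open>I = r E\<close> and \<open>J = r F\<close> is the one given by \<open>r (E \<union> F)\<close>.
\<close>

definition r_max_inv :: "('a set \<Rightarrow> 'a set) \<Rightarrow> 'a set topology" where
  "r_max_inv r = topology_generated_by {{M \<in> r_max r. I \<subseteq> M} | I. r_fin_gen r I}"

record 'c mult_lattice =
  elems :: "'c set"
  leq :: "'c \<Rightarrow> 'c \<Rightarrow> bool"
  mul :: "'c \<Rightarrow> 'c \<Rightarrow> 'c"
  top_unit :: 'c

definition mult_lattice_isomorphic :: "'c mult_lattice \<Rightarrow> 'd mult_lattice \<Rightarrow> bool" where
  "mult_lattice_isomorphic L K \<longleftrightarrow>
     (\<exists>\<phi>. bij_betw \<phi> (elems L) (elems K) \<and>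
        (\<forall>a\<in>elems L. \<forall>b\<in>elems L. leq L a b \<longleftrightarrow> leq K (\<phi> a) (\<phi> b)) \<and>
        (\<forall>a\<in>elems L. \<forall>b\<in>elems L. \<phi> (mul L a b) = mul K (\<phi> a) (\<phi> b)) \<and>
        \<phi> (top_unit L) = top_unit K)"

definition r_ideal_lattice :: "('a::comm_monoid_mult set \<Rightarrow> 'a set) \<Rightarrow> 'a set mult_lattice" where
  "r_ideal_lattice r =
     \<lparr>elems = {I. r_ideal r I}, leq = (\<subseteq>), mul = (\<lambda>I J. r (I * J)), top_unit = UNIV\<rparr>"

text \<open>
  A function on \<open>X\<close> is encoded by its extensional representative (the value off \<open>topspace X\<close> is
  fixed to be \<^const>\<open>undefined\<close>), so that equality is equality on \<open>X\<close>. Values are taken in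
  \<^typ>\<open>enat\<close> to accommodate the bottom element; since \<open>\<infinity> + m = \<infinity>\<close>, pointwise addition
  makes that element absorbing.
\<close>

definition usc_functions :: "'b topology \<Rightarrow> ('b \<Rightarrow> enat) set" where
  "usc_functions X =
     {f \<in> topspace X \<rightarrow>\<^sub>E range enat.
        \<forall>k\<ge>(1::nat). compactin X {x \<in> topspace X. enat k \<le> f x}}"

definition usc_bottom :: "'b topology \<Rightarrow> 'b \<Rightarrow> enat" where
  "usc_bottom X = (\<lambda>x\<in>topspace X. \<infinity>)"

definition usc_lattice :: "'b topology \<Rightarrow> ('b \<Rightarrow> enat) mult_lattice" where
  "usc_lattice X =
     \<lparr>elems = insert (usc_bottom X) (usc_functions X),
      leq = (\<lambda>f g. \<forall>x\<in>topspace X. f x \<ge> g x),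
      mul = (\<lambda>f g. \<lambda>x\<in>topspace X. f x + g x),
      top_unit = (\<lambda>x\<in>topspace X. 0)\<rparr>"

end

theory Submission
  imports Defs
begin

text \<open>
  Condition (3) is the hub. If nontrivial primes are maximal and contain invertible radical ideals,
  then each maximal \<open>M\<close> is locally generated by one element, because an invertible radical ideal
  inside \<open>M\<close> is locally principal and locally equal to \<open>M\<close>. So every \<open>M\<close> carries a discrete valuation,
  an ideal is determined by its orders at all \<open>M\<close>, products add orders, and radical ideals are those
  of order at most one. A nontrivial ideal \<open>I\<close> is then the product of the ideals
  \<open>J\<^sub>k = \<Inter>{M. k \<le> ord\<^sub>M I}\<close>, once it is known that \<open>J\<^sub>k \<subseteq> M\<close> only for \<open>k \<le> ord\<^sub>M I\<close>.

  Conversely let \<open>H\<close> be an \<open>r\<close>-SP-monoid, \<open>P \<subset> M\<close> nontrivial primes, \<open>y \<in> M - P\<close>, and \<open>N \<subseteq> M\<close> a minimal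
  prime over \<open>P \<union> {y}\<close>. If \<open>N\<close> is idempotent, then \<open>(P \<union> {y\<^sup>2})\<^sub>r\<close> is locally equal to \<open>N\<close>, and
  modularity cancels \<open>y\<close> from \<open>y \<in> (P \<union> {y\<^sup>2})\<^sub>r\<close>. Otherwise \<open>N\<close> is locally generated by any \<open>v \<in> N - N\<^sup>2\<close>,
  and an invertible radical ideal inside \<open>P\<close> would be divisible by \<open>v\<^sup>2\<close>.
\<close>

text \<open>The obstacle hidden in the claim about the \<open>J\<^sub>k\<close> is that infinitely
  many maximal ideals may have their intersection inside yet another one. It is overcome by a
  finitely generated witness: passing from an ideal to its residual by its own radical lowers every
  positive order by one, so enough rounds, starting from a principal ideal, give an ideal that lies
  in all members of a level but not in the additional \<open>M\<close>. For this, finitely generated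
  nontrivial ideals and their radicals have to be invertible, and that yields (5) and (7) as well.
  In (6) compactness of the level sets supplies the same closedness on the side of functions, so one
  construction both factors ideals and realizes functions as orders. The way from (5) to dimension
  one is an argument on squares: an element that locally generates a radical ideal is not locally
  divisible by the square of a nonunit. Localizations are contracted back to H, so no monoid of
  fractions and no ideal system on it ever appear.\<close>

definition localization :: "'a::comm_monoid_mult set \<Rightarrow> 'a set \<Rightarrow> 'a set" where
  "localization N I = {x. \<exists>s. s \<notin> N \<and> s * x \<in> I}"

text \<open>The colon ideal \<open>(I : X)\<close>, the adjoint of multiplication by
  \<open>X\<close>.\<close>

definition residual :: "'a::comm_monoid_mult set \<Rightarrow> 'a set \<Rightarrow> 'a set" where
  "residual I X = {h. \<forall>x\<in>X. h * x \<in> I}"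

lemma localization_mono: "I \<subseteq> J \<Longrightarrow> localization N I \<subseteq> localization N J"
  by (auto simp: localization_def)

lemma mem_elt_set_times_UNIV: "y \<in> x *o UNIV \<longleftrightarrow> (\<exists>h. y = x * h)"
  by (auto simp: elt_set_times_def)

lemma prod_list_remove1: "x \<in> set xs \<Longrightarrow> prod_list xs = x * prod_list (remove1 x xs)"
  for x :: "'b::comm_monoid_mult"
  by (induction xs) (auto simp: mult_ac)

section \<open>Closures, products and colon ideals\<close>

locale cancellative_ideal_system =
  fixes r :: "'a::comm_monoid_mult set \<Rightarrow> 'a set"
  assumes more_than_one: "\<exists>x y :: 'a. x \<noteq> y"
    and cancellative_monoid: "\<forall>x :: 'a. x \<notin> absorbing \<longrightarrow> cancellative x"
    and ideal_system: "ideal_system r"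
    and finitary: "finitary r"
begin

lemma closure_UNIV_mult: "x \<in> X \<Longrightarrow> h * x \<in> r X"
  using ideal_system unfolding ideal_system_def
  by (metis (no_types, lifting) UNIV_I Un_subset_iff mult.commute set_times_intro subsetD)

lemma closure_extensive: "X \<subseteq> r X"
  using closure_UNIV_mult[where h = 1] by auto

lemma absorbing_subset_closure: "absorbing \<subseteq> r X"
  using ideal_system unfolding ideal_system_def by blast

lemma closure_minimal: "X \<subseteq> r Y \<Longrightarrow> r X \<subseteq> r Y"
  using ideal_system unfolding ideal_system_def by blast

lemma closure_least: "r_ideal r I \<Longrightarrow> X \<subseteq> I \<Longrightarrow> r X \<subseteq> I"
  using closure_minimal unfolding r_ideal_def by metis

lemma r_ideal_closure [simp]: "r_ideal r (r X)"
  unfolding r_ideal_def using closure_minimal closure_extensive by (metis subset_antisym subset_refl)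

lemma closure_mono: "X \<subseteq> Y \<Longrightarrow> r X \<subseteq> r Y"
  by (meson closure_extensive closure_minimal subset_trans)

lemma r_idealI: "r X \<subseteq> X \<Longrightarrow> r_ideal r X"
  unfolding r_ideal_def using closure_extensive by blast

lemma closure_eq: "r_ideal r I \<Longrightarrow> r I = I"
  by (simp add: r_ideal_def)

lemma r_ideal_UNIV [simp]: "r_ideal r UNIV"
  by (rule r_idealI) auto

lemma closure_UNIV [simp]: "r UNIV = UNIV"
  by (rule closure_eq) simp

lemma closure_elt_times: "r (c *o X) = c *o r X"
  using ideal_system unfolding ideal_system_def by simp

lemma r_ideal_mult: "r_ideal r I \<Longrightarrow> x \<in> I \<Longrightarrow> h * x \<in> I"
  using closure_UNIV_mult closure_eq by metis

lemma r_ideal_mult_right: "r_ideal r I \<Longrightarrow> x \<in> I \<Longrightarrow> x * h \<in> I"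
  using r_ideal_mult by (metis mult.commute)

lemma absorbing_subset: "r_ideal r I \<Longrightarrow> absorbing \<subseteq> I"
  using absorbing_subset_closure closure_eq by metis

lemma r_ideal_eq_UNIV: "r_ideal r I \<Longrightarrow> 1 \<in> I \<Longrightarrow> I = UNIV"
  using r_ideal_mult[of I 1] by auto

lemma closure_singleton: "r {x} = x *o UNIV"
proof
  have "r_ideal r (x *o UNIV)"
    using closure_elt_times[of x UNIV] by (simp add: r_ideal_def)
  moreover have "{x} \<subseteq> x *o UNIV"
    using mem_elt_set_times_UNIV[of x x] by (metis empty_subsetI insert_subset mult_1_right)
  ultimately show "r {x} \<subseteq> x *o UNIV" by (rule closure_least)
  show "x *o UNIV \<subseteq> r {x}"
    using closure_UNIV_mult[of x "{x}"] by (auto simp: elt_set_times_def mult.commute)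
qed

lemma r_ideal_principal [simp]: "r_ideal r (x *o UNIV)"
  using closure_singleton r_ideal_closure by metis

lemma principal_subset: "r_ideal r I \<Longrightarrow> x *o UNIV \<subseteq> I \<longleftrightarrow> x \<in> I"
  by (metis closure_singleton closure_least closure_extensive empty_subsetI insert_subset subset_trans)

lemma r_ideal_elt_times: "r_ideal r I \<Longrightarrow> r_ideal r (c *o I)"
  using closure_elt_times[of c I] by (simp add: r_ideal_def)

lemma r_ideal_Inter: "(\<And>I. I \<in> \<A> \<Longrightarrow> r_ideal r I) \<Longrightarrow> r_ideal r (\<Inter>\<A>)"
  by (rule r_idealI) (metis Inter_lower Inter_greatest closure_least)

text \<open>For each \<open>x\<close> in \<open>X\<close>, axiom (C) turns \<open>x\<close> times
  the closure of the residual into the closure of a subset of \<open>I\<close>.\<close>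

lemma r_ideal_residual:
  assumes "r_ideal r I"
  shows "r_ideal r (residual I X)"
proof (rule r_idealI, rule subsetI)
  fix h assume h: "h \<in> r (residual I X)"
  show "h \<in> residual I X" unfolding residual_def
  proof (intro CollectI ballI)
    fix x assume x: "x \<in> X"
    have "x *o residual I X \<subseteq> I"
      using x by (auto simp: elt_set_times_def residual_def mult.commute)
    then have "r (x *o residual I X) \<subseteq> I" by (rule closure_least[OF assms])
    moreover have "x * h \<in> r (x *o residual I X)"
      using h closure_elt_times by auto
    ultimately show "h * x \<in> I" by (auto simp: mult.commute)
  qed
qed

lemma subset_residual_iff: "A \<subseteq> residual I B \<longleftrightarrow> A * B \<subseteq> (I :: 'a set)"
proof
  show "A \<subseteq> residual I B \<Longrightarrow> A * B \<subseteq> I"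
    unfolding residual_def by (blast elim: set_times_elim)
  show "A * B \<subseteq> I \<Longrightarrow> A \<subseteq> residual I B"
    unfolding residual_def by (blast intro: set_times_intro)
qed

text \<open>Two passes through \<open>subset_residual_iff\<close>, closing one factor at a time.
  Associativity of the r-product rests on this.\<close>

lemma closure_times_subset:
  assumes "r_ideal r I" "A * B \<subseteq> I"
  shows "r A * r B \<subseteq> I"
proof -
  have "r A \<subseteq> residual I B"
    using assms by (intro closure_least r_ideal_residual) (simp_all add: subset_residual_iff)
  then have "B \<subseteq> residual I (r A)" by (simp add: subset_residual_iff mult.commute)
  then have "r B \<subseteq> residual I (r A)" by (rule closure_least[OF r_ideal_residual[OF assms(1)]])
  then show ?thesis by (simp add: subset_residual_iff mult.commute)
qed

lemma closure_times: "r (r A * r B) = r (A * B)"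
proof
  show "r (r A * r B) \<subseteq> r (A * B)"
    by (intro closure_least closure_times_subset closure_extensive r_ideal_closure)
  show "r (A * B) \<subseteq> r (r A * r B)"
    by (intro closure_mono set_times_mono2 closure_extensive)
qed

lemma closure_times_left: "r (r A * B) = r (A * B)"
  by (metis closure_times closure_eq r_ideal_closure)

lemma closure_times_right: "r (A * r B) = r (A * B)"
  by (metis closure_times closure_eq r_ideal_closure)

lemma times_subset_left: "r_ideal r I \<Longrightarrow> I * J \<subseteq> I"
  by (auto elim!: set_times_elim intro: r_ideal_mult_right)

lemma closure_times_subset_left: "r_ideal r I \<Longrightarrow> r (I * J) \<subseteq> I"
  by (intro closure_least times_subset_left)

lemma closure_times_subset_right: "r_ideal r J \<Longrightarrow> r (I * J) \<subseteq> J"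
  using closure_times_subset_left by (metis mult.commute)

lemma mult_mem_closure_times: "x \<in> A \<Longrightarrow> y \<in> B \<Longrightarrow> x * y \<in> r (A * B)"
  by (meson closure_extensive set_times_intro subsetD)

lemma closure_one: "r 1 = UNIV"
  using r_ideal_eq_UNIV[of "r 1"] closure_extensive[of 1] by auto

lemma mem_closure_finite: "x \<in> r X \<longleftrightarrow> (\<exists>E. finite E \<and> E \<subseteq> X \<and> x \<in> r E)"
  using finitary unfolding finitary_def by blast

text \<open>By finitarity a closure element needs only finitely many generators, and these lie in
  one member of the chain.\<close>

lemma r_ideal_Union_chain:
  assumes "\<A> \<noteq> {}" "\<And>I. I \<in> \<A> \<Longrightarrow> r_ideal r I"
    and chain: "\<And>I J. I \<in> \<A> \<Longrightarrow> J \<in> \<A> \<Longrightarrow> I \<subseteq> J \<or> J \<subseteq> I"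
  shows "r_ideal r (\<Union>\<A>)"
proof (rule r_idealI, rule subsetI)
  fix x assume "x \<in> r (\<Union>\<A>)"
  then obtain E where E: "finite E" "E \<subseteq> \<Union>\<A>" "x \<in> r E"
    by (auto simp: mem_closure_finite[of x "\<Union>\<A>"])
  have "\<exists>I\<in>\<A>. E \<subseteq> I"
    using E(1,2)
  proof (induction E rule: finite_induct)
    case empty
    then show ?case using assms(1) by auto
  next
    case (insert e E)
    then obtain I J where "I \<in> \<A>" "E \<subseteq> I" "J \<in> \<A>" "e \<in> J" by auto
    then show ?case using chain[of I J] by blast
  qed
  then show "x \<in> \<Union>\<A>" using E(3) closure_least assms(2) by blast
qed

section \<open>Cancellation and absorbing elements\<close>

lemma mult_cancel: "x \<notin> absorbing \<Longrightarrow> x * y = x * z \<longleftrightarrow> y = (z::'a)"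
  using cancellative_monoid unfolding cancellative_def by blast

text \<open>Regular elements are exactly the non-absorbing ones, because axiom (C) holds for all of \<open>H\<close>.\<close>

lemma regular_elem_iff: "regular_elem r x \<longleftrightarrow> x \<notin> absorbing"
proof
  assume "regular_elem r x"
  then have c: "\<And>y z. x * y = x * z \<Longrightarrow> y = z" unfolding regular_elem_def cancellative_def by blast
  show "x \<notin> absorbing"
  proof
    assume "x \<in> absorbing"
    then have "y * x = x" for y by (simp add: absorbing_def)
    then have "x * y = x * z" for y z by (metis mult.commute)
    then show False using c more_than_one by blast
  qed
next
  assume "x \<notin> absorbing"
  then show "regular_elem r x"
    using cancellative_monoid closure_elt_times by (auto simp: regular_elem_def)
qed

lemma mult_mem_absorbing: "x * y \<in> absorbing \<longleftrightarrow> x \<in> absorbing \<or> (y::'a) \<in> absorbing"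
proof
  assume xy: "x * y \<in> absorbing"
  show "x \<in> absorbing \<or> y \<in> absorbing"
  proof (rule ccontr)
    assume n: "\<not> ?thesis"
    have "x * (y * h) = x * y" for h using xy by (simp add: absorbing_def mult_ac)
    then have "y * h = y" for h using n mult_cancel by blast
    then have "y \<in> absorbing" by (auto simp: absorbing_def) (metis mult.commute)
    then show False using n by simp
  qed
next
  have "a * b \<in> absorbing" if a: "a \<in> absorbing" for a b :: 'a
  proof -
    have "b * a = a" using a by (simp add: absorbing_def)
    then show ?thesis using a by (simp add: mult.commute)
  qed
  then show "x \<in> absorbing \<or> y \<in> absorbing \<Longrightarrow> x * y \<in> absorbing"
    by (metis mult.commute)
qed

lemma one_not_absorbing: "(1::'a) \<notin> absorbing"
proof
  assume "(1::'a) \<in> absorbing"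
  then have "\<And>y. y = (1::'a)" by (simp add: absorbing_def)
  then show False using more_than_one by metis
qed

lemma power_mem_absorbing: "x ^ n \<in> absorbing \<Longrightarrow> (x::'a) \<in> absorbing"
  by (induction n) (auto simp: mult_mem_absorbing one_not_absorbing)

text \<open>Axiom (C) gives \<open>d *o r {} = r {}\<close>. A non-absorbing \<open>d\<close> in
  \<open>r {}\<close> is then \<open>d * e\<close> with \<open>e\<close> in \<open>r {}\<close>, and
  cancellation leaves \<open>e = 1\<close>.\<close>

lemma closure_empty: "r {} = absorbing \<or> r {} = UNIV"
proof (cases "r {} \<subseteq> absorbing")
  case True
  then show ?thesis using absorbing_subset_closure by blast
next
  case False
  then obtain d where d: "d \<in> r {}" "d \<notin> absorbing" by blast
  have "d *o r {} = r {}" using closure_elt_times[of d "{}"] by (simp add: elt_set_times_def)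
  then obtain e where "e \<in> r {}" "d = d * e" using d by (auto simp: elt_set_times_def)
  then have "1 \<in> r {}" using mult_cancel[OF d(2), of 1 e] by auto
  then show ?thesis using r_ideal_eq_UNIV[OF r_ideal_closure] by blast
qed

lemma nontrivial_iff: "r_ideal r I \<Longrightarrow> nontrivial I \<longleftrightarrow> (\<exists>x\<in>I. x \<notin> absorbing)"
  using absorbing_subset unfolding nontrivial_def by blast

lemma nontrivial_mono: "nontrivial I \<Longrightarrow> I \<subseteq> J \<Longrightarrow> nontrivial J"
  unfolding nontrivial_def by blast

lemma not_nontrivial: "r_ideal r I \<Longrightarrow> \<not> nontrivial I \<Longrightarrow> I = absorbing"
  using absorbing_subset unfolding nontrivial_def by blast

lemma nontrivial_UNIV: "nontrivial (UNIV::'a set)"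
  using one_not_absorbing by (auto simp: nontrivial_def)

lemma nontrivial_principal: "x \<notin> absorbing \<Longrightarrow> nontrivial (x *o (UNIV::'a set))"
  by (metis nontrivial_iff r_ideal_principal principal_subset subset_refl)

lemma nontrivial_times:
  assumes "r_ideal r I" "r_ideal r J" "nontrivial I" "nontrivial J"
  shows "nontrivial (r (I * J))"
  using assms mult_mem_closure_times mult_mem_absorbing by (metis nontrivial_iff r_ideal_closure)

section \<open>Radical ideals\<close>

lemma radical_trivial: "radical (absorbing :: 'a set) = absorbing"
  using power_mem_absorbing by (auto simp: radical_def intro: exI[of _ 1])

lemma subset_radical: "I \<subseteq> radical I"
  by (auto simp: radical_def intro!: exI[of _ 1])

lemma radical_r_ideal_trivial: "r_ideal r (absorbing) \<Longrightarrow> radical_r_ideal r absorbing"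
  using power_mem_absorbing by (auto simp: radical_r_ideal_def)

lemma radical_r_ideal_UNIV: "radical_r_ideal r UNIV"
  by (auto simp: radical_r_ideal_def)

lemma radical_r_ideal_closure_empty: "radical_r_ideal r (r {})"
  using closure_empty radical_r_ideal_trivial radical_r_ideal_UNIV r_ideal_closure by metis

lemma radical_r_idealD: "radical_r_ideal r J \<Longrightarrow> x ^ n \<in> J \<Longrightarrow> x \<in> J"
proof (cases "n = 0")
  assume "radical_r_ideal r J" "x ^ n \<in> J" "n = 0"
  then show "x \<in> J" using r_ideal_eq_UNIV by (auto simp: radical_r_ideal_def)
qed (auto simp: radical_r_ideal_def Suc_le_eq)

lemma radical_least: "radical_r_ideal r J \<Longrightarrow> I \<subseteq> J \<Longrightarrow> radical I \<subseteq> J"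
  by (auto simp: radical_def intro: radical_r_idealD)

section \<open>Prime and maximal ideals\<close>

lemma prime_r_idealD: "prime_r_ideal r P \<Longrightarrow> r_ideal r P"
  by (simp add: prime_r_ideal_def)

lemma one_notin_prime: "prime_r_ideal r P \<Longrightarrow> 1 \<notin> P"
  using r_ideal_eq_UNIV by (auto simp: prime_r_ideal_def)

lemma prime_mult_iff: "prime_r_ideal r P \<Longrightarrow> x * y \<in> P \<longleftrightarrow> x \<in> P \<or> y \<in> P"
  by (metis prime_r_ideal_def r_ideal_mult r_ideal_mult_right)

lemma prime_power: "prime_r_ideal r P \<Longrightarrow> x ^ n \<in> P \<Longrightarrow> x \<in> P"
  by (induction n) (auto simp: one_notin_prime prime_mult_iff)

lemma prime_radical_r_ideal: "prime_r_ideal r P \<Longrightarrow> radical_r_ideal r P"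
  using prime_power by (auto simp: radical_r_ideal_def prime_r_idealD)

lemma prime_times: 
  assumes "prime_r_ideal r P" "A * B \<subseteq> P"
  shows "A \<subseteq> P \<or> B \<subseteq> P"
proof (rule ccontr)
  assume "\<not> ?thesis"
  then obtain a b where "a \<in> A" "b \<in> B" "a \<notin> P" "b \<notin> P" by auto
  then show False using assms prime_mult_iff by (metis set_times_intro subsetD)
qed

lemma prime_prod_list:
  "prime_r_ideal r P \<Longrightarrow> prod_list Js \<subseteq> P \<Longrightarrow> \<exists>J\<in>set Js. J \<subseteq> P"
proof (induction Js)
  case Nil
  then show ?case using one_notin_prime by auto
next
  case (Cons J Js)
  then show ?case using prime_times[of P J "prod_list Js"] by auto
qed

text \<open>The set \<open>S\<close> is left general: \<open>{1}\<close> yields maximal ideals, the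
  powers of \<open>x\<close> yield radicals, and the elements \<open>s * v ^ k\<close> yield the
  local nilpotence in \<open>minimal_prime_localization\<close>.\<close>

lemma exists_maximal_disjoint:
  assumes "r_ideal r I" "I \<inter> S = {}"
  obtains P where "r_ideal r P" "I \<subseteq> P" "P \<inter> S = {}"
    "\<And>Q. r_ideal r Q \<Longrightarrow> P \<subseteq> Q \<Longrightarrow> Q \<inter> S = {} \<Longrightarrow> Q = P"
proof -
  define \<A> where "\<A> = {Q. r_ideal r Q \<and> I \<subseteq> Q \<and> Q \<inter> S = {}}"
  have "\<exists>M\<in>\<A>. \<forall>Q\<in>\<A>. M \<subseteq> Q \<longrightarrow> Q = M"
  proof (rule subset_Zorn_nonempty)
    show "\<A> \<noteq> {}" using assms by (auto simp: \<A>_def)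
    fix C assume "C \<noteq> {}" and C: "subset.chain \<A> C"
    then have "r_ideal r (\<Union>C)"
      by (intro r_ideal_Union_chain) (auto simp: \<A>_def subset_chain_def)
    then show "\<Union>C \<in> \<A>" using C \<open>C \<noteq> {}\<close> by (auto simp: \<A>_def subset_chain_def)
  qed
  then obtain M where M: "M \<in> \<A>" "\<And>Q. Q \<in> \<A> \<Longrightarrow> M \<subseteq> Q \<Longrightarrow> Q = M" by metis
  then have "Q = M" if "r_ideal r Q" "M \<subseteq> Q" "Q \<inter> S = {}" for Q
    using that by (auto simp: \<A>_def)
  then show ?thesis using that[of M] M(1) by (simp add: \<A>_def)
qed

text \<open>If neither \<open>x\<close> nor \<open>y\<close> were in \<open>P\<close>, adjoining
  either would make the ideal meet \<open>S\<close>; the product of the two meeting points lies in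
  \<open>P\<close> because \<open>x * y\<close> does.\<close>

lemma maximal_disjoint_prime:
  assumes P: "r_ideal r P" "P \<inter> S = {}"
    and S: "1 \<in> S" "\<And>s t. s \<in> S \<Longrightarrow> t \<in> S \<Longrightarrow> s * t \<in> S"
    and max: "\<And>Q. r_ideal r Q \<Longrightarrow> P \<subseteq> Q \<Longrightarrow> Q \<inter> S = {} \<Longrightarrow> Q = P"
  shows "prime_r_ideal r P"
  unfolding prime_r_ideal_def
proof (intro conjI allI impI P(1))
  show "P \<noteq> UNIV" using P(2) S(1) by auto
  fix x y assume xy: "x * y \<in> P"
  have *: "\<exists>s\<in>S. s \<in> r (insert z P)" if "z \<notin> P" for z
  proof (rule ccontr)
    assume "\<not> ?thesis"
    then have "r (insert z P) = P"
      using closure_extensive[of "insert z P"] by (intro max) auto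
    then show False using that closure_extensive[of "insert z P"] by auto
  qed
  show "x \<in> P \<or> y \<in> P"
  proof (rule ccontr)
    assume "\<not> ?thesis"
    then obtain s t where st: "s \<in> S" "t \<in> S" "s \<in> r (insert x P)" "t \<in> r (insert y P)"
      using * by metis
    have "insert x P * insert y P \<subseteq> P"
      using xy r_ideal_mult[OF P(1)] r_ideal_mult_right[OF P(1)]
      by (auto elim!: set_times_elim)
    then have "r (insert x P) * r (insert y P) \<subseteq> P" by (rule closure_times_subset[OF P(1)])
    then have "s * t \<in> P" using st by (meson set_times_intro subsetD)
    then show False using S(2) st P(2) by blast
  qed
qed

lemma exists_prime_disjoint:
  assumes "r_ideal r I" "I \<inter> S = {}" "1 \<in> S" "\<And>s t. s \<in> S \<Longrightarrow> t \<in> S \<Longrightarrow> s * t \<in> S"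
  obtains P where "prime_r_ideal r P" "I \<subseteq> P" "P \<inter> S = {}"
proof -
  obtain P where P: "r_ideal r P" "I \<subseteq> P" "P \<inter> S = {}"
    "\<And>Q. r_ideal r Q \<Longrightarrow> P \<subseteq> Q \<Longrightarrow> Q \<inter> S = {} \<Longrightarrow> Q = P"
    using exists_maximal_disjoint[OF assms(1,2)] by metis
  moreover have "prime_r_ideal r P"
    by (rule maximal_disjoint_prime[OF P(1,3) assms(3,4) P(4)])
  ultimately show ?thesis using that by blast
qed

lemma exists_r_max:
  assumes "r_ideal r I" "I \<noteq> UNIV"
  obtains M where "M \<in> r_max r" "I \<subseteq> M"
proof -
  have "I \<inter> {1} = {}" using assms r_ideal_eq_UNIV by auto
  then obtain P where "r_ideal r P" "I \<subseteq> P" "P \<inter> {1} = {}"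
    "\<And>Q. r_ideal r Q \<Longrightarrow> P \<subseteq> Q \<Longrightarrow> Q \<inter> {1} = {} \<Longrightarrow> Q = P"
    using exists_maximal_disjoint[OF assms(1)] by metis
  then have "P \<in> r_max r" using r_ideal_eq_UNIV by (auto simp: r_max_def)
  then show ?thesis using that \<open>I \<subseteq> P\<close> by blast
qed

lemma r_max_prime:
  assumes "M \<in> r_max r"
  shows "prime_r_ideal r M"
proof (rule maximal_disjoint_prime[where S = "{1}"])
  show "M \<inter> {1} = {}" using assms r_ideal_eq_UNIV by (auto simp: r_max_def)
qed (use assms in \<open>auto simp: r_max_def\<close>)

text \<open>A prime avoiding the powers of \<open>x\<close> separates \<open>x\<close> from
  \<open>I\<close>. This is how radicals are seen to be r-ideals.\<close>

lemma radical_eq_Inter_primes: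
  assumes "r_ideal r I"
  shows "radical I = \<Inter>{P. prime_r_ideal r P \<and> I \<subseteq> P}"
proof
  show "radical I \<subseteq> \<Inter>{P. prime_r_ideal r P \<and> I \<subseteq> P}"
    using prime_power by (auto simp: radical_def)
  show "\<Inter>{P. prime_r_ideal r P \<and> I \<subseteq> P} \<subseteq> radical I"
  proof (rule subsetI, rule ccontr)
    fix x assume x: "x \<in> \<Inter>{P. prime_r_ideal r P \<and> I \<subseteq> P}" "x \<notin> radical I"
    \<comment> \<open>The exponent 0 is not covered by \<open>radical\<close>, hence the passage to
      \<open>Suc n\<close>.\<close>
    have n: "x ^ n \<notin> I" for n
    proof
      assume n: "x ^ n \<in> I"
      then have "x ^ Suc n \<in> I" using r_ideal_mult assms by simp
      then show False using x(2) by (auto simp: radical_def intro: exI[of _ "Suc n"])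
    qed
    have "I \<inter> range (\<lambda>n. x ^ n) = {}" using n by auto
    moreover have "1 \<in> range (\<lambda>n. x ^ n)" by (metis power_0 rangeI)
    moreover have "s * t \<in> range (\<lambda>n. x ^ n)"
      if "s \<in> range (\<lambda>n. x ^ n)" "t \<in> range (\<lambda>n. x ^ n)" for s t
      using that by (auto simp: power_add[symmetric])
    ultimately obtain P where P: "prime_r_ideal r P" "I \<subseteq> P" "P \<inter> range (\<lambda>n. x ^ n) = {}"
      using exists_prime_disjoint[OF assms] by metis
    have "x \<in> P" using x P by auto
    moreover have "x \<in> range (\<lambda>n. x ^ n)" by (metis power_one_right rangeI)
    ultimately show False using P(3) by auto
  qed
qed

lemma radical_r_ideal_radical: 
  assumes "r_ideal r I"
  shows "radical_r_ideal r (radical I)"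
  unfolding radical_r_ideal_def radical_eq_Inter_primes[OF assms]
proof (intro conjI allI impI)
  show "r_ideal r (\<Inter>{P. prime_r_ideal r P \<and> I \<subseteq> P})"
    by (rule r_ideal_Inter) (auto dest: prime_r_idealD)
qed (use prime_power in blast)

lemma exists_minimal_prime:
  assumes M: "prime_r_ideal r M" "I \<subseteq> M"
  obtains N where "prime_r_ideal r N" "I \<subseteq> N" "N \<subseteq> M"
    "\<And>P. prime_r_ideal r P \<Longrightarrow> I \<subseteq> P \<Longrightarrow> P \<subseteq> N \<Longrightarrow> P = N"
proof -
  \<comment> \<open>Complements turn the search for a minimal prime into one for a maximal
    element.\<close>
  let ?\<A> = "{- Q | Q. prime_r_ideal r Q \<and> I \<subseteq> Q \<and> Q \<subseteq> M}"
  have "\<exists>N\<in>?\<A>. \<forall>Q\<in>?\<A>. N \<subseteq> Q \<longrightarrow> Q = N"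
  proof (rule subset_Zorn_nonempty)
    show "?\<A> \<noteq> {}" using M by auto
    fix C assume ne: "C \<noteq> {}" and C: "subset.chain ?\<A> C"
    define Q where "Q = - (\<Union>C)"
    have Cp: "\<And>X. X \<in> C \<Longrightarrow> prime_r_ideal r (- X) \<and> I \<subseteq> - X \<and> - X \<subseteq> M"
      using C by (force simp: subset_chain_def)
    have "Q = \<Inter>(uminus ` C)" by (auto simp: Q_def)
    moreover have "r_ideal r J" if "J \<in> uminus ` C" for J
      using that Cp prime_r_idealD by blast
    ultimately have ri: "r_ideal r Q" using r_ideal_Inter by metis
    have "prime_r_ideal r Q" unfolding prime_r_ideal_def
    proof (intro conjI allI impI ri)
      obtain X where "X \<in> C" using ne by blast
      then have "1 \<in> X" using one_notin_prime[of "- X"] Cp by auto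
      then show "Q \<noteq> UNIV" using \<open>X \<in> C\<close> by (auto simp: Q_def)
    next
      fix x y assume xy: "x * y \<in> Q"
      show "x \<in> Q \<or> y \<in> Q"
      proof (rule ccontr)
        assume "\<not> ?thesis"
        then have "x \<in> \<Union>C" "y \<in> \<Union>C" unfolding Q_def by simp_all
        then obtain X Y where XY: "X \<in> C" "Y \<in> C" "x \<in> X" "y \<in> Y" by (elim UnionE)
        \<comment> \<open>The larger of the two contains both \<open>x\<close> and \<open>y\<close>,
          and its complement is a prime that contains \<open>x * y\<close>.\<close>
        then have "X \<subseteq> Y \<or> Y \<subseteq> X" using C unfolding subset_chain_def by metis
        then obtain Z where "Z \<in> C" "x \<in> Z" "y \<in> Z" using XY by (meson subsetD)
        then show False using Cp[of Z] xy prime_mult_iff[of "- Z" x y] by (auto simp: Q_def)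
      qed
    qed
    moreover have "I \<subseteq> Q" "Q \<subseteq> M" using Cp ne unfolding Q_def by blast+
    ultimately show "\<Union>C \<in> ?\<A>" by (auto simp: Q_def intro!: exI[of _ Q])
  qed
  then obtain N where N: "prime_r_ideal r N" "I \<subseteq> N" "N \<subseteq> M"
    and max: "\<forall>Q\<in>?\<A>. - N \<subseteq> Q \<longrightarrow> Q = - N" by auto
  have "P = N" if P: "prime_r_ideal r P" "I \<subseteq> P" "P \<subseteq> N" for P
  proof -
    have "- P \<in> ?\<A>" using P N by auto
    then have "- P = - N" using max P by auto
    then show ?thesis by auto
  qed
  then show ?thesis using that N by blast
qed

section \<open>Localization\<close>

lemma subset_localization: "prime_r_ideal r N \<Longrightarrow> I \<subseteq> localization N I"
  using one_notin_prime by (force simp: localization_def)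

text \<open>Finitarity reduces to a finite set of generators, whose denominators multiply to a
  common one outside the prime \<open>N\<close>.\<close>

lemma r_ideal_localization:
  assumes N: "prime_r_ideal r N" and I: "r_ideal r I"
  shows "r_ideal r (localization N I)"
proof (rule r_idealI, rule subsetI)
  fix x assume "x \<in> r (localization N I)"
  then obtain E where E: "finite E" "E \<subseteq> localization N I" "x \<in> r E"
    using mem_closure_finite[of x "localization N I"] by auto
  have "\<exists>s. s \<notin> N \<and> s *o E \<subseteq> I"
    using E(1,2)
  proof (induction E rule: finite_induct)
    case empty
    then show ?case using one_notin_prime[OF N] by (auto simp: elt_set_times_def)
  next
    case (insert e E)
    then obtain s t where st: "s \<notin> N" "s *o E \<subseteq> I" "t \<notin> N" "t * e \<in> I"
      by (auto simp: localization_def)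
    have "(s * t) *o insert e E \<subseteq> I"
    proof
      fix z assume "z \<in> (s * t) *o insert e E"
      then obtain b where b: "b = e \<or> b \<in> E" "z = s * t * b" by (auto simp: elt_set_times_def)
      then show "z \<in> I"
      proof (elim disjE)
        assume "b \<in> E"
        then have "t * (s * b) \<in> I" using r_ideal_mult[OF I] st(2) by auto
        then show "z \<in> I" using b by (simp add: mult_ac)
      next
        assume "b = e"
        then show "z \<in> I" using b r_ideal_mult[OF I st(4), of s] by (simp add: mult_ac)
      qed
    qed
    moreover have "s * t \<notin> N" using st prime_mult_iff[OF N] by blast
    ultimately show ?case by blast
  qed
  then obtain s where s: "s \<notin> N" "s *o E \<subseteq> I" by blast
  have "s * x \<in> r (s *o E)" using E(3) closure_elt_times by (auto simp: elt_set_times_def)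
  then show "x \<in> localization N I" using s closure_least[OF I s(2)] by (auto simp: localization_def)
qed

lemma localization_idem: 
  assumes "prime_r_ideal r N"
  shows "localization N (localization N I) = localization N I"
proof
  show "localization N (localization N I) \<subseteq> localization N I"
  proof
    fix x assume "x \<in> localization N (localization N I)"
    then obtain s t where "s \<notin> N" "t \<notin> N" "t * (s * x) \<in> I" by (auto simp: localization_def)
    then show "x \<in> localization N I"
      using prime_mult_iff[OF assms] by (auto simp: localization_def mult.assoc intro!: exI[of _ "t * s"])
  qed
qed (rule subset_localization[OF assms])

lemma localization_prime: "prime_r_ideal r P \<Longrightarrow> P \<subseteq> N \<Longrightarrow> localization N P \<subseteq> P"
  using prime_mult_iff by (auto simp: localization_def)

lemma localization_times:
  assumes N: "prime_r_ideal r N" and "A \<subseteq> localization N I" "B \<subseteq> localization N J"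
  shows "r (A * B) \<subseteq> localization N (r (I * J))"
proof (rule closure_least)
  show "r_ideal r (localization N (r (I * J)))" by (simp add: N r_ideal_localization)
  show "A * B \<subseteq> localization N (r (I * J))"
  proof
    fix z assume "z \<in> A * B"
    then obtain x y where xy: "x \<in> A" "y \<in> B" "z = x * y" by (rule set_times_elim)
    then obtain s t where "s \<notin> N" "s * x \<in> I" "t \<notin> N" "t * y \<in> J"
      using assms(2,3) unfolding localization_def by blast
    moreover have "s * t * z = (s * x) * (t * y)" using xy by (simp add: mult_ac)
    ultimately show "z \<in> localization N (r (I * J))"
      using mult_mem_closure_times prime_mult_iff[OF N]
      by (auto simp: localization_def intro!: exI[of _ "s * t"])
  qed
qed

text \<open>The possible denominators of \<open>x\<close> form the ideal
  \<open>residual I {x}\<close>. If it is proper, a maximal ideal above it admits none of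
  them.\<close>

lemma mem_if_locally_mem:
  assumes I: "r_ideal r I" and loc: "\<And>M. M \<in> r_max r \<Longrightarrow> x \<in> localization M I"
  shows "x \<in> I"
proof (rule ccontr)
  assume x: "x \<notin> I"
  then have "1 \<notin> residual I {x}" by (simp add: residual_def)
  then have "residual I {x} \<noteq> UNIV" by blast
  then obtain M where M: "M \<in> r_max r" "residual I {x} \<subseteq> M"
    using exists_r_max r_ideal_residual[OF I] by metis
  then show False using loc[OF M(1)] by (auto simp: residual_def localization_def)
qed

text \<open>Otherwise some prime above \<open>I\<close> avoids all \<open>s * v ^ k\<close> with
  \<open>s\<close> outside \<open>N\<close>. The case \<open>k = 0\<close> puts it inside
  \<open>N\<close>, so by minimality it is \<open>N\<close>, although it misses
  \<open>v\<close>.\<close>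

lemma minimal_prime_localization:
  assumes N: "prime_r_ideal r N" and I: "r_ideal r I"
    and min: "\<And>P. prime_r_ideal r P \<Longrightarrow> I \<subseteq> P \<Longrightarrow> P \<subseteq> N \<Longrightarrow> P = N" and v: "v \<in> N"
  shows "\<exists>k. v ^ k \<in> localization N I"
proof (rule ccontr)
  assume n: "\<not> ?thesis"
  let ?S = "{s * v ^ k | s k. s \<notin> N}"
  have dis: "I \<inter> ?S = {}" using n by (auto simp: localization_def)
  have one: "1 \<in> ?S" using one_notin_prime[OF N] by (auto intro!: exI[of _ 1] exI[of _ 0])
  have mult: "x * y \<in> ?S" if xy: "x \<in> ?S" "y \<in> ?S" for x y
  proof -
    obtain s t k l where "s \<notin> N" "t \<notin> N" "x = s * v ^ k" "y = t * v ^ l" using xy by auto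
    then show ?thesis using prime_mult_iff[OF N]
      by (auto simp: power_add mult_ac intro!: exI[of _ "s * t"] exI[of _ "k + l"])
  qed
  obtain P where P: "prime_r_ideal r P" "I \<subseteq> P" "P \<inter> ?S = {}"
    by (rule exists_prime_disjoint[OF I dis one mult])
  have "P \<subseteq> N"
  proof
    fix s assume "s \<in> P"
    then have "s * v ^ 0 \<notin> ?S" using P(3) by auto
    then show "s \<in> N" by blast
  qed
  then have "v \<in> P" using min P v by blast
  moreover have "1 * v ^ 1 \<in> ?S" using one_notin_prime[OF N] by blast
  ultimately show False using P(3) by auto
qed

lemma minimal_prime_radical_localization:
  assumes N: "prime_r_ideal r N" and J: "radical_r_ideal r J"
    and min: "\<And>P. prime_r_ideal r P \<Longrightarrow> J \<subseteq> P \<Longrightarrow> P \<subseteq> N \<Longrightarrow> P = N"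
  shows "N \<subseteq> localization N J"
proof
  fix v assume v: "v \<in> N"
  have JI: "r_ideal r J" using J by (simp add: radical_r_ideal_def)
  obtain k s where s: "s \<notin> N" "s * v ^ k \<in> J"
    using minimal_prime_localization[OF N JI min v] by (auto simp: localization_def)
  \<comment> \<open>Raising the denominator to a power along with \<open>v\<close> lets radicality
    act on \<open>s * v\<close> itself.\<close>
  have "(s * v) ^ Suc k = (s ^ k * v) * (s * v ^ k)"
    by (simp add: power_mult_distrib mult_ac)
  then have "(s * v) ^ Suc k \<in> J" using r_ideal_mult[OF JI s(2)] by simp
  then have "s * v \<in> J" by (rule radical_r_idealD[OF J])
  then show "v \<in> localization N J" using s by (auto simp: localization_def)
qed

section \<open>Invertible ideals\<close>

lemma r_invertible_iff:
  "r_invertible r I \<longleftrightarrow> r_ideal r I \<and> (\<exists>J y. y \<notin> absorbing \<and> r (I * J) = y *o UNIV)"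
  by (simp add: r_invertible_def regular_elem_iff)

lemma r_invertible_r_ideal: "r_invertible r I \<Longrightarrow> r_ideal r I"
  by (simp add: r_invertible_iff)

lemma r_invertible_principal: "x \<notin> absorbing \<Longrightarrow> r_invertible r (x *o UNIV)"
proof -
  assume "x \<notin> absorbing"
  moreover have "r ((x *o UNIV) * 1) = x *o UNIV" using closure_eq by (metis mult_1_right r_ideal_principal)
  ultimately show ?thesis unfolding r_invertible_iff using r_ideal_principal by blast
qed

lemma r_invertible_factor:
  assumes "r_invertible r (r (I * A))" "r_ideal r I"
  shows "r_invertible r I"
proof -
  obtain K y where "y \<notin> absorbing" "r (r (I * A) * K) = y *o UNIV"
    using assms(1) by (auto simp: r_invertible_iff)
  then have "r (I * (A * K)) = y *o UNIV" by (simp add: closure_times_left mult.assoc)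
  then show ?thesis using \<open>y \<notin> absorbing\<close> assms(2) by (auto simp: r_invertible_iff)
qed

lemma r_invertible_prod_list_factor:
  assumes "r_invertible r (r_prod r Js)" "J \<in> set Js" "r_ideal r J"
  shows "r_invertible r J"
proof -
  have "prod_list Js = J * prod_list (remove1 J Js)"
    using assms(2) by (rule prod_list_remove1)
  then show ?thesis using assms r_invertible_factor by (simp add: r_prod_def)
qed

text \<open>
  In \<open>(IJ)\<^sub>r = yH\<close> not all products lie in \<open>yN\<close>; a product \<open>ij\<close> outside \<open>yN\<close> exhibits \<open>i\<close> as a
  local generator.
\<close>

lemma r_invertible_locally_principal:
  assumes I: "r_invertible r I" and N: "prime_r_ideal r N"
  obtains i where "i \<in> I" "i \<notin> absorbing" "I \<subseteq> localization N (i *o UNIV)"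
proof -
  obtain J y where y: "y \<notin> absorbing" "r (I * J) = y *o UNIV"
    using I by (auto simp: r_invertible_iff)
  have sub: "\<exists>h. i * j = y * h" if "i \<in> I" "j \<in> J" for i j
    using mult_mem_closure_times[OF that] unfolding y(2) by (simp add: mem_elt_set_times_UNIV)
  have "\<exists>i\<in>I. \<exists>j\<in>J. i * j \<notin> y *o N"
  proof (rule ccontr)
    assume "\<not> ?thesis"
    \<comment> \<open>By (C) \<open>y *o N\<close> is an r-ideal, so it would contain
      \<open>y *o UNIV\<close>, and cancelling \<open>y\<close> would put 1 into
      \<open>N\<close>.\<close>
    then have "I * J \<subseteq> y *o N" by (auto elim!: set_times_elim)
    then have "y *o UNIV \<subseteq> y *o N"
      using closure_least[OF r_ideal_elt_times[OF prime_r_idealD[OF N]], of "I * J" y] y(2) by simp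
    then have "y * 1 \<in> y *o N" by (metis mem_elt_set_times_UNIV subsetD)
    then obtain b where "b \<in> N" "y * 1 = y * b" by (auto simp: elt_set_times_def)
    then show False using mult_cancel[OF y(1), of 1 b] one_notin_prime[OF N] by metis
  qed
  then obtain i j where ij: "i \<in> I" "j \<in> J" "i * j \<notin> y *o N" by blast
  then obtain t where t: "i * j = y * t" using sub by blast
  have tN: "t \<notin> N" using t ij(3) by (auto simp: elt_set_times_def)
  have "I \<subseteq> localization N (i *o UNIV)"
  proof
    fix x assume "x \<in> I"
    then obtain h where h: "x * j = y * h" using sub ij by blast
    have "y * (t * x) = (i * j) * x" using t by (simp add: mult_ac)
    also have "\<dots> = i * (x * j)" by (simp add: mult_ac)
    also have "\<dots> = y * (i * h)" using h by (simp add: mult_ac)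
    finally have "t * x = i * h" using mult_cancel y(1) by blast
    then show "x \<in> localization N (i *o UNIV)"
      using tN by (auto simp: localization_def mem_elt_set_times_UNIV)
  qed
  moreover have "i \<notin> absorbing"
  proof
    assume "i \<in> absorbing"
    then have "y * t \<in> absorbing" using t mult_mem_absorbing by metis
    then show False
      using y(1) tN absorbing_subset[OF prime_r_idealD[OF N]] mult_mem_absorbing by blast
  qed
  ultimately show ?thesis using that ij by blast
qed

lemma r_invertible_nontrivial:
  assumes "r_invertible r I"
  shows "nontrivial I"
proof -
  obtain K y where y: "y \<notin> absorbing" "r (I * K) = y *o UNIV"
    using assms by (auto simp: r_invertible_iff)
  have "y *o UNIV \<subseteq> I" using y(2) closure_times_subset_left r_invertible_r_ideal[OF assms] by metis
  then show ?thesis using nontrivial_principal[OF y(1)] nontrivial_mono by blast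
qed

text \<open>Finitely many elements \<open>E\<close> of \<open>I\<close> suffice to obtain
  \<open>y\<close>. For \<open>x\<close> in \<open>I\<close> each \<open>x * k\<close> is a multiple
  of \<open>y\<close>, so \<open>x * y\<close> lies in \<open>y *o r E\<close>, and \<open>y\<close>
  cancels.\<close>

lemma r_invertible_r_fin_gen:
  assumes "r_invertible r I"
  shows "r_fin_gen r I"
proof -
  obtain K y where y: "y \<notin> absorbing" "r (I * K) = y *o UNIV" and I: "r_ideal r I"
    using assms by (auto simp: r_invertible_iff)
  have "y \<in> r (I * K)" using y(2) mem_elt_set_times_UNIV by (metis mult_1_right)
  then obtain D where D: "finite D" "D \<subseteq> I * K" "y \<in> r D" using mem_closure_finite by metis
  have "\<exists>E\<subseteq>I. finite E \<and> D \<subseteq> E * K"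
    using D(1,2)
  proof (induction D rule: finite_induct)
    case (insert d D)
    then obtain E i k where E: "E \<subseteq> I" "finite E" "D \<subseteq> E * K" "i \<in> I" "k \<in> K" "d = i * k"
      by (auto elim!: set_times_elim)
    then have "insert d D \<subseteq> insert i E * K"
      using set_times_mono2[of E "insert i E" K K] by (auto intro: set_times_intro)
    then show ?case using E by (intro exI[of _ "insert i E"]) auto
  qed auto
  then obtain E where E: "E \<subseteq> I" "finite E" "D \<subseteq> E * K" by blast
  have "I \<subseteq> r E"
  proof
    fix x assume x: "x \<in> I"
    have "x *o (E * K) \<subseteq> y *o r E"
    proof
      fix z assume "z \<in> x *o (E * K)"
      then obtain e k where e: "e \<in> E" "k \<in> K" "z = x * (e * k)"
        by (auto simp: elt_set_times_def elim!: set_times_elim)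
      have "x * k \<in> r (I * K)" using x e mult_mem_closure_times by blast
      then obtain h where h: "x * k = y * h" using y(2) by (auto simp: mem_elt_set_times_UNIV)
      have "z = y * (h * e)" using e h by (metis mult.commute mult.left_commute)
      then show "z \<in> y *o r E" using closure_UNIV_mult[OF e(1)] by (auto simp: elt_set_times_def)
    qed
    then have "r (x *o (E * K)) \<subseteq> y *o r E"
      by (rule closure_least[OF r_ideal_elt_times[OF r_ideal_closure]])
    moreover have "x * y \<in> r (x *o (E * K))"
      using closure_mono[OF E(3)] D(3) closure_elt_times by (auto simp: elt_set_times_def)
    ultimately obtain e where "e \<in> r E" "x * y = y * e" by (auto simp: elt_set_times_def)
    then show "x \<in> r E" using mult_cancel[OF y(1)] by (metis mult.commute)
  qed
  then have "I = r E" using closure_least[OF I E(1)] by blast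
  then show ?thesis using E I by (auto simp: r_fin_gen_def)
qed

text \<open>To contain is to divide. For \<open>x\<close> in \<open>I\<close> and \<open>k\<close>
  in \<open>K\<close>, the quotient of \<open>x * k\<close> by \<open>y\<close> lies in
  \<open>(I : C)\<close>; expanding \<open>x * y\<close> by the products from \<open>C * K\<close>
  and cancelling \<open>y\<close> recovers \<open>x\<close>.\<close>

lemma r_invertible_residual:
  assumes C: "r_invertible r C" and I: "r_ideal r I" "I \<subseteq> C"
  shows "r (C * residual I C) = I"
proof
  show "r (C * residual I C) \<subseteq> I"
    by (rule closure_least[OF I(1)]) (auto simp: residual_def mult.commute elim!: set_times_elim)
  obtain K y where y: "y \<notin> absorbing" "r (C * K) = y *o UNIV" using C by (auto simp: r_invertible_iff)
  have CK: "\<exists>h. c * k = y * h" if "c \<in> C" "k \<in> K" for c k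
    using mult_mem_closure_times[OF that] unfolding y(2) by (simp add: mem_elt_set_times_UNIV)
  show "I \<subseteq> r (C * residual I C)"
  proof
    fix x assume x: "x \<in> I"
    have "x *o (C * K) \<subseteq> y *o (C * residual I C)"
    proof
      fix z assume "z \<in> x *o (C * K)"
      then obtain c k where c: "c \<in> C" "k \<in> K" "z = x * (c * k)"
        by (auto simp: elt_set_times_def elim!: set_times_elim)
      obtain a where a: "x * k = y * a" using CK x I(2) c by blast
      have "a \<in> residual I C" unfolding residual_def
      proof (intro CollectI ballI)
        fix c' assume "c' \<in> C"
        then obtain h where h: "c' * k = y * h" using CK c by blast
        have "y * (a * c') = x * (c' * k)" using a by (metis mult.commute mult.left_commute)
        also have "\<dots> = y * (h * x)" using h by (simp add: mult_ac)
        finally have "a * c' = h * x" using mult_cancel[OF y(1)] by blast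
        then show "a * c' \<in> I" using r_ideal_mult[OF I(1) x] by simp
      qed
      moreover have "z = y * (c * a)" using a c by (metis mult.commute mult.left_commute)
      ultimately show "z \<in> y *o (C * residual I C)"
        using c by (auto simp: elt_set_times_def intro: set_times_intro)
    qed
    then have "r (x *o (C * K)) \<subseteq> y *o r (C * residual I C)"
      using closure_mono closure_elt_times by metis
    moreover have "x * y \<in> r (x *o (C * K))"
    proof -
      have "y \<in> r (C * K)" unfolding y(2) mem_elt_set_times_UNIV by (metis mult_1_right)
      then show ?thesis unfolding closure_elt_times by (rule set_times_intro2)
    qed
    ultimately obtain e where "e \<in> r (C * residual I C)" "x * y = y * e"
      by (auto simp: elt_set_times_def)
    then show "x \<in> r (C * residual I C)" using mult_cancel[OF y(1)] by (metis mult.commute)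
  qed
qed

lemma closure_principal_times: "r ((x *o UNIV) * (y *o UNIV)) = (x * y) *o UNIV"
proof -
  have "{x} * {y} = {x * y}" by (auto simp: set_times_def)
  then show ?thesis by (metis closure_times closure_singleton)
qed

section \<open>Dimension\<close>

text \<open>Dimension at most one in terms of inclusions: the prime \<open>absorbing\<close> can be
  prepended to every chain of nontrivial primes.\<close>

definition nontrivial_primes_maximal :: bool where
  "nontrivial_primes_maximal \<longleftrightarrow>
     (\<forall>P Q. prime_r_ideal r P \<and> prime_r_ideal r Q \<and> nontrivial P \<and> P \<subseteq> Q \<longrightarrow> P = Q)"

text \<open>It suffices to test primeness on principal ideals, as their r-products are
  principal.\<close>

lemma lattice_prime_iff: "lattice_prime r P \<longleftrightarrow> prime_r_ideal r P"
proof
  assume P: "lattice_prime r P"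
  then have PI: "r_ideal r P" by (simp add: lattice_prime_def)
  have "x \<in> P \<or> y \<in> P" if "x * y \<in> P" for x y
  proof -
    have "r ((x *o UNIV) * (y *o UNIV)) \<subseteq> P"
      using that by (simp add: closure_principal_times principal_subset[OF PI])
    then have "x *o UNIV \<subseteq> P \<or> y *o UNIV \<subseteq> P"
      using P r_ideal_principal unfolding lattice_prime_def by blast
    then show ?thesis by (simp add: principal_subset[OF PI])
  qed
  then show "prime_r_ideal r P" using P by (auto simp: lattice_prime_def prime_r_ideal_def)
next
  assume P: "prime_r_ideal r P"
  have "I \<subseteq> P \<or> J \<subseteq> P" if "r (I * J) \<subseteq> P" for I J
    using prime_times[OF P] that closure_extensive by (meson subset_trans)
  then show "lattice_prime r P" using P by (auto simp: lattice_prime_def prime_r_ideal_def)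
qed

text \<open>The existence of a prime excludes \<open>r {} = UNIV\<close>, so \<open>r {}\<close> is
  \<open>absorbing\<close>, which is prime by cancellation.\<close>

lemma prime_absorbing:
  assumes "prime_r_ideal r P"
  shows "prime_r_ideal r absorbing"
proof -
  have "r {} \<subseteq> P" using closure_least[OF prime_r_idealD[OF assms]] by simp
  then have "r {} \<noteq> UNIV" using assms by (auto simp: prime_r_ideal_def)
  then have "r {} = absorbing" using closure_empty by blast
  then show ?thesis
    using r_ideal_closure[of "{}"] one_not_absorbing mult_mem_absorbing
    by (auto simp: prime_r_ideal_def)
qed

lemma ereal_of_enat_diff_le: "ereal_of_enat s - 1 \<le> 1 \<longleftrightarrow> s \<le> 2"
proof (cases s)
  case (enat n)
  have "ereal_of_enat s - 1 \<le> 1 \<longleftrightarrow> n \<le> 2"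
    by (simp add: enat one_ereal_def)
  also have "\<dots> \<longleftrightarrow> s \<le> 2" by (simp add: enat numeral_eq_enat)
  finally show ?thesis .
qed (simp add: numeral_eq_enat one_ereal_def)

lemma r_dim_le_one_iff: "r_dim r \<le> 1 \<longleftrightarrow> nontrivial_primes_maximal"
proof -
  let ?chains = "{C. finite C \<and> (\<forall>P\<in>C. prime_r_ideal r P) \<and> (\<forall>P\<in>C. \<forall>Q\<in>C. P \<subseteq> Q \<or> Q \<subseteq> P)}"
  have "r_dim r \<le> 1 \<longleftrightarrow> (\<forall>C\<in>?chains. enat (card C) \<le> 2)"
    by (simp add: r_dim_def ereal_of_enat_diff_le lattice_prime_iff SUP_le_iff)
  also have "\<dots> \<longleftrightarrow> (\<forall>C\<in>?chains. card C \<le> 2)" by (simp add: numeral_eq_enat)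
  also have "\<dots> \<longleftrightarrow> nontrivial_primes_maximal"
  proof
    assume card: "\<forall>C\<in>?chains. card C \<le> 2"
    show nontrivial_primes_maximal unfolding nontrivial_primes_maximal_def
    proof (intro allI impI, elim conjE, rule ccontr)
      fix P Q assume PQ: "prime_r_ideal r P" "prime_r_ideal r Q" "nontrivial P" "P \<subseteq> Q" "P \<noteq> Q"
      then have "absorbing \<subset> P" "P \<subset> Q" by (auto simp: nontrivial_def)
      then have c3: "card {absorbing, P, Q} = 3" and mem: "{absorbing, P, Q} \<in> ?chains"
        using PQ prime_absorbing[OF PQ(1)] by (auto simp: card_insert_if)
      show False using bspec[OF card mem] c3 by simp
    qed
  next
    assume max: nontrivial_primes_maximal
    show "\<forall>C\<in>?chains. card C \<le> 2"
    proof
      fix C assume C: "C \<in> ?chains"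
      have "\<exists>N. C \<subseteq> {absorbing, N}"
      proof (cases "\<exists>N\<in>C. nontrivial N")
        case True
        then obtain N where N: "N \<in> C" "nontrivial N" by blast
        have "P = N" if "P \<in> C" "P \<noteq> absorbing" for P
        proof -
          have "nontrivial P" using that C not_nontrivial prime_r_idealD by blast
          moreover have "prime_r_ideal r P" "prime_r_ideal r N" "P \<subseteq> N \<or> N \<subseteq> P"
            using C that N by simp_all
          ultimately show ?thesis using max N(2) unfolding nontrivial_primes_maximal_def by metis
        qed
        then show ?thesis by blast
      next
        case False
        then have "C \<subseteq> {absorbing}" using C not_nontrivial prime_r_idealD by blast
        then show ?thesis by blast
      qed
      then obtain N where "C \<subseteq> {absorbing, N}" by blast
      then have "card C \<le> card {absorbing, N}" by (intro card_mono) auto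
      also have "\<dots> \<le> 2" by (simp add: card_insert_if)
      finally show "card C \<le> 2" .
    qed
  qed
  finally show ?thesis .
qed

section \<open>From factorizations of ideals to dimension one\<close>

text \<open>Factor a principal ideal inside \<open>P\<close>: some factor lies in \<open>P\<close>,
  and factors of invertible ideals are invertible.\<close>

lemma prime_contains_invertible_radical:
  assumes fac: "\<And>I. r_invertible r I \<Longrightarrow> \<exists>Js. (\<forall>J\<in>set Js. radical_r_ideal r J) \<and> I = r_prod r Js"
    and P: "prime_r_ideal r P" "nontrivial P"
  shows "\<exists>J. r_invertible r J \<and> radical_r_ideal r J \<and> J \<subseteq> P"
proof -
  obtain x where x: "x \<in> P" "x \<notin> absorbing" using P nontrivial_iff prime_r_idealD by blast
  then have inv: "r_invertible r (x *o UNIV)" by (simp add: r_invertible_principal)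
  obtain Js where Js: "\<forall>J\<in>set Js. radical_r_ideal r J" "x *o UNIV = r_prod r Js"
    using fac[OF inv] by blast
  have "prod_list Js \<subseteq> x *o UNIV" using closure_extensive unfolding Js(2) r_prod_def .
  also have "\<dots> \<subseteq> P" using x(1) P prime_r_idealD principal_subset by blast
  finally obtain J where J: "J \<in> set Js" "J \<subseteq> P" using prime_prod_list P by blast
  moreover have "r_invertible r J"
    using r_invertible_prod_list_factor[OF _ J(1)] inv Js J(1) by (simp add: radical_r_ideal_def)
  ultimately show ?thesis using Js(1) by blast
qed

text \<open>The only use of modularity: cancellation modulo an ideal.\<close>

lemma modular_cancel:
  assumes mod: "modular r" and J: "r_ideal r J"
    and mem: "s * y \<in> r (insert (y * a) J)"
  shows "y \<in> absorbing \<or> s \<in> r (insert a (residual J {y}))"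
proof (rule disjCI)
  assume y: "\<not> s \<in> r (insert a (residual J {y}))"
  show "y \<in> absorbing"
  proof (rule ccontr)
    assume yreg: "y \<notin> absorbing"
    let ?I = "(y * a) *o UNIV" and ?N = "y *o UNIV"
    have IN: "?I \<subseteq> ?N" by (auto simp: elt_set_times_def mult.assoc)
    have "insert (y * a) J \<subseteq> r (?I \<union> J)"
      using closure_extensive[of "?I \<union> J"] mem_elt_set_times_UNIV[of "y * a" "y * a"]
      by (metis (no_types, lifting) UnCI insert_subset le_sup_iff mult_1_right subsetD)
    then have "s * y \<in> r (?I \<union> J)" using mem closure_minimal by blast
    moreover have "s * y \<in> ?N" using mem_elt_set_times_UNIV mult.commute by metis
    ultimately have "s * y \<in> r (?I \<union> J) \<inter> ?N" by simp
    then have "s * y \<in> r (?I \<union> (J \<inter> ?N))"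
      using mod J IN r_ideal_principal unfolding modular_def by blast
    \<comment> \<open>An element of \<open>J\<close> divisible by \<open>y\<close> is
      \<open>y * h\<close> with \<open>h\<close> in \<open>(J : y)\<close>, so after the modular law
      everything carries the factor \<open>y\<close>.\<close>
    moreover have "?I \<union> (J \<inter> ?N) \<subseteq> y *o r (insert a (residual J {y}))"
    proof
      fix z assume "z \<in> ?I \<union> (J \<inter> ?N)"
      then consider h where "z = y * (h * a)" | h where "z \<in> J" "z = y * h"
        by (auto simp: elt_set_times_def mult_ac)
      then show "z \<in> y *o r (insert a (residual J {y}))"
      proof cases
        case 1
        then show ?thesis using closure_UNIV_mult[of a "insert a (residual J {y})"] by auto
      next
        case 2
        then have "h \<in> residual J {y}" by (simp add: residual_def mult.commute)
        then show ?thesis using 2 closure_extensive[of "insert a (residual J {y})"] by auto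
      qed
    qed
    ultimately have "s * y \<in> y *o r (insert a (residual J {y}))"
      using closure_least[OF r_ideal_elt_times[OF r_ideal_closure]] by blast
    then obtain t where "t \<in> r (insert a (residual J {y}))" "y * s = y * t"
      by (auto simp: elt_set_times_def mult.commute)
    then show False using y mult_cancel[OF yreg] by metis
  qed
qed

text \<open>One factor \<open>J\<close> lies in \<open>N\<close>. Either the product of the others
  does too, or an element of it outside \<open>N\<close> is a denominator that makes
  \<open>I\<close> and \<open>J\<close> locally equal.\<close>

lemma SP_factor_in_prime:
  assumes N: "prime_r_ideal r N" and I: "r_ideal r I" "I \<subseteq> N" "I = r_prod r Js"
    and rad: "\<forall>J\<in>set Js. radical_r_ideal r J"
  obtains J where "radical_r_ideal r J" "J \<subseteq> N" "I \<subseteq> J" "J \<subseteq> localization N I"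
  | "I \<subseteq> r (N * N)"
proof -
  have "prod_list Js \<subseteq> N" using I closure_extensive unfolding r_prod_def by blast
  then obtain J where J: "J \<in> set Js" "J \<subseteq> N" using prime_prod_list N by blast
  let ?rest = "remove1 J Js"
  have eq: "prod_list Js = J * prod_list ?rest"
    using J(1) by (rule prod_list_remove1)
  have JI: "r_ideal r J" using J rad by (simp add: radical_r_ideal_def)
  show ?thesis
  proof (cases "prod_list ?rest \<subseteq> N")
    case True
    then have "I \<subseteq> r (N * N)"
      unfolding I(3) r_prod_def eq using J(2) by (intro closure_mono set_times_mono2)
    then show ?thesis by (rule that(2))
  next
    case False
    then obtain s where s: "s \<in> prod_list ?rest" "s \<notin> N" by blast
    have "J \<subseteq> localization N I"
    proof
      fix x assume "x \<in> J"
      then have "x * s \<in> I"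
        unfolding I(3) r_prod_def eq using s(1) by (rule mult_mem_closure_times)
      then have "s * x \<in> I" by (simp add: mult.commute)
      then show "x \<in> localization N I" using s(2) by (auto simp: localization_def)
    qed
    moreover have "I \<subseteq> J" unfolding I(3) r_prod_def eq by (rule closure_times_subset_left[OF JI])
    ultimately show ?thesis using that(1) J rad by blast
  qed
qed

text \<open>An ideal containing \<open>v \<in> N - N\<^sup>2\<close> is locally radical at \<open>N\<close>; apply this to \<open>{a\<^sup>2, v}\<^sub>r\<close>.\<close>

lemma SP_locally_principal:
  assumes mod: "modular r" and SP: "r_SP_monoid r"
    and N: "prime_r_ideal r N" and v: "v \<in> N" "v \<notin> r (N * N)"
  shows "N \<subseteq> localization N (v *o UNIV)"
proof
  fix a assume a: "a \<in> N"
  have NI: "r_ideal r N" using N by (rule prime_r_idealD)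
  let ?I = "r {a * a, v}"
  have IN: "?I \<subseteq> N" using a v(1) r_ideal_mult[OF NI] by (intro closure_least[OF NI]) auto
  obtain Js where "\<forall>J\<in>set Js. radical_r_ideal r J" "?I = r_prod r Js"
    using SP unfolding r_SP_monoid_def by (meson r_ideal_closure)
  then consider J where "radical_r_ideal r J" "J \<subseteq> N" "?I \<subseteq> J" "J \<subseteq> localization N ?I"
    | "?I \<subseteq> r (N * N)"
    using SP_factor_in_prime[OF N r_ideal_closure IN] by metis
  then show "a \<in> localization N (v *o UNIV)"
  proof cases
    case 1
    have "a ^ 2 \<in> J" using 1(3) closure_extensive[of "{a * a, v}"] by (auto simp: power2_eq_square)
    then have "a \<in> localization N ?I" using 1(4) radical_r_idealD[OF 1(1)] by blast
    then obtain s where s: "s \<notin> N" "s * a \<in> ?I" by (auto simp: localization_def)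
    have "?I \<subseteq> r (insert (a * a) (v *o UNIV))"
      using mem_elt_set_times_UNIV[of v v]
      by (intro closure_mono) (metis insertI1 insert_mono insert_subset mult_1_right subset_insertI2 empty_subsetI)
    then have "a \<in> absorbing \<or> s \<in> r (insert a (residual (v *o UNIV) {a}))"
      using modular_cancel[OF mod r_ideal_principal] s(2) by blast
    then show ?thesis
    proof
      assume "a \<in> absorbing"
      then have "a \<in> v *o UNIV" using absorbing_subset[OF r_ideal_principal] by blast
      then show ?thesis using subset_localization[OF N] by blast
    next
      assume *: "s \<in> r (insert a (residual (v *o UNIV) {a}))"
      \<comment> \<open>As \<open>a\<close> is in \<open>N\<close> and \<open>s\<close> is not, the
        colon ideal must leave \<open>N\<close>; any of its elements outside \<open>N\<close> is a
        denominator bringing \<open>a\<close> into \<open>v *o UNIV\<close>.\<close>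
      have "\<not> residual (v *o UNIV) {a} \<subseteq> N"
      proof
        assume "residual (v *o UNIV) {a} \<subseteq> N"
        then have "r (insert a (residual (v *o UNIV) {a})) \<subseteq> N"
          using a by (intro closure_least[OF NI]) auto
        then show False using * s(1) by blast
      qed
      then show ?thesis by (auto simp: residual_def localization_def)
    qed
  next
    case 2
    then show ?thesis using v(2) closure_extensive[of "{a * a, v}"] by auto
  qed
qed

text \<open>Up to local units, \<open>j = v * b\<close>, and since \<open>P\<close> is a prime
  without \<open>v\<close>, \<open>b\<close> is in \<open>P\<close> and another \<open>v\<close>
  splits off: \<open>j = v * v * c\<close>. The square of \<open>v * c\<close> is thus a multiple of
  \<open>j\<close>, radicality gives \<open>v * c = j * h\<close>, and \<open>j = j * v * h\<close>
  makes \<open>v\<close> a local unit.\<close>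

lemma locally_principal_minimal:
  assumes inv: "\<And>P. prime_r_ideal r P \<Longrightarrow> nontrivial P \<Longrightarrow>
      \<exists>J. r_invertible r J \<and> radical_r_ideal r J \<and> J \<subseteq> P"
    and N: "prime_r_ideal r N" and v: "v \<in> N" "N \<subseteq> localization N (v *o UNIV)"
    and P: "prime_r_ideal r P" "nontrivial P" "P \<subseteq> N"
  shows "P = N"
proof (rule ccontr)
  assume ne: "P \<noteq> N"
  have vP: "v \<notin> P"
  proof
    assume "v \<in> P"
    then have "v *o UNIV \<subseteq> P" using principal_subset prime_r_idealD P(1) by blast
    then have "N \<subseteq> P" using v(2) localization_mono localization_prime[OF P(1,3)] by blast
    then show False using ne P(3) by blast
  qed
  obtain J where J: "r_invertible r J" "radical_r_ideal r J" "J \<subseteq> P" using inv P by blast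
  obtain j where j: "j \<in> J" "j \<notin> absorbing" "J \<subseteq> localization N (j *o UNIV)"
    using r_invertible_locally_principal[OF J(1) N] by metis
  have "j \<in> localization N (v *o UNIV)" using j(1) J(3) P(3) v(2) by blast
  then obtain s b where s: "s \<notin> N" "s * j = v * b"
    by (auto simp: localization_def mem_elt_set_times_UNIV)
  have "v * b \<in> P" using s j(1) J(3) P(1) prime_mult_iff by (metis subsetD)
  then have "b \<in> P" using vP P(1) prime_mult_iff by blast
  then have "b \<in> localization N (v *o UNIV)" using P(3) v(2) by blast
  then obtain t c where t: "t \<notin> N" "t * b = v * c"
    by (auto simp: localization_def mem_elt_set_times_UNIV)
  have e: "s * t * j = v * (v * c)"
  proof -
    have "s * t * j = t * (s * j)" by (simp add: mult_ac)
    also have "\<dots> = v * (t * b)" unfolding s(2) by (simp add: mult_ac)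
    finally show ?thesis by (simp add: t(2))
  qed
  have "(v * c) ^ 2 = (c * s * t) * j"
  proof -
    have "(v * c) ^ 2 = c * (v * (v * c))" by (simp add: power2_eq_square mult_ac)
    also have "\<dots> = (c * s * t) * j" unfolding e[symmetric] by (simp add: mult_ac)
    finally show ?thesis .
  qed
  then have "(v * c) ^ 2 \<in> J" using j(1) r_ideal_mult[OF r_invertible_r_ideal[OF J(1)]] by simp
  then have "v * c \<in> localization N (j *o UNIV)" using radical_r_idealD[OF J(2)] j(3) by blast
  then obtain w h where w: "w \<notin> N" "w * (v * c) = j * h"
    by (auto simp: localization_def mem_elt_set_times_UNIV)
  have "j * (w * (s * t)) = w * (s * t * j)" by (simp add: mult_ac)
  also have "\<dots> = v * (w * (v * c))" unfolding e by (simp add: mult_ac)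
  also have "\<dots> = j * (v * h)" unfolding w(2) by (simp add: mult_ac)
  finally have "w * (s * t) = v * h" using mult_cancel[OF j(2)] by metis
  moreover have "v * h \<in> N" using v(1) r_ideal_mult_right prime_r_idealD N by blast
  ultimately show False using prime_mult_iff[OF N] w(1) s(1) t(1) by metis
qed

text \<open>Every factor contains \<open>N\<close> locally, either by assumption or because it is
  locally all of H, so the product locally contains a power of \<open>N\<close>; idempotence absorbs
  the exponent.\<close>

lemma idempotent_prime_subset_localization:
  assumes N: "prime_r_ideal r N" and idem: "N \<subseteq> localization N (r (N * N))"
    and Js: "\<And>J. J \<in> set Js \<Longrightarrow> r_ideal r J \<and> (J \<subseteq> N \<longrightarrow> N \<subseteq> localization N J)"
  shows "N \<subseteq> localization N (r (prod_list Js))"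
  using Js
proof (induction Js)
  case Nil
  then show ?case using closure_one subset_localization[OF N] by fastforce
next
  case (Cons J Js)
  have IH: "N \<subseteq> localization N (r (prod_list Js))" using Cons by auto
  have eq: "r (J * r (prod_list Js)) = r (prod_list (J # Js))" by (simp add: closure_times_right)
  have "N \<subseteq> localization N (r (J * r (prod_list Js)))"
  proof (cases "J \<subseteq> N")
    case True
    then have "N \<subseteq> localization N J" using Cons.prems[of J] by auto
    then have "r (N * N) \<subseteq> localization N (r (J * r (prod_list Js)))"
      using localization_times[OF N] IH by blast
    then have "localization N (r (N * N)) \<subseteq> localization N (r (J * r (prod_list Js)))"
      using localization_mono localization_idem[OF N] by metis
    then show ?thesis using idem by blast
  next
    case False
    then obtain s where s: "s \<in> J" "s \<notin> N" by blast
    have "UNIV \<subseteq> localization N J"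
    proof
      fix x
      have "s * x \<in> J" using s Cons.prems[of J] r_ideal_mult_right by auto
      then show "x \<in> localization N J" using s by (auto simp: localization_def)
    qed
    then have "r (UNIV * N) \<subseteq> localization N (r (J * r (prod_list Js)))"
      using localization_times[OF N] IH by blast
    moreover have "N \<subseteq> r (UNIV * N)" using mult_mem_closure_times[of 1 UNIV _ N] by fastforce
    ultimately show ?thesis by blast
  qed
  then show ?case unfolding eq .
qed

lemma SP_one_dimensional:
  assumes mod: "modular r" and SP: "r_SP_monoid r"
  shows nontrivial_primes_maximal
  unfolding nontrivial_primes_maximal_def
proof (intro allI impI, elim conjE, rule ccontr)
  fix P M assume P: "prime_r_ideal r P" "nontrivial P" and M: "prime_r_ideal r M"
    and PM: "P \<subseteq> M" "P \<noteq> M"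
  have PI: "r_ideal r P" using P(1) by (rule prime_r_idealD)
  have inv: "\<exists>J. r_invertible r J \<and> radical_r_ideal r J \<and> J \<subseteq> Q"
    if "prime_r_ideal r Q" "nontrivial Q" for Q
  proof (rule prime_contains_invertible_radical[OF _ that])
    fix I assume "r_invertible r I"
    then show "\<exists>Js. (\<forall>J\<in>set Js. radical_r_ideal r J) \<and> I = r_prod r Js"
      using SP r_invertible_r_ideal unfolding r_SP_monoid_def by blast
  qed
  obtain y where y: "y \<in> M" "y \<notin> P" using PM by blast
  have sub: "insert y P \<subseteq> M" using y PM by blast
  obtain N where N: "prime_r_ideal r N" "insert y P \<subseteq> N" "N \<subseteq> M"
    and min: "\<And>Q. prime_r_ideal r Q \<Longrightarrow> insert y P \<subseteq> Q \<Longrightarrow> Q \<subseteq> N \<Longrightarrow> Q = N"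
    using exists_minimal_prime[OF M sub] by metis
  have idem: "N \<subseteq> r (N * N)"
  proof (rule ccontr)
    assume "\<not> ?thesis"
    then obtain v where v: "v \<in> N" "v \<notin> r (N * N)" by blast
    have "P = N"
      using locally_principal_minimal[OF inv N(1) v(1) SP_locally_principal[OF mod SP N(1) v] P]
        N(2) by blast
    then show False using N(2) y(2) by blast
  qed
  let ?A = "r (insert (y * y) P)"
  obtain Js where Js: "\<forall>J\<in>set Js. radical_r_ideal r J" "?A = r_prod r Js"
    using SP unfolding r_SP_monoid_def by (meson r_ideal_closure)
  have "N \<subseteq> localization N (r (prod_list Js))"
  proof (rule idempotent_prime_subset_localization[OF N(1)])
    show "N \<subseteq> localization N (r (N * N))" using idem subset_localization[OF N(1)] by blast
    fix J assume J: "J \<in> set Js"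
    then have radJ: "radical_r_ideal r J" using Js by blast
    then have JI: "r_ideal r J" by (simp add: radical_r_ideal_def)
    have "prod_list Js = J * prod_list (remove1 J Js)"
      using J by (rule prod_list_remove1)
    \<comment> \<open>A factor contains the product, hence the square of \<open>y\<close>, hence
      \<open>y\<close>. So every prime between \<open>J\<close> and \<open>N\<close> contains
      \<open>insert y P\<close> and equals \<open>N\<close>.\<close>
    then have AJ: "?A \<subseteq> J" using Js(2) closure_times_subset_left[OF JI] by (simp add: r_prod_def)
    then have "y ^ 2 \<in> J" using closure_extensive by (force simp: power2_eq_square)
    then have "y \<in> J" by (rule radical_r_idealD[OF radJ])
    then have "insert y P \<subseteq> J" using AJ closure_extensive by blast
    then have "N \<subseteq> localization N J"
      using min by (intro minimal_prime_radical_localization[OF N(1) radJ]) blast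
    then show "r_ideal r J \<and> (J \<subseteq> N \<longrightarrow> N \<subseteq> localization N J)" using JI by blast
  qed
  then have "y \<in> localization N ?A" using N(2) Js(2) by (auto simp: r_prod_def)
  then obtain s where s: "s \<notin> N" "s * y \<in> ?A" by (auto simp: localization_def)
  have "y \<in> absorbing \<or> s \<in> r (insert y (residual P {y}))"
    using modular_cancel[OF mod PI s(2)] .
  moreover have "y \<notin> absorbing" using y(2) absorbing_subset[OF PI] by blast
  \<comment> \<open>As \<open>y\<close> is outside the prime \<open>P\<close>, the colon ideal stays
    in \<open>P\<close>, and cancellation has placed \<open>s\<close> in the closure of
    \<open>P\<close> and \<open>y\<close>, inside \<open>N\<close>.\<close>
  moreover have "residual P {y} \<subseteq> P" using prime_mult_iff[OF P(1)] y(2) by (auto simp: residual_def)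
  then have "r (insert y (residual P {y})) \<subseteq> N"
    using N(2) by (intro closure_least[OF prime_r_idealD[OF N(1)]]) auto
  ultimately show False using s(1) by blast
qed

text \<open>A prime strictly below \<open>Q\<close> makes the local generator \<open>a\<close> of a
  radical split as \<open>b * c\<close> with both factors in \<open>Q\<close>. The local generator
  \<open>d\<close> of the radical of \<open>b\<close> and \<open>c\<close> divides both and lies in
  \<open>Q\<close>, so \<open>a\<close> has the square of a nonunit as a local divisor.\<close>

lemma radicals_invertible_one_dimensional:
  assumes inv: "\<And>I. r_fin_gen r I \<Longrightarrow> nontrivial I \<Longrightarrow> r_invertible r (radical I)"
  shows nontrivial_primes_maximal
  unfolding nontrivial_primes_maximal_def
proof (intro allI impI, elim conjE, rule ccontr)
  fix P Q assume P: "prime_r_ideal r P" "nontrivial P" and Q: "prime_r_ideal r Q"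
    and PQ: "P \<subseteq> Q" "P \<noteq> Q"
  have QI: "r_ideal r Q" using Q by (rule prime_r_idealD)
  have gen: "\<exists>g. g \<in> radical (r E) \<and> g \<notin> absorbing \<and> radical (r E) \<subseteq> localization Q (g *o UNIV)"
    if "finite E" "E \<subseteq> Q" "x \<in> E" "x \<notin> absorbing" for E x
  proof -
    have "r_fin_gen r (r E)" using that(1) closure_extensive by (auto simp: r_fin_gen_def)
    moreover have "nontrivial (r E)"
      using that(3,4) closure_extensive nontrivial_iff[OF r_ideal_closure] by blast
    ultimately show ?thesis using r_invertible_locally_principal[OF inv Q] by metis
  qed
  have radQ: "radical (r E) \<subseteq> Q" if "E \<subseteq> Q" for E
    using radical_least[OF prime_radical_r_ideal[OF Q]] closure_least[OF QI that] by blast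
  have rad: "radical_r_ideal r (radical (r E))" for E by (simp add: radical_r_ideal_radical)
  have mem_rad: "x \<in> radical (r E)" if "x \<in> E" for x E
    using that closure_extensive subset_radical by blast
  obtain x where x: "x \<in> P" "x \<notin> absorbing" using P nontrivial_iff prime_r_idealD by blast
  obtain y where y: "y \<in> Q" "y \<notin> P" using PQ by blast
  obtain a where a: "a \<in> radical (r {x})" "a \<notin> absorbing"
    "radical (r {x}) \<subseteq> localization Q (a *o UNIV)"
    using gen[of "{x}" x] x PQ by auto
  obtain b where b: "b \<in> radical (r {x, y})" "b \<notin> absorbing"
    "radical (r {x, y}) \<subseteq> localization Q (b *o UNIV)"
    using gen[of "{x, y}" x] x y PQ by auto
  have "radical (r {x}) \<subseteq> radical (r {x, y})"
    using closure_mono[of "{x}" "{x, y}"] unfolding radical_def by blast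
  then obtain s c where s: "s \<notin> Q" "s * a = b * c"
    using a(1) b(3) by (auto simp: localization_def mem_elt_set_times_UNIV)
  obtain t h where t: "t \<notin> Q" "t * y = b * h"
    using b(3) mem_rad[of y "{x, y}"] by (auto simp: localization_def mem_elt_set_times_UNIV)
  \<comment> \<open>Locally \<open>b\<close> divides \<open>y\<close>, which is outside
    \<open>P\<close>. Since \<open>a\<close> is in \<open>P\<close>, the other factor
    \<open>c\<close> must be in \<open>P\<close>, so neither factor is a unit at
    \<open>Q\<close>.\<close>
  have bP: "b \<notin> P"
  proof
    assume "b \<in> P"
    then have "t * y \<in> P" using t(2) prime_mult_iff[OF P(1)] by auto
    then show False using t(1) y(2) PQ prime_mult_iff[OF P(1)] by blast
  qed
  have "radical (r {x}) \<subseteq> P"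
    using radical_least[OF prime_radical_r_ideal[OF P(1)]] x(1)
      closure_least[OF prime_r_idealD[OF P(1)]] by simp
  then have "b * c \<in> P" using s(2) a(1) prime_mult_iff[OF P(1)] by (metis subsetD)
  then have c: "c \<in> P" using bP prime_mult_iff[OF P(1)] by blast
  have bQ: "b \<in> Q" using radQ[of "{x, y}"] b(1) x(1) y(1) PQ by blast
  obtain d where d: "d \<in> radical (r {b, c})" "d \<notin> absorbing"
    "radical (r {b, c}) \<subseteq> localization Q (d *o UNIV)"
    using gen[of "{b, c}" b] b(2) bQ c PQ by auto
  obtain s1 c' where s1: "s1 \<notin> Q" "s1 * c = d * c'"
    using d(3) mem_rad[of c "{b, c}"] by (auto simp: localization_def mem_elt_set_times_UNIV)
  obtain s2 b' where s2: "s2 \<notin> Q" "s2 * b = d * b'"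
    using d(3) mem_rad[of b "{b, c}"] by (auto simp: localization_def mem_elt_set_times_UNIV)
  have dQ: "d \<in> Q" using radQ[of "{b, c}"] d(1) bQ c PQ by blast
  let ?z = "d * b' * c'"
  have e: "s * s1 * s2 * a = d * ?z"
  proof -
    have "s * s1 * s2 * a = (s1 * s2) * (s * a)" by (simp add: mult_ac)
    also have "\<dots> = (s1 * c) * (s2 * b)" unfolding s(2) by (simp add: mult_ac)
    also have "\<dots> = d * ?z" unfolding s1(2) s2(2) by (simp add: mult_ac)
    finally show ?thesis .
  qed
  \<comment> \<open>Locally \<open>a = d * ?z\<close>, so \<open>a\<close> divides the square of
    \<open>?z\<close>. Radicality gives \<open>?z = a * k\<close>, and cancelling \<open>a\<close>
    turns \<open>d\<close> into a unit at \<open>Q\<close>.\<close>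
  have "?z ^ 2 = (b' * c') * (d * ?z)" by (simp add: power2_eq_square mult_ac)
  also have "\<dots> = (b' * c' * (s * s1 * s2)) * a" unfolding e[symmetric] by (simp add: mult_ac)
  also have "\<dots> \<in> radical (r {x})"
    using a(1) rad[of "{x}"] by (intro r_ideal_mult) (auto simp: radical_r_ideal_def)
  finally have "?z \<in> radical (r {x})" by (rule radical_r_idealD[OF rad])
  then obtain w k where w: "w \<notin> Q" "w * ?z = a * k"
    using a(3) by (auto simp: localization_def mem_elt_set_times_UNIV)
  have "a * (w * (s * s1 * s2)) = w * (s * s1 * s2 * a)" by (simp add: mult_ac)
  also have "\<dots> = d * (w * ?z)" unfolding e by (simp add: mult_ac)
  also have "\<dots> = a * (d * k)" unfolding w(2) by (simp add: mult_ac)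
  finally have "w * (s * s1 * s2) = d * k" using mult_cancel[OF a(2)] by metis
  moreover have "d * k \<in> Q" using dQ r_ideal_mult_right[OF QI] by blast
  ultimately show False using prime_mult_iff[OF Q] w(1) s(1) s1(1) s2(1) by metis
qed

end

section \<open>Valuations in dimension one\<close>

text \<open>Condition (3) with the dimension expressed by inclusions; every other condition has only
  to be compared with this one.\<close>

locale SP_ideal_system = cancellative_ideal_system +
  assumes one_dimensional: nontrivial_primes_maximal
    and invertible_radical_in_prime: "\<And>P. prime_r_ideal r P \<Longrightarrow> nontrivial P \<Longrightarrow>
      \<exists>J. r_invertible r J \<and> radical_r_ideal r J \<and> J \<subseteq> P"
begin

text \<open>The points that carry a valuation. Only if \<open>r {}\<close> is maximal does this
  differ from \<open>r_max r\<close>, and then it is empty.\<close>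

definition max_spec :: "'a set set" where
  "max_spec = {M \<in> r_max r. nontrivial M}"

lemma max_spec_prime: "M \<in> max_spec \<Longrightarrow> prime_r_ideal r M"
  by (simp add: max_spec_def r_max_prime)

lemma max_spec_r_ideal: "M \<in> max_spec \<Longrightarrow> r_ideal r M"
  by (simp add: max_spec_prime prime_r_idealD)

lemma notin_max_spec: "M \<in> max_spec \<Longrightarrow> x \<notin> M \<Longrightarrow> x \<notin> absorbing"
  using absorbing_subset max_spec_r_ideal by blast

lemma nontrivial_prime_eq:
  "M \<in> max_spec \<Longrightarrow> prime_r_ideal r P \<Longrightarrow> nontrivial P \<Longrightarrow> P \<subseteq> M \<Longrightarrow> P = M"
  using one_dimensional max_spec_prime unfolding nontrivial_primes_maximal_def by metis

lemma exists_max_spec: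
  assumes "r_ideal r I" "nontrivial I" "I \<noteq> UNIV"
  obtains M where "M \<in> max_spec" "I \<subseteq> M"
proof -
  obtain M where "M \<in> r_max r" "I \<subseteq> M" using exists_r_max assms(1,3) by metis
  moreover have "nontrivial M" using nontrivial_mono[OF assms(2) \<open>I \<subseteq> M\<close>] .
  ultimately show ?thesis using that by (simp add: max_spec_def)
qed

lemma radical_localization:
  assumes M: "M \<in> max_spec" and J: "radical_r_ideal r J" "nontrivial J"
  shows "M \<subseteq> localization M J"
proof (rule minimal_prime_radical_localization[OF max_spec_prime[OF M] J(1)])
  fix P assume "prime_r_ideal r P" "J \<subseteq> P" "P \<subseteq> M"
  then show "P = M" using nontrivial_prime_eq[OF M] nontrivial_mono J(2) by metis
qed

definition uniformizer :: "'a set \<Rightarrow> 'a" where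
  "uniformizer M = (SOME u. u \<in> M \<and> u \<notin> absorbing \<and> M \<subseteq> localization M (u *o UNIV))"

lemma uniformizer:
  assumes M: "M \<in> max_spec"
  shows "uniformizer M \<in> M" "uniformizer M \<notin> absorbing"
    "M \<subseteq> localization M (uniformizer M *o UNIV)"
proof -
  have p: "prime_r_ideal r M" by (rule max_spec_prime[OF M])
  obtain J where J: "r_invertible r J" "radical_r_ideal r J" "J \<subseteq> M"
    using invertible_radical_in_prime[OF p] M by (auto simp: max_spec_def)
  obtain j where j: "j \<in> J" "j \<notin> absorbing" "J \<subseteq> localization M (j *o UNIV)"
    using r_invertible_locally_principal[OF J(1) p] by metis
  have "M \<subseteq> localization M J" by (rule radical_localization[OF M J(2) r_invertible_nontrivial[OF J(1)]])
  also have "\<dots> \<subseteq> localization M (j *o UNIV)"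
    using localization_mono[OF j(3)] localization_idem[OF p] by metis
  finally have "\<exists>u. u \<in> M \<and> u \<notin> absorbing \<and> M \<subseteq> localization M (u *o UNIV)"
    using j J(3) by blast
  from someI_ex[OF this] show "uniformizer M \<in> M" "uniformizer M \<notin> absorbing"
    "M \<subseteq> localization M (uniformizer M *o UNIV)"
    unfolding uniformizer_def by blast+
qed

lemma uniformizer_power: "M \<in> max_spec \<Longrightarrow> uniformizer M ^ n \<notin> absorbing"
  using uniformizer(2) power_mem_absorbing by blast

text \<open>The exponent of the uniformizer up to local units, written without fractions. No
  exponent fits an absorbing \<open>x\<close>, so such elements are always split off.\<close>

definition ord :: "'a set \<Rightarrow> 'a \<Rightarrow> nat" where
  "ord M x = (THE n. \<exists>s t. s \<notin> M \<and> t \<notin> M \<and> s * x = uniformizer M ^ n * t)"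

text \<open>\<open>M\<close> is the only prime between \<open>x *o UNIV\<close> and
  \<open>M\<close>, so \<open>x\<close> locally divides a power \<open>?u ^ k\<close> and is not
  divisible by \<open>?u ^ Suc k\<close>. Take the largest exponent that divides; the cofactor is a
  unit at \<open>M\<close>, or one more uniformizer would split off.\<close>

lemma ord_exists:
  assumes M: "M \<in> max_spec" and x: "x \<notin> absorbing"
  shows "\<exists>n s t. s \<notin> M \<and> t \<notin> M \<and> s * x = uniformizer M ^ n * t"
proof (cases "x \<in> M")
  case False
  then have "1 * x = uniformizer M ^ 0 * x" by simp
  then show ?thesis using False one_notin_prime[OF max_spec_prime[OF M]] by blast
next
  case True
  note p = max_spec_prime[OF M] and MI = max_spec_r_ideal[OF M]
  let ?u = "uniformizer M"
  let ?P = "\<lambda>n. x \<in> localization M (?u ^ n *o UNIV)"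
  have "P = M" if "prime_r_ideal r P" "x *o UNIV \<subseteq> P" "P \<subseteq> M" for P
    using nontrivial_prime_eq[OF M that(1) _ that(3)]
      nontrivial_mono[OF nontrivial_principal[OF x] that(2)] by blast
  then obtain k s h where k: "s \<notin> M" "s * ?u ^ k = x * h"
    using minimal_prime_localization[OF p r_ideal_principal _ uniformizer(1)[OF M], of x]
    by (auto simp: localization_def mem_elt_set_times_UNIV)
  have "\<not> ?P (Suc k)"
  proof
    assume "?P (Suc k)"
    then obtain w g where w: "w \<notin> M" "w * x = ?u ^ Suc k * g"
      by (auto simp: localization_def mem_elt_set_times_UNIV)
    have "?u ^ k * (w * s) = w * (s * ?u ^ k)" by (simp add: mult_ac)
    also have "\<dots> = (w * x) * h" unfolding k(2) by (simp add: mult_ac)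
    also have "\<dots> = ?u ^ k * (?u * (g * h))" unfolding w(2) by (simp add: mult_ac)
    finally have "w * s = ?u * (g * h)" using mult_cancel[OF uniformizer_power[OF M]] by metis
    then have "w * s \<in> M" using r_ideal_mult_right[OF MI uniformizer(1)[OF M]] by simp
    then show False using w(1) k(1) prime_mult_iff[OF p] by blast
  qed
  moreover have "?P 0" using subset_localization[OF p] mem_elt_set_times_UNIV[of x 1] by fastforce
  ultimately obtain n where n: "?P n" "\<not> ?P (Suc n)"
    using ex_least_nat_less[of "\<lambda>n. \<not> ?P n" "Suc k"] by auto
  obtain s t where s: "s \<notin> M" "s * x = ?u ^ n * t"
    using n(1) by (auto simp: localization_def mem_elt_set_times_UNIV)
  have "t \<notin> M"
  proof
    assume "t \<in> M"
    then obtain w g where w: "w \<notin> M" "w * t = ?u * g"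
      using uniformizer(3)[OF M] by (auto simp: localization_def mem_elt_set_times_UNIV)
    have "(w * s) * x = w * (s * x)" by (simp add: mult_ac)
    also have "\<dots> = ?u ^ n * (w * t)" unfolding s(2) by (simp add: mult_ac)
    also have "\<dots> = ?u ^ Suc n * g" unfolding w(2) by (simp add: mult_ac)
    finally show False using n(2) w(1) s(1) prime_mult_iff[OF p]
      by (auto simp: localization_def mem_elt_set_times_UNIV)
  qed
  then show ?thesis using s by blast
qed

lemma ord_unique_le:
  assumes M: "M \<in> max_spec"
    and s: "s \<notin> M" "t \<notin> M" "s * x = uniformizer M ^ n * t"
    and s': "s' \<notin> M" "t' \<notin> M" "s' * x = uniformizer M ^ m * t'"
  shows "m \<le> n"
proof (rule ccontr)
  let ?u = "uniformizer M"
  assume "\<not> m \<le> n"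
  then obtain k where k: "m = n + Suc k" by (metis less_imp_Suc_add not_le_imp_less add_Suc_right)
  have "?u ^ n * (s' * t) = s' * (s * x)" unfolding s(3) by (simp add: mult_ac)
  also have "\<dots> = s * (s' * x)" by (simp add: mult_ac)
  also have "\<dots> = ?u ^ n * (?u * (?u ^ k * s * t'))" unfolding s'(3) k power_add by (simp add: mult_ac)
  finally have "s' * t = ?u * (?u ^ k * s * t')" using mult_cancel[OF uniformizer_power[OF M]] by metis
  then have "s' * t \<in> M"
    using r_ideal_mult_right[OF max_spec_r_ideal[OF M] uniformizer(1)[OF M]] by simp
  then show False using s'(1) s(2) prime_mult_iff[OF max_spec_prime[OF M]] by blast
qed

lemma ord_eqI:
  assumes "M \<in> max_spec" "s \<notin> M" "t \<notin> M" "s * x = uniformizer M ^ n * t"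
  shows "ord M x = n"
  unfolding ord_def
proof (rule the_equality)
  show "\<exists>s t. s \<notin> M \<and> t \<notin> M \<and> s * x = uniformizer M ^ n * t" using assms by blast
  fix m assume "\<exists>s t. s \<notin> M \<and> t \<notin> M \<and> s * x = uniformizer M ^ m * t"
  then show "m = n" using ord_unique_le[OF assms(1)] assms(2-4) by (metis le_antisym)
qed

lemma ordE:
  assumes "M \<in> max_spec" "x \<notin> absorbing"
  obtains s t where "s \<notin> M" "t \<notin> M" "s * x = uniformizer M ^ ord M x * t"
  using ord_exists[OF assms] ord_eqI[OF assms(1)] by metis

lemma ord_mult:
  assumes M: "M \<in> max_spec" and x: "x \<notin> absorbing" and y: "y \<notin> absorbing"
  shows "ord M (x * y) = ord M x + ord M y"
proof -
  obtain s t where s: "s \<notin> M" "t \<notin> M" "s * x = uniformizer M ^ ord M x * t" using ordE[OF M x] .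
  obtain s' t' where s': "s' \<notin> M" "t' \<notin> M" "s' * y = uniformizer M ^ ord M y * t'" using ordE[OF M y] .
  have "(s * s') * (x * y) = (s * x) * (s' * y)" by (simp add: mult_ac)
  also have "\<dots> = uniformizer M ^ (ord M x + ord M y) * (t * t')"
    unfolding s(3) s'(3) power_add by (simp add: mult_ac)
  finally show ?thesis
    using ord_eqI[OF M] s(1,2) s'(1,2) prime_mult_iff[OF max_spec_prime[OF M]] by metis
qed

lemma ord_notin: "M \<in> max_spec \<Longrightarrow> x \<notin> M \<Longrightarrow> ord M x = 0"
  using ord_eqI[of M 1 x x 0] one_notin_prime[OF max_spec_prime] by simp

lemma ord_eq_0_iff:
  assumes M: "M \<in> max_spec" and x: "x \<notin> absorbing"
  shows "ord M x = 0 \<longleftrightarrow> x \<notin> M"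
proof
  assume "ord M x = 0"
  then obtain s t where "s \<notin> M" "t \<notin> M" "s * x = t" using ordE[OF M x] by (metis mult_1 power_0)
  then show "x \<notin> M" using r_ideal_mult[OF max_spec_r_ideal[OF M]] by blast
qed (rule ord_notin[OF M])

lemma ord_uniformizer: "M \<in> max_spec \<Longrightarrow> ord M (uniformizer M) = 1"
  using ord_eqI[of M 1 1 "uniformizer M" 1] one_notin_prime[OF max_spec_prime] by simp

lemma ord_power:
  "M \<in> max_spec \<Longrightarrow> x \<notin> absorbing \<Longrightarrow> ord M (x ^ n) = n * ord M x"
proof (induction n)
  case 0
  then show ?case using ord_notin one_notin_prime[OF max_spec_prime] by simp
next
  case (Suc n)
  then have "x ^ n \<notin> absorbing" using power_mem_absorbing by blast
  then show ?case using Suc by (simp add: ord_mult)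
qed

lemma ord_le_iff:
  assumes M: "M \<in> max_spec" and x: "x \<notin> absorbing" and y: "y \<notin> absorbing"
  shows "ord M x \<le> ord M y \<longleftrightarrow> y \<in> localization M (x *o UNIV)"
proof
  note p = max_spec_prime[OF M]
  assume le: "ord M x \<le> ord M y"
  obtain s t where s: "s \<notin> M" "t \<notin> M" "s * x = uniformizer M ^ ord M x * t" using ordE[OF M x] .
  obtain s' t' where s': "s' \<notin> M" "t' \<notin> M" "s' * y = uniformizer M ^ ord M y * t'" using ordE[OF M y] .
  obtain k where k: "ord M y = ord M x + k" using le le_Suc_ex by blast
  have "(s' * t) * y = t * (s' * y)" by (simp add: mult_ac)
  also have "\<dots> = uniformizer M ^ k * t' * (uniformizer M ^ ord M x * t)"
    unfolding s'(3) k power_add by (simp add: mult_ac)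
  also have "\<dots> = x * (uniformizer M ^ k * t' * s)" unfolding s(3)[symmetric] by (simp add: mult_ac)
  finally show "y \<in> localization M (x *o UNIV)"
    using s(2) s'(1) prime_mult_iff[OF p] by (auto simp: localization_def mem_elt_set_times_UNIV)
next
  assume "y \<in> localization M (x *o UNIV)"
  then obtain w h where w: "w \<notin> M" "w * y = x * h" by (auto simp: localization_def mem_elt_set_times_UNIV)
  have wr: "w \<notin> absorbing" using w(1) notin_max_spec[OF M] by blast
  then have h: "h \<notin> absorbing" using w(2) y mult_mem_absorbing by metis
  have "ord M y = ord M (w * y)" using ord_mult[OF M wr y] ord_notin[OF M w(1)] by simp
  also have "\<dots> = ord M x + ord M h" unfolding w(2) by (rule ord_mult[OF M x h])
  finally show "ord M x \<le> ord M y" by simp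
qed

section \<open>Orders of ideals and the local-global principle\<close>

definition ideal_ord :: "'a set \<Rightarrow> 'a set \<Rightarrow> nat" where
  "ideal_ord M I = (LEAST n. \<exists>x\<in>I. x \<notin> absorbing \<and> ord M x = n)"

lemma ideal_ord_attained:
  assumes "r_ideal r I" "nontrivial I"
  obtains i where "i \<in> I" "i \<notin> absorbing" "ord M i = ideal_ord M I"
proof -
  have "\<exists>n. \<exists>x\<in>I. x \<notin> absorbing \<and> ord M x = n" using assms nontrivial_iff by blast
  from LeastI_ex[OF this] show ?thesis using that unfolding ideal_ord_def by blast
qed

lemma ideal_ord_le: "x \<in> I \<Longrightarrow> x \<notin> absorbing \<Longrightarrow> ideal_ord M I \<le> ord M x"
  unfolding ideal_ord_def by (intro Least_le) blast

lemma subset_localization_generator: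
  assumes M: "M \<in> max_spec" and i: "i \<notin> absorbing" "ord M i \<le> ideal_ord M I"
  shows "I \<subseteq> localization M (i *o UNIV)"
proof
  fix x assume x: "x \<in> I"
  show "x \<in> localization M (i *o UNIV)"
  proof (cases "x \<in> absorbing")
    case True
    then have "x \<in> i *o UNIV" using absorbing_subset[OF r_ideal_principal] by blast
    then show ?thesis using subset_localization[OF max_spec_prime[OF M]] by blast
  next
    case False
    then have "ord M i \<le> ord M x" using ideal_ord_le[OF x False, of M] i(2) by simp
    then show ?thesis using ord_le_iff[OF M i(1) False] by simp
  qed
qed

lemma mem_iff_ord:
  assumes I: "r_ideal r I" "nontrivial I" and x: "x \<notin> absorbing"
  shows "x \<in> I \<longleftrightarrow> (\<forall>M\<in>max_spec. ideal_ord M I \<le> ord M x)"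
proof
  assume le: "\<forall>M\<in>max_spec. ideal_ord M I \<le> ord M x"
  show "x \<in> I"
  proof (rule mem_if_locally_mem[OF I(1)])
    fix M assume M: "M \<in> r_max r"
    show "x \<in> localization M I"
    proof (cases "nontrivial M")
      case True
      then have M: "M \<in> max_spec" using M by (simp add: max_spec_def)
      obtain i where i: "i \<in> I" "i \<notin> absorbing" "ord M i = ideal_ord M I"
        using ideal_ord_attained[OF I] .
      have "x \<in> localization M (i *o UNIV)" using ord_le_iff[OF M i(2) x] le M i(3) by simp
      then show ?thesis using localization_mono i(1) principal_subset[OF I(1)] by blast
    next
      case False
      \<comment> \<open>At the trivial maximal ideal there is nothing to compare: a non-absorbing
        element of \<open>I\<close> is an admissible denominator.\<close>
      then have "M = absorbing" using M not_nontrivial by (simp add: r_max_def)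
      then obtain s where "s \<in> I" "s \<notin> M" using I nontrivial_iff by blast
      then show ?thesis using r_ideal_mult_right[OF I(1)] by (auto simp: localization_def)
    qed
  qed
qed (use ideal_ord_le[OF _ x] in blast)

lemma ideal_subset_iff:
  assumes I: "r_ideal r I" "nontrivial I" and J: "r_ideal r J" "nontrivial J"
  shows "I \<subseteq> J \<longleftrightarrow> (\<forall>M\<in>max_spec. ideal_ord M J \<le> ideal_ord M I)"
proof
  assume "I \<subseteq> J"
  then show "\<forall>M\<in>max_spec. ideal_ord M J \<le> ideal_ord M I"
    using ideal_ord_attained[OF I] ideal_ord_le by (metis subsetD)
next
  assume le: "\<forall>M\<in>max_spec. ideal_ord M J \<le> ideal_ord M I"
  show "I \<subseteq> J"
  proof
    fix x assume x: "x \<in> I"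
    show "x \<in> J"
    proof (cases "x \<in> absorbing")
      case True
      then show ?thesis using absorbing_subset[OF J(1)] by blast
    next
      case False
      then have "\<forall>M\<in>max_spec. ideal_ord M J \<le> ord M x"
        using le ideal_ord_le[OF x False] le_trans by blast
      then show ?thesis using mem_iff_ord[OF J False] by simp
    qed
  qed
qed

lemma ideal_eqI:
  assumes "r_ideal r I" "nontrivial I" "r_ideal r J" "nontrivial J"
    "\<And>M. M \<in> max_spec \<Longrightarrow> ideal_ord M I = ideal_ord M J"
  shows "I = J"
  using ideal_subset_iff[of I J] ideal_subset_iff[of J I] assms by auto

lemma ideal_ord_times:
  assumes M: "M \<in> max_spec" and I: "r_ideal r I" "nontrivial I" and J: "r_ideal r J" "nontrivial J"
  shows "ideal_ord M (r (I * J)) = ideal_ord M I + ideal_ord M J"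
proof (rule antisym)
  obtain i where i: "i \<in> I" "i \<notin> absorbing" "ord M i = ideal_ord M I"
    using ideal_ord_attained[OF I] .
  obtain j where j: "j \<in> J" "j \<notin> absorbing" "ord M j = ideal_ord M J"
    using ideal_ord_attained[OF J] .
  have ij: "i * j \<notin> absorbing" using i(2) j(2) mult_mem_absorbing by blast
  have o: "ord M (i * j) = ideal_ord M I + ideal_ord M J"
    using ord_mult[OF M i(2) j(2)] i(3) j(3) by simp
  show "ideal_ord M (r (I * J)) \<le> ideal_ord M I + ideal_ord M J"
    using ideal_ord_le[OF mult_mem_closure_times[OF i(1) j(1)] ij, of M] o by simp
  have sub: "r (I * J) \<subseteq> localization M ((i * j) *o UNIV)"
    using localization_times[OF max_spec_prime[OF M]
        subset_localization_generator[OF M i(2) eq_refl[OF i(3)]]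
        subset_localization_generator[OF M j(2) eq_refl[OF j(3)]]]
    by (simp add: closure_principal_times)
  obtain k where k: "k \<in> r (I * J)" "k \<notin> absorbing" "ord M k = ideal_ord M (r (I * J))"
    using ideal_ord_attained[OF r_ideal_closure nontrivial_times[OF I(1) J(1) I(2) J(2)]] .
  have "ord M (i * j) \<le> ord M k" using ord_le_iff[OF M ij k(2)] k(1) sub by blast
  then show "ideal_ord M I + ideal_ord M J \<le> ideal_ord M (r (I * J))" using o k(3) by simp
qed

lemma ideal_ord_eq_0_iff:
  assumes M: "M \<in> max_spec" and I: "r_ideal r I" "nontrivial I"
  shows "ideal_ord M I = 0 \<longleftrightarrow> \<not> I \<subseteq> M"
proof
  assume "ideal_ord M I = 0"
  then obtain i where "i \<in> I" "i \<notin> absorbing" "ord M i = 0" using ideal_ord_attained[OF I] by metis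
  then show "\<not> I \<subseteq> M" using ord_eq_0_iff[OF M] by blast
next
  assume "\<not> I \<subseteq> M"
  then obtain i where i: "i \<in> I" "i \<notin> M" by blast
  then have "ideal_ord M I \<le> ord M i" using ideal_ord_le notin_max_spec[OF M] by blast
  then show "ideal_ord M I = 0" using ord_notin[OF M i(2)] by simp
qed

lemma ideal_ord_UNIV: "M \<in> max_spec \<Longrightarrow> ideal_ord M UNIV = 0"
  using ideal_ord_eq_0_iff[OF _ r_ideal_UNIV nontrivial_UNIV] one_notin_prime[OF max_spec_prime] by blast

text \<open>By \<open>radical_localization\<close>, \<open>J\<close> contains a local unit times the
  uniformizer.\<close>

lemma ideal_ord_radical:
  assumes M: "M \<in> max_spec" and J: "radical_r_ideal r J" "nontrivial J"
  shows "ideal_ord M J = (if J \<subseteq> M then 1 else 0)"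
proof (cases "J \<subseteq> M")
  case True
  have JI: "r_ideal r J" using J by (simp add: radical_r_ideal_def)
  obtain s where s: "s \<notin> M" "s * uniformizer M \<in> J"
    using radical_localization[OF M J] uniformizer(1)[OF M] by (auto simp: localization_def)
  have sr: "s \<notin> absorbing" by (rule notin_max_spec[OF M s(1)])
  have "ideal_ord M J \<le> ord M (s * uniformizer M)"
    using ideal_ord_le[OF s(2)] sr uniformizer(2)[OF M] mult_mem_absorbing by blast
  also have "\<dots> = 1"
    using ord_mult[OF M sr uniformizer(2)[OF M]] ord_notin[OF M s(1)] ord_uniformizer[OF M] by simp
  finally show ?thesis using True ideal_ord_eq_0_iff[OF M JI J(2)] by auto
qed (use ideal_ord_eq_0_iff[OF M _ J(2)] J in \<open>simp add: radical_r_ideal_def\<close>)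

text \<open>\<open>ord M (x ^ n)\<close> is \<open>n * ord M x\<close>, which is positive only if
  \<open>ord M x\<close> is, and a bound of one asks for no more.\<close>

lemma radical_r_ideal_if_ord_le_1:
  assumes J: "r_ideal r J" "nontrivial J" and le: "\<And>M. M \<in> max_spec \<Longrightarrow> ideal_ord M J \<le> 1"
  shows "radical_r_ideal r J"
  unfolding radical_r_ideal_def
proof (intro conjI allI impI J(1), elim conjE)
  fix x n assume xn: "x ^ n \<in> J"
  show "x \<in> J"
  proof (cases "x \<in> absorbing")
    case True
    then show ?thesis using absorbing_subset[OF J(1)] by blast
  next
    case False
    have "ideal_ord M J \<le> ord M x" if M: "M \<in> max_spec" for M
    proof -
      have "ideal_ord M J \<le> n * ord M x"
        using ideal_ord_le[OF xn] ord_power[OF M False] power_mem_absorbing False by metis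
      then show ?thesis using le[OF M] by (cases "ord M x") auto
    qed
    then show ?thesis using mem_iff_ord[OF J False] by simp
  qed
qed

section \<open>Invertibility of finitely generated ideals and of their radicals\<close>

lemma ideal_ord_principal:
  assumes "M \<in> max_spec" "x \<notin> absorbing"
  shows "ideal_ord M (x *o UNIV) = ord M x"
proof (rule antisym)
  show "ideal_ord M (x *o UNIV) \<le> ord M x"
    using ideal_ord_le[OF _ assms(2)] principal_subset[OF r_ideal_principal] by blast
  obtain k where k: "k \<in> x *o UNIV" "k \<notin> absorbing" "ord M k = ideal_ord M (x *o UNIV)"
    using ideal_ord_attained[OF r_ideal_principal nontrivial_principal[OF assms(2)]] .
  then show "ord M x \<le> ideal_ord M (x *o UNIV)"
    using ord_le_iff[OF assms k(2)] subset_localization[OF max_spec_prime[OF assms(1)]] by auto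
qed

text \<open>The candidate inverse is \<open>(xH : I)\<close> for some \<open>x\<close> in
  \<open>I\<close>. Comparing orders, each \<open>M\<close> requires only an element of the product
  that equals \<open>x\<close> up to a local unit.\<close>

lemma r_fin_gen_invertible:
  assumes fg: "r_fin_gen r I" and nt: "nontrivial I"
  shows "r_invertible r I"
proof -
  obtain E where E: "finite E" "I = r E" and I: "r_ideal r I" using fg by (auto simp: r_fin_gen_def)
  obtain x where x: "x \<in> I" "x \<notin> absorbing" using nt I nontrivial_iff by blast
  let ?J = "residual (x *o UNIV) I"
  have JI: "r_ideal r ?J" by (simp add: r_ideal_residual)
  have "x \<in> ?J" by (auto simp: residual_def mem_elt_set_times_UNIV)
  then have Jnt: "nontrivial ?J" using x(2) nontrivial_iff[OF JI] by blast
  have "r (I * ?J) = x *o UNIV"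
  proof (rule ideal_eqI)
    show "nontrivial (r (I * ?J))" by (rule nontrivial_times[OF I JI nt Jnt])
    fix M assume M: "M \<in> max_spec"
    note p = max_spec_prime[OF M]
    obtain i where i: "i \<in> I" "i \<notin> absorbing" "ord M i = ideal_ord M I" using ideal_ord_attained[OF I nt] .
    have sub: "I \<subseteq> localization M (i *o UNIV)"
      by (rule subset_localization_generator[OF M i(2) eq_refl[OF i(3)]])
    obtain s h where s: "s \<notin> M" "s * x = i * h"
      using sub x(1) by (auto simp: localization_def mem_elt_set_times_UNIV)
    \<comment> \<open>Finiteness of \<open>E\<close> gives one denominator for all generators, and
      (C) extends it to \<open>I\<close>. The element \<open>h * t\<close> then lies in the colon
      ideal.\<close>
    have "\<exists>t. t \<notin> M \<and> t *o E \<subseteq> i *o UNIV"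
    proof -
      have "finite E \<Longrightarrow> E \<subseteq> I \<Longrightarrow> \<exists>t. t \<notin> M \<and> t *o E \<subseteq> i *o UNIV"
      proof (induction E rule: finite_induct)
        case empty
        then show ?case using one_notin_prime[OF p] by (auto simp: elt_set_times_def)
      next
        case (insert e E)
        then obtain t where t: "t \<notin> M" "t *o E \<subseteq> i *o UNIV" by auto
        obtain w where w: "w \<notin> M" "w * e \<in> i *o UNIV"
          using sub insert by (auto simp: localization_def)
        have "(t * w) *o insert e E \<subseteq> i *o UNIV"
        proof
          fix z assume "z \<in> (t * w) *o insert e E"
          then consider "z = t * (w * e)" | b where "b \<in> E" "z = w * (t * b)"
            by (auto simp: elt_set_times_def mult_ac)
          then show "z \<in> i *o UNIV"
          proof cases
            case 1
            then show ?thesis using r_ideal_mult[OF r_ideal_principal w(2)] by simp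
          next
            case 2
            then have "t * b \<in> i *o UNIV" using t(2) by auto
            then show ?thesis using r_ideal_mult[OF r_ideal_principal] 2 by simp
          qed
        qed
        then show ?case using t(1) w(1) prime_mult_iff[OF p] by blast
      qed
      then show ?thesis using E closure_extensive by simp
    qed
    then obtain t where t: "t \<notin> M" "t *o E \<subseteq> i *o UNIV" by blast
    have tI: "t *o I \<subseteq> i *o UNIV"
      using closure_least[OF r_ideal_principal t(2)] closure_elt_times E(2) by simp
    have "h * t \<in> ?J" unfolding residual_def
    proof (intro CollectI ballI)
      fix e assume "e \<in> I"
      then have "t * e \<in> i *o UNIV" using tI by (meson set_times_intro2 subsetD)
      then obtain k where k: "t * e = i * k" by (auto simp: mem_elt_set_times_UNIV)
      have "h * t * e = h * (t * e)" by (simp add: mult_ac)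
      also have "\<dots> = (i * h) * k" unfolding k by (simp add: mult_ac)
      also have "\<dots> = x * (s * k)" unfolding s(2)[symmetric] by (simp add: mult_ac)
      finally show "h * t * e \<in> x *o UNIV" by (auto simp: mem_elt_set_times_UNIV)
    qed
    then have "i * (h * t) \<in> r (I * ?J)" using mult_mem_closure_times i(1) by blast
    moreover have "i * (h * t) = (s * t) * x"
    proof -
      have "i * (h * t) = (i * h) * t" by (simp add: mult_ac)
      then show ?thesis unfolding s(2)[symmetric] by (simp add: mult_ac)
    qed
    ultimately have mem: "(s * t) * x \<in> r (I * ?J)" by simp
    have st: "s * t \<notin> M" using s(1) t(1) prime_mult_iff[OF p] by blast
    have str: "s * t \<notin> absorbing" by (rule notin_max_spec[OF M st])
    have "ideal_ord M (r (I * ?J)) \<le> ord M ((s * t) * x)"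
      using ideal_ord_le[OF mem] str x(2) mult_mem_absorbing by blast
    also have "\<dots> = ord M x" using ord_mult[OF M str x(2)] ord_notin[OF M st] by simp
    also have "\<dots> = ideal_ord M (x *o UNIV)" by (simp add: ideal_ord_principal[OF M x(2)])
    finally have "ideal_ord M (r (I * ?J)) \<le> ideal_ord M (x *o UNIV)" .
    moreover have "r (I * ?J) \<subseteq> x *o UNIV"
      by (rule closure_least[OF r_ideal_principal])
        (auto simp: residual_def mult.commute elim!: set_times_elim)
    then have "ideal_ord M (x *o UNIV) \<le> ideal_ord M (r (I * ?J))"
      using ideal_subset_iff[OF r_ideal_closure nontrivial_times[OF I JI nt Jnt] r_ideal_principal
          nontrivial_principal[OF x(2)]] M by blast
    ultimately show "ideal_ord M (r (I * ?J)) = ideal_ord M (x *o UNIV)" by simp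
  qed (use x in \<open>simp_all add: nontrivial_principal\<close>)
  then show ?thesis using I x(2) by (auto simp: r_invertible_iff)
qed

lemma ideal_ord_residual:
  assumes C: "r_invertible r C" and I: "r_ideal r I" "nontrivial I" "I \<subseteq> C" and M: "M \<in> max_spec"
  shows "ideal_ord M I = ideal_ord M C + ideal_ord M (residual I C)"
    and "r_ideal r (residual I C)" and "nontrivial (residual I C)"
proof -
  show RI: "r_ideal r (residual I C)" by (rule r_ideal_residual[OF I(1)])
  have "I \<subseteq> residual I C" using r_ideal_mult_right[OF I(1)] by (auto simp: residual_def)
  then show Rnt: "nontrivial (residual I C)" by (rule nontrivial_mono[OF I(2)])
  show "ideal_ord M I = ideal_ord M C + ideal_ord M (residual I C)"
    using ideal_ord_times[OF M r_invertible_r_ideal[OF C] r_invertible_nontrivial[OF C] RI Rnt]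
      r_invertible_residual[OF C I(1,3)] by simp
qed

text \<open>Enlarge an invertible radical ideal \<open>B\<close> inside \<open>M\<close> by
  \<open>I\<close>. Orders can only drop, so they stay at most one and the sum is radical; being
  finitely generated, it is invertible.\<close>

lemma invertible_radical_between:
  assumes fg: "r_fin_gen r I" and M: "M \<in> max_spec" "I \<subseteq> M"
  obtains C where "r_invertible r C" "radical_r_ideal r C" "I \<subseteq> C" "C \<subseteq> M"
proof -
  obtain B where B: "r_invertible r B" "radical_r_ideal r B" "B \<subseteq> M"
    using invertible_radical_in_prime[OF max_spec_prime[OF M(1)]] M by (auto simp: max_spec_def)
  obtain E F where EF: "finite E" "E \<subseteq> I" "I = r E" "finite F" "F \<subseteq> B" "B = r F"
    using fg r_invertible_r_fin_gen[OF B(1)] by (auto simp: r_fin_gen_def)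
  let ?C = "r (E \<union> F)"
  have IC: "I \<subseteq> ?C" and BC: "B \<subseteq> ?C" using closure_mono EF(3,6) by auto
  have CM: "?C \<subseteq> M"
    using EF(2,5) M(2) B(3) by (intro closure_least[OF max_spec_r_ideal[OF M(1)]]) blast
  have Cfg: "r_fin_gen r ?C"
    using EF(1,4) closure_extensive[of "E \<union> F"] unfolding r_fin_gen_def by (metis finite_UnI r_ideal_closure)
  have Bnt: "nontrivial B" by (rule r_invertible_nontrivial[OF B(1)])
  have Cnt: "nontrivial ?C" by (rule nontrivial_mono[OF Bnt BC])
  have "ideal_ord N ?C \<le> 1" if N: "N \<in> max_spec" for N
  proof -
    have "ideal_ord N ?C \<le> ideal_ord N B"
      using BC ideal_subset_iff[OF r_invertible_r_ideal[OF B(1)] Bnt r_ideal_closure Cnt] N by blast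
    also have "\<dots> \<le> 1" using ideal_ord_radical[OF N B(2) Bnt] by simp
    finally show ?thesis .
  qed
  then have "radical_r_ideal r ?C" by (rule radical_r_ideal_if_ord_le_1[OF r_ideal_closure Cnt])
  then show ?thesis using that r_fin_gen_invertible[OF Cfg Cnt] IC CM by blast
qed

text \<open>
  With \<open>R\<close> the radical of \<open>I\<close>, the ideal \<open>S = (I : R)\<close> has order one less than \<open>I\<close> at each \<open>M \<supseteq> I\<close>,
  since it contains \<open>(I : C)\<close> for an invertible radical \<open>C\<close> between \<open>I\<close> and \<open>M\<close>. Hence \<open>RS = I\<close>.
\<close>

lemma radical_times_residual:
  assumes fg: "r_fin_gen r I" and nt: "nontrivial I"
  shows "r (radical I * residual I (radical I)) = I"
proof -
  have I: "r_ideal r I" using fg by (simp add: r_fin_gen_def)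
  let ?R = "radical I" and ?S = "residual I (radical I)"
  have rad: "radical_r_ideal r ?R" by (rule radical_r_ideal_radical[OF I])
  then have RI: "r_ideal r ?R" by (simp add: radical_r_ideal_def)
  have SI: "r_ideal r ?S" by (rule r_ideal_residual[OF I])
  have IR: "I \<subseteq> ?R" by (rule subset_radical)
  have IS: "I \<subseteq> ?S" using r_ideal_mult_right[OF I] by (auto simp: residual_def)
  have Rnt: "nontrivial ?R" and Snt: "nontrivial ?S" using nontrivial_mono[OF nt] IR IS by auto
  have RSnt: "nontrivial (r (?R * ?S))" by (rule nontrivial_times[OF RI SI Rnt Snt])
  show ?thesis
  proof (rule ideal_eqI[OF r_ideal_closure RSnt I nt])
    fix M assume M: "M \<in> max_spec"
    have eq: "ideal_ord M (r (?R * ?S)) = ideal_ord M ?R + ideal_ord M ?S"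
      by (rule ideal_ord_times[OF M RI Rnt SI Snt])
    show "ideal_ord M (r (?R * ?S)) = ideal_ord M I"
    proof (cases "I \<subseteq> M")
      case False
      then show ?thesis
        using eq IR IS ideal_ord_eq_0_iff[OF M] RI Rnt SI Snt I nt by (metis add_0 subset_trans)
    next
      case True
      obtain C where C: "r_invertible r C" "radical_r_ideal r C" "I \<subseteq> C" "C \<subseteq> M"
        using invertible_radical_between[OF fg M True] by metis
      have RC: "?R \<subseteq> C" by (rule radical_least[OF C(2,3)])
      have RM: "?R \<subseteq> M" using RC C(4) by blast
      have "residual I C \<subseteq> ?S" using RC by (auto simp: residual_def)
      then have "ideal_ord M ?S \<le> ideal_ord M (residual I C)"
        using ideal_subset_iff[OF ideal_ord_residual(2,3)[OF C(1) I nt C(3) M] SI Snt] M by blast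
      moreover have "ideal_ord M I = ideal_ord M C + ideal_ord M (residual I C)"
        by (rule ideal_ord_residual(1)[OF C(1) I nt C(3) M])
      moreover have "ideal_ord M C = 1"
        using ideal_ord_radical[OF M C(2) r_invertible_nontrivial[OF C(1)]] C(4) by simp
      moreover have "ideal_ord M ?R = 1" using ideal_ord_radical[OF M rad Rnt] RM by simp
      ultimately have "ideal_ord M (r (?R * ?S)) \<le> ideal_ord M I" using eq by simp
      moreover have "r (?R * ?S) \<subseteq> I"
        by (rule closure_least[OF I]) (auto simp: residual_def mult.commute elim!: set_times_elim)
      then have "ideal_ord M I \<le> ideal_ord M (r (?R * ?S))"
        using ideal_subset_iff[OF r_ideal_closure RSnt I nt] M by blast
      ultimately show ?thesis by simp
    qed
  qed
qed

lemma radical_invertible: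
  assumes "r_fin_gen r I" "nontrivial I"
  shows "r_invertible r (radical I)"
proof (rule r_invertible_factor)
  show "r_invertible r (r (radical I * residual I (radical I)))"
    using radical_times_residual[OF assms] r_fin_gen_invertible[OF assms] by simp
  show "r_ideal r (radical I)"
    using radical_r_ideal_radical assms(1) by (simp add: r_fin_gen_def radical_r_ideal_def)
qed

text \<open>Iterate \<open>T\<close> to \<open>(T : radical T)\<close>: each step lowers the
  positive orders by one, which is truncated subtraction, and invertibility keeps the ideal finitely
  generated.\<close>

lemma exists_ord_diff:
  assumes "r_fin_gen r I" "nontrivial I"
  shows "\<exists>S. r_fin_gen r S \<and> nontrivial S \<and> (\<forall>M\<in>max_spec. ideal_ord M S = ideal_ord M I - k)"
proof (induction k)
  case 0
  then show ?case using assms by auto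
next
  case (Suc k)
  then obtain T where T: "r_fin_gen r T" "nontrivial T"
    and ordT: "\<forall>M\<in>max_spec. ideal_ord M T = ideal_ord M I - k" by blast
  have TI: "r_ideal r T" using T by (simp add: r_fin_gen_def)
  let ?R = "radical T" and ?S = "residual T (radical T)"
  have R: "r_invertible r ?R" by (rule radical_invertible[OF T])
  have Rrad: "radical_r_ideal r ?R" by (rule radical_r_ideal_radical[OF TI])
  have SI: "r_ideal r ?S" by (rule r_ideal_residual[OF TI])
  have "r (?S * ?R) = T" using radical_times_residual[OF T] by (simp add: mult.commute)
  then have S: "r_invertible r ?S"
    using r_invertible_factor[of ?S ?R] r_fin_gen_invertible[OF T] SI by simp
  have "ideal_ord M ?S = ideal_ord M I - Suc k" if M: "M \<in> max_spec" for M
  proof -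
    have "ideal_ord M T = ideal_ord M ?R + ideal_ord M ?S"
      by (rule ideal_ord_residual(1)[OF R TI T(2) subset_radical M])
    moreover have "?R \<subseteq> M \<longleftrightarrow> T \<subseteq> M"
      using radical_least[OF prime_radical_r_ideal[OF max_spec_prime[OF M]]] subset_radical by blast
    then have "ideal_ord M ?R = (if T \<subseteq> M then 1 else 0)"
      using ideal_ord_radical[OF M Rrad r_invertible_nontrivial[OF R]] by simp
    moreover have "ideal_ord M T = 0 \<longleftrightarrow> \<not> T \<subseteq> M" by (rule ideal_ord_eq_0_iff[OF M TI T(2)])
    ultimately show ?thesis using ordT M by (cases "T \<subseteq> M") auto
  qed
  then show ?case using r_invertible_r_fin_gen[OF S] r_invertible_nontrivial[OF S] by blast
qed

end

lemma sum_list_indicator_le: "sum_list (map (\<lambda>k. if k \<le> m then 1 else 0) [1..<Suc n]) = min m n"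
  by (induction n) auto

context cancellative_ideal_system
begin

section \<open>The space of maximal ideals\<close>

lemma topspace_r_max_inv: "topspace (r_max_inv r) = r_max r"
proof -
  have "r_fin_gen r (r {})" by (auto simp: r_fin_gen_def)
  moreover have "{M \<in> r_max r. r {} \<subseteq> M} = r_max r"
    using closure_least by (auto simp: r_max_def)
  ultimately show ?thesis unfolding r_max_inv_def topology_generated_by_topspace by blast
qed

lemma openin_r_max_inv_basic: "r_fin_gen r I \<Longrightarrow> openin (r_max_inv r) {M \<in> r_max r. I \<subseteq> M}"
  unfolding r_max_inv_def by (rule topology_generated_by_Basis) blast

text \<open>Induction over the generated topology; for an intersection, the generators of the two
  ideals are united.\<close>

lemma openin_r_max_inv_nhd:
  assumes "openin (r_max_inv r) U" "M \<in> U"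
  shows "\<exists>F. r_fin_gen r F \<and> F \<subseteq> M \<and> {N \<in> r_max r. F \<subseteq> N} \<subseteq> U"
proof -
  have M: "r_ideal r M"
    using openin_subset[OF assms(1)] assms(2) topspace_r_max_inv by (auto simp: r_max_def)
  have "generate_topology_on {{M \<in> r_max r. I \<subseteq> M} | I. r_fin_gen r I} U"
    using assms(1) by (simp add: r_max_inv_def openin_topology_generated_by_iff)
  then show ?thesis using assms(2)
  proof (induction rule: generate_topology_on.induct)
    case Empty
    then show ?case by simp
  next
    case (Int A B)
    obtain F where F: "r_fin_gen r F" "F \<subseteq> M" "{N \<in> r_max r. F \<subseteq> N} \<subseteq> A"
      using Int.IH(1) Int.prems by auto
    obtain G where G: "r_fin_gen r G" "G \<subseteq> M" "{N \<in> r_max r. G \<subseteq> N} \<subseteq> B"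
      using Int.IH(2) Int.prems by auto
    obtain E1 where E1: "finite E1" "E1 \<subseteq> F" "F = r E1" using F(1) unfolding r_fin_gen_def by metis
    obtain E2 where E2: "finite E2" "E2 \<subseteq> G" "G = r E2" using G(1) unfolding r_fin_gen_def by metis
    have "r (E1 \<union> E2) \<subseteq> M" using E1(2) E2(2) F(2) G(2) by (intro closure_least[OF M]) auto
    moreover have "r_fin_gen r (r (E1 \<union> E2))"
      unfolding r_fin_gen_def using E1(1) E2(1) closure_extensive by (metis finite_UnI r_ideal_closure)
    moreover have "F \<subseteq> r (E1 \<union> E2)" "G \<subseteq> r (E1 \<union> E2)" using E1(3) E2(3) closure_mono by auto
    then have "{N \<in> r_max r. r (E1 \<union> E2) \<subseteq> N} \<subseteq> {N \<in> r_max r. F \<subseteq> N} \<inter> {N \<in> r_max r. G \<subseteq> N}" by auto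
    then have "{N \<in> r_max r. r (E1 \<union> E2) \<subseteq> N} \<subseteq> A \<inter> B" using F(3) G(3) by (meson Int_mono subset_trans)
    ultimately show ?case by metis
  next
    case (UN K)
    then obtain A where A: "A \<in> K" "M \<in> A" by auto
    then obtain F where "r_fin_gen r F" "F \<subseteq> M" "{N \<in> r_max r. F \<subseteq> N} \<subseteq> A"
      using UN.IH[OF A(1)] by auto
    moreover have "A \<subseteq> \<Union>K" using A(1) by (rule Union_upper)
    ultimately show ?case by (meson subset_trans)
  next
    case (Basis S)
    then show ?case by auto
  qed
qed

text \<open>Cover \<open>K\<close> by the sets \<open>{N. x \<in> N}\<close> with \<open>x \<notin> P\<close>, and multiply over a finite subcover.\<close>

lemma compact_Inter_not_subset:
  assumes K: "compactin (r_max_inv r) K" and P: "prime_r_ideal r P"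
    and ns: "\<And>N. N \<in> K \<Longrightarrow> \<not> N \<subseteq> P"
  shows "\<not> \<Inter>K \<subseteq> P"
proof -
  let ?V = "\<lambda>x. {M \<in> r_max r. x *o UNIV \<subseteq> M}"
  have Kmax: "K \<subseteq> r_max r" using compactin_subset_topspace[OF K] topspace_r_max_inv by simp
  have mem: "N \<in> ?V x \<longleftrightarrow> x \<in> N" if "N \<in> K" for N x
    using that Kmax principal_subset[of N x] by (auto simp: r_max_def)
  have "openin (r_max_inv r) U" if U: "U \<in> ?V ` (- P)" for U
  proof -
    obtain x where x: "U = ?V x" using U by blast
    have "r_fin_gen r (x *o UNIV)" unfolding r_fin_gen_def
      using closure_singleton closure_extensive r_ideal_principal by (metis finite.emptyI finite_insert)
    then show ?thesis unfolding x by (rule openin_r_max_inv_basic)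
  qed
  moreover have "K \<subseteq> \<Union>(?V ` (- P))"
  proof
    fix N assume N: "N \<in> K"
    then obtain x where "x \<in> N" "x \<notin> P" using ns by blast
    then show "N \<in> \<Union>(?V ` (- P))" using mem[OF N] by blast
  qed
  ultimately have "\<exists>\<F>. finite \<F> \<and> \<F> \<subseteq> ?V ` (- P) \<and> K \<subseteq> \<Union>\<F>"
    by (rule compactinD[OF K])
  then obtain \<F> where \<F>: "finite \<F>" "\<F> \<subseteq> ?V ` (- P)" "K \<subseteq> \<Union>\<F>"
    by (elim exE conjE)
  obtain F where F: "F \<subseteq> - P" "finite F" "\<F> = ?V ` F"
    using finite_subset_image[OF \<F>(1,2)] by (elim exE conjE)
  have "\<Prod>F \<notin> P"
    using F(2,1)
  proof (induction F rule: finite_induct)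
    case empty
    then show ?case using one_notin_prime[OF P] by simp
  next
    case (insert x F)
    then show ?case using prime_mult_iff[OF P] by auto
  qed
  moreover have "\<Prod>F \<in> N" if N: "N \<in> K" for N
  proof -
    obtain x where x: "x \<in> F" "x \<in> N" using \<F>(3) F(3) mem[OF N] N by blast
    have "r_ideal r N" using N Kmax by (auto simp: r_max_def)
    then show ?thesis using r_ideal_mult_right[OF _ x(2)] prod.remove[OF F(2) x(1)] by metis
  qed
  ultimately show ?thesis by blast
qed

text \<open>Distinct maximal ideals are incomparable, so the preceding lemma applies with
  \<open>P = M\<close>.\<close>

lemma compact_Inter_subset_r_max:
  assumes K: "compactin (r_max_inv r) K" and M: "M \<in> r_max r" "\<Inter>K \<subseteq> M"
  shows "M \<in> K"
proof (rule ccontr)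
  assume "M \<notin> K"
  have Kmax: "K \<subseteq> r_max r" using compactin_subset_topspace[OF K] topspace_r_max_inv by simp
  have "\<not> N \<subseteq> M" if N: "N \<in> K" for N
  proof
    assume "N \<subseteq> M"
    moreover have "N \<in> r_max r" using N Kmax by (rule subsetD[rotated])
    ultimately have "M = N" using M(1) by (simp add: r_max_def)
    then show False using N \<open>M \<notin> K\<close> by simp
  qed
  then show False using compact_Inter_not_subset[OF K r_max_prime[OF M(1)]] M(2) by blast
qed

text \<open>Here the preceding avoidance argument is applied to the prime
  \<open>absorbing\<close>.\<close>

lemma compact_Inter_nontrivial:
  assumes K: "compactin (r_max_inv r) K" and nt: "\<And>M. M \<in> r_max r \<Longrightarrow> nontrivial M"
  shows "nontrivial (\<Inter>K)"
proof (cases "K = {}")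
  case True
  then show ?thesis using nontrivial_UNIV by simp
next
  case False
  have Kmax: "K \<subseteq> r_max r" using compactin_subset_topspace[OF K] topspace_r_max_inv by simp
  then obtain N where "N \<in> r_max r" using False by blast
  then have P: "prime_r_ideal r absorbing" using prime_absorbing r_max_prime by blast
  have "\<not> N \<subseteq> absorbing" if "N \<in> K" for N using that nt Kmax unfolding nontrivial_def by blast
  then have "\<not> \<Inter>K \<subseteq> absorbing" by (rule compact_Inter_not_subset[OF K P])
  moreover have "absorbing \<subseteq> \<Inter>K" using Kmax absorbing_subset by (auto simp: r_max_def)
  ultimately show ?thesis unfolding nontrivial_def by blast
qed

text \<open>If the levels of \<open>f\<close> were never empty, their intersections would generate a proper ideal.\<close>

lemma levels_bounded:
  fixes f :: "'a set \<Rightarrow> nat"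
  assumes \<M>: "\<M> \<subseteq> r_max r"
    and closed: "\<And>k M. 1 \<le> k \<Longrightarrow> M \<in> r_max r \<Longrightarrow> \<Inter>{N \<in> \<M>. k \<le> f N} \<subseteq> M \<Longrightarrow> k \<le> f M"
  shows "\<exists>n. \<forall>M\<in>\<M>. f M \<le> n"
proof (rule ccontr)
  assume unb: "\<not> ?thesis"
  let ?J = "\<lambda>k. \<Inter>{N \<in> \<M>. k \<le> f N}"
  have JI: "r_ideal r (?J k)" for k
    using \<M> by (intro r_ideal_Inter) (auto simp: r_max_def)
  have mono: "?J k \<subseteq> ?J l" if "k \<le> l" for k l using that by fastforce
  have UI: "r_ideal r (\<Union>(range ?J))"
  proof (rule r_ideal_Union_chain)
    fix A B assume "A \<in> range ?J" "B \<in> range ?J"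
    then obtain k l where "A = ?J k" "B = ?J l" by blast
    then show "A \<subseteq> B \<or> B \<subseteq> A" using mono[of k l] mono[of l k] linear[of k l] by metis
  qed (use JI in auto)
  have "1 \<notin> ?J k" for k
  proof -
    obtain M where M: "M \<in> \<M>" "\<not> f M \<le> k" using unb by blast
    then have "1 \<notin> M" using one_notin_prime r_max_prime \<M> by blast
    then show ?thesis using M by auto
  qed
  then have "\<Union>(range ?J) \<noteq> UNIV" by blast
  then obtain M where M: "M \<in> r_max r" "\<Union>(range ?J) \<subseteq> M" by (rule exists_r_max[OF UI])
  then have "?J (Suc (f M)) \<subseteq> M" by blast
  then show False using closed[OF _ M(1), of "Suc (f M)"] by simp
qed

lemma nontrivial_r_max:
  assumes "r {} \<notin> r_max r" "M \<in> r_max r"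
  shows "nontrivial M"
proof (rule ccontr)
  assume "\<not> nontrivial M"
  then have M: "M = absorbing" using assms(2) not_nontrivial by (simp add: r_max_def)
  have "r {} \<subseteq> M" "M \<noteq> UNIV" using closure_least assms(2) by (auto simp: r_max_def)
  then have "r {} = M" using M closure_empty by auto
  then show False using assms by simp
qed

lemma r_prod_Cons: "r_prod r (J # Js) = r (J * r_prod r Js)"
  by (simp add: r_prod_def closure_times_right)

lemma r_prod_Nil: "r_prod r [] = UNIV"
  using closure_one by (simp add: r_prod_def)

lemma r_prod_singleton: "r_ideal r I \<Longrightarrow> r_prod r [I] = I"
  by (metis closure_eq mult_1_right prod_list.Cons prod_list.Nil r_prod_def)

lemma r_ideal_r_prod: "r_ideal r (r_prod r Js)"
  by (simp add: r_prod_def)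

end

context SP_ideal_system
begin

section \<open>Factorization into a chain of radical ideals\<close>

lemma ideal_ord_r_prod:
  assumes "\<And>J. J \<in> set Js \<Longrightarrow> r_ideal r J \<and> nontrivial J"
  shows "nontrivial (r_prod r Js)"
    and "M \<in> max_spec \<Longrightarrow> ideal_ord M (r_prod r Js) = sum_list (map (ideal_ord M) Js)"
proof -
  have "nontrivial (r_prod r Js) \<and>
    (M \<in> max_spec \<longrightarrow> ideal_ord M (r_prod r Js) = sum_list (map (ideal_ord M) Js))"
    using assms
  proof (induction Js)
    case Nil
    then show ?case using nontrivial_UNIV ideal_ord_UNIV by (simp add: r_prod_Nil)
  next
    case (Cons J Js)
    have IH: "nontrivial (r_prod r Js)"
      "M \<in> max_spec \<longrightarrow> ideal_ord M (r_prod r Js) = sum_list (map (ideal_ord M) Js)"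
      using Cons by auto
    have J: "r_ideal r J" "nontrivial J" using Cons.prems[of J] by auto
    show ?case
      using nontrivial_times[OF J(1) r_ideal_r_prod J(2) IH(1)]
        ideal_ord_times[OF _ J r_ideal_r_prod IH(1), of M] IH(2)
      by (simp add: r_prod_Cons)
  qed
  then show "nontrivial (r_prod r Js)"
    and "M \<in> max_spec \<Longrightarrow> ideal_ord M (r_prod r Js) = sum_list (map (ideal_ord M) Js)" by auto
qed

text \<open>With \<open>k = Suc j\<close>, choose \<open>x\<close> in \<open>I\<close> of least
  order at \<open>M\<close> and let \<open>S\<close> have order \<open>ord N x - j\<close> at every
  \<open>N\<close>. It lies in all members of the level, hence in \<open>M\<close>, but its order at
  \<open>M\<close> is 0 if that of \<open>I\<close> is at most \<open>j\<close>.\<close>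

lemma Inter_level_subset:
  assumes I: "r_ideal r I" "nontrivial I" and M: "M \<in> max_spec"
    and sub: "\<Inter>{N \<in> max_spec. k \<le> ideal_ord N I} \<subseteq> M"
  shows "k \<le> ideal_ord M I"
proof (rule ccontr)
  assume "\<not> ?thesis"
  then obtain j where k: "k = Suc j" and j: "ideal_ord M I \<le> j"
    by (metis not_less_eq_eq old.nat.exhaust zero_le)
  obtain x where x: "x \<in> I" "x \<notin> absorbing" "ord M x = ideal_ord M I" using ideal_ord_attained[OF I] .
  have "r_fin_gen r (x *o UNIV)"
    using r_invertible_r_fin_gen r_invertible_principal[OF x(2)] by blast
  then obtain S where S: "r_fin_gen r S" "nontrivial S"
    "\<forall>N\<in>max_spec. ideal_ord N S = ideal_ord N (x *o UNIV) - j"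
    using exists_ord_diff nontrivial_principal[OF x(2)] by blast
  have SI: "r_ideal r S" using S(1) by (simp add: r_fin_gen_def)
  have ordS: "ideal_ord N S = ord N x - j" if "N \<in> max_spec" for N
    using S(3) that ideal_ord_principal[OF that x(2)] by simp
  have "S \<subseteq> N" if N: "N \<in> max_spec" "k \<le> ideal_ord N I" for N
  proof -
    have "k \<le> ord N x" using N(2) ideal_ord_le[OF x(1,2)] le_trans by blast
    then have "ideal_ord N S \<noteq> 0" using ordS[OF N(1)] k by simp
    then show ?thesis using ideal_ord_eq_0_iff[OF N(1) SI S(2)] by simp
  qed
  then have "S \<subseteq> M" using sub by blast
  moreover have "ideal_ord M S = 0" using ordS[OF M] x(3) j by simp
  ultimately show False using ideal_ord_eq_0_iff[OF M SI S(2)] by blast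
qed

text \<open>Stated for an arbitrary \<open>f\<close> because it serves twice: for the orders of a
  given ideal, and for the functions to be realized in (6).\<close>

lemma exists_ideal_with_ord:
  fixes f :: "'a set \<Rightarrow> nat"
  assumes closed: "\<And>k M. 1 \<le> k \<Longrightarrow> M \<in> max_spec \<Longrightarrow>
      \<Inter>{N \<in> max_spec. k \<le> f N} \<subseteq> M \<Longrightarrow> k \<le> f M"
    and nt: "\<And>k. 1 \<le> k \<Longrightarrow> nontrivial (\<Inter>{N \<in> max_spec. k \<le> f N})"
  obtains Js where "\<forall>J\<in>set Js. radical_r_ideal r J \<and> J \<noteq> UNIV" "sorted_wrt (\<subseteq>) Js"
    "nontrivial (r_prod r Js)" "\<forall>M\<in>max_spec. ideal_ord M (r_prod r Js) = f M"
proof -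
  let ?J = "\<lambda>k. \<Inter>{N \<in> max_spec. k \<le> f N}"
  have "\<exists>n. \<forall>M\<in>max_spec. f M \<le> n"
  proof (rule levels_bounded)
    show "max_spec \<subseteq> r_max r" by (auto simp: max_spec_def)
    fix k M assume k: "1 \<le> k" and M: "M \<in> r_max r" "?J k \<subseteq> M"
    then have "M \<in> max_spec" using nontrivial_mono[OF nt[OF k] M(2)] by (simp add: max_spec_def)
    then show "k \<le> f M" using closed k M(2) by blast
  qed
  then obtain n where n: "\<And>M. M \<in> max_spec \<Longrightarrow> f M \<le> n" by blast
  \<comment> \<open>An empty level intersects to H. Such factors are dropped to keep the chain
    proper; as H has order 0, the sums do not change.\<close>
  let ?Js = "filter (\<lambda>J. J \<noteq> UNIV) (map ?J [1..<Suc n])"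
  have rad: "radical_r_ideal r (?J k)" for k
    unfolding radical_r_ideal_def
  proof (intro conjI allI impI)
    show "r_ideal r (?J k)" by (rule r_ideal_Inter) (auto dest: max_spec_r_ideal)
    fix x m assume "1 \<le> m \<and> x ^ m \<in> ?J k"
    then show "x \<in> ?J k" using prime_power[OF max_spec_prime] by blast
  qed
  have Js: "r_ideal r J \<and> nontrivial J" if "J \<in> set ?Js" for J
    using that nt rad by (auto simp: radical_r_ideal_def)
  have "sorted_wrt (\<subseteq>) (map ?J [1..<Suc n])"
    unfolding sorted_wrt_map
    by (rule sorted_wrt_mono_rel[OF _ sorted_upt[of 1 "Suc n"]]) fastforce
  then have sorted: "sorted_wrt (\<subseteq>) ?Js" by (rule sorted_wrt_filter)
  have "ideal_ord M (r_prod r ?Js) = f M" if M: "M \<in> max_spec" for M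
  proof -
    have "ideal_ord M (r_prod r ?Js) = sum_list (map (ideal_ord M) ?Js)"
      by (rule ideal_ord_r_prod(2)[OF Js M])
    also have "\<dots> = sum_list (map (ideal_ord M) (map ?J [1..<Suc n]))"
      using ideal_ord_UNIV[OF M] by (intro sum_list_map_filter) auto
    also have "\<dots> = sum_list (map (\<lambda>k. if k \<le> f M then 1 else 0) [1..<Suc n])"
      unfolding map_map
    proof (rule arg_cong[where f = sum_list], rule map_cong[OF refl])
      fix k assume k: "k \<in> set [1..<Suc n]"
      then have k: "1 \<le> k" by auto
      have "?J k \<subseteq> M \<longleftrightarrow> k \<le> f M" using closed[OF k M] M by blast
      then show "(ideal_ord M \<circ> ?J) k = (if k \<le> f M then 1 else 0)"
        using ideal_ord_radical[OF M rad nt[OF k]] by simp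
    qed
    also have "\<dots> = f M" unfolding sum_list_indicator_le using n[OF M] by simp
    finally show ?thesis .
  qed
  then have ord: "\<forall>M\<in>max_spec. ideal_ord M (r_prod r ?Js) = f M" by (rule ballI)
  have proper: "\<forall>J\<in>set ?Js. radical_r_ideal r J \<and> J \<noteq> UNIV" using rad by auto
  show ?thesis by (rule that[OF proper sorted ideal_ord_r_prod(1)[OF Js] ord])
qed

lemma chain_factorization:
  assumes I: "r_ideal r I" "nontrivial I"
  shows "\<exists>Js. (\<forall>J\<in>set Js. radical_r_ideal r J \<and> J \<noteq> UNIV) \<and> sorted_wrt (\<subseteq>) Js \<and> I = r_prod r Js"
proof -
  let ?J = "\<lambda>k. \<Inter>{N \<in> max_spec. k \<le> ideal_ord N I}"
  have nt: "nontrivial (?J k)" if "1 \<le> k" for k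
  proof (rule nontrivial_mono[OF I(2)])
    show "I \<subseteq> ?J k" using that ideal_ord_eq_0_iff[OF _ I] by fastforce
  qed
  have closed: "k \<le> ideal_ord M I" if "1 \<le> k" "M \<in> max_spec" "?J k \<subseteq> M" for k M
    by (rule Inter_level_subset[OF I that(2,3)])
  obtain Js where Js: "\<forall>J\<in>set Js. radical_r_ideal r J \<and> J \<noteq> UNIV" "sorted_wrt (\<subseteq>) Js"
    "nontrivial (r_prod r Js)" "\<forall>M\<in>max_spec. ideal_ord M (r_prod r Js) = ideal_ord M I"
    by (rule exists_ideal_with_ord[of "\<lambda>M. ideal_ord M I", OF closed nt])
  have "I = r_prod r Js" using Js by (intro ideal_eqI[OF I r_ideal_r_prod]) auto
  then show ?thesis using Js by blast
qed

section \<open>Uniqueness of the chain\<close>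

lemma proper_ideal_ord_pos:
  assumes "r_ideal r J" "nontrivial J" "J \<noteq> UNIV"
  obtains M where "M \<in> max_spec" "ideal_ord M J \<noteq> 0"
proof -
  obtain M where M: "M \<in> max_spec" "J \<subseteq> M" by (rule exists_max_spec[OF assms])
  then have "ideal_ord M J \<noteq> 0" using ideal_ord_eq_0_iff[OF M(1) assms(1,2)] by simp
  then show ?thesis using that M(1) by simp
qed

text \<open>The head is the smallest member, so it lies in \<open>M\<close> as soon as any other
  member does.\<close>

lemma chain_head_ord:
  assumes "\<And>J. J \<in> set (L # Ls) \<Longrightarrow> r_ideal r J \<and> nontrivial J"
    and "sorted_wrt (\<subseteq>) (L # Ls)" and M: "M \<in> max_spec"
  shows "ideal_ord M L = 0 \<longleftrightarrow> sum_list (map (ideal_ord M) (L # Ls)) = 0"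
proof -
  have "ideal_ord M J = 0" if z: "ideal_ord M L = 0" and J: "J \<in> set Ls" for J
  proof -
    have "L \<subseteq> J" using assms(2) J by simp
    moreover have "\<not> L \<subseteq> M" using ideal_ord_eq_0_iff[OF M] assms(1)[of L] z by simp
    ultimately show ?thesis using ideal_ord_eq_0_iff[OF M, of J] assms(1)[of J] J by auto
  qed
  then show ?thesis by (auto simp: sum_list_eq_0_iff)
qed

text \<open>The support of the total order determines where the head has order one, hence the head,
  since orders of radical ideals are 0 or 1. Subtract it and recurse; properness prevents one chain
  from ending early.\<close>

lemma chain_unique:
  assumes "\<And>J. J \<in> set Js \<Longrightarrow> radical_r_ideal r J \<and> nontrivial J \<and> J \<noteq> UNIV" "sorted_wrt (\<subseteq>) Js"
    and "\<And>J. J \<in> set Js' \<Longrightarrow> radical_r_ideal r J \<and> nontrivial J \<and> J \<noteq> UNIV" "sorted_wrt (\<subseteq>) Js'"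
    and "\<And>M. M \<in> max_spec \<Longrightarrow>
      sum_list (map (ideal_ord M) Js) = sum_list (map (ideal_ord M) Js')"
  shows "Js = Js'"
  using assms
proof (induction Js arbitrary: Js')
  case Nil
  show ?case
  proof (cases Js')
    case (Cons K Ks)
    then have "r_ideal r K" "nontrivial K" "K \<noteq> UNIV"
      using Nil.prems(3)[of K] by (auto simp: radical_r_ideal_def)
    then obtain M where M: "M \<in> max_spec" "ideal_ord M K \<noteq> 0" by (rule proper_ideal_ord_pos)
    then show ?thesis using Nil.prems(5)[OF M(1)] Cons by simp
  qed simp
next
  case (Cons J Js)
  have J: "radical_r_ideal r J" "nontrivial J" "r_ideal r J" "J \<noteq> UNIV"
    using Cons.prems(1)[of J] by (auto simp: radical_r_ideal_def)
  obtain M where M: "M \<in> max_spec" "ideal_ord M J \<noteq> 0"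
    by (rule proper_ideal_ord_pos[OF J(3,2,4)])
  then obtain K Ks where Js': "Js' = K # Ks"
    using Cons.prems(5)[OF M(1)] by (cases Js') auto
  have K: "radical_r_ideal r K" "nontrivial K" "r_ideal r K"
    using Cons.prems(3)[of K] Js' by (auto simp: radical_r_ideal_def)
  have "ideal_ord M J = ideal_ord M K" if M: "M \<in> max_spec" for M
  proof -
    have "ideal_ord M J = 0 \<longleftrightarrow> sum_list (map (ideal_ord M) (J # Js)) = 0"
      using Cons.prems(1,2) by (intro chain_head_ord[OF _ _ M]) (auto simp: radical_r_ideal_def)
    moreover have "ideal_ord M K = 0 \<longleftrightarrow> sum_list (map (ideal_ord M) (K # Ks)) = 0"
      using Cons.prems(3,4) Js' by (intro chain_head_ord[OF _ _ M]) (auto simp: radical_r_ideal_def)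
    ultimately have "ideal_ord M J = 0 \<longleftrightarrow> ideal_ord M K = 0"
      using Cons.prems(5)[OF M] unfolding Js' by metis
    then show ?thesis
      using ideal_ord_radical[OF M J(1,2)] ideal_ord_radical[OF M K(1,2)] by (auto split: if_splits)
  qed
  then have JK: "J = K" using ideal_eqI[OF J(3,2) K(3,2)] by simp
  have "Js = Ks"
  proof (rule Cons.IH)
    fix M assume "M \<in> max_spec"
    then show "sum_list (map (ideal_ord M) Js) = sum_list (map (ideal_ord M) Ks)"
      using Cons.prems(5)[of M] by (simp add: Js' JK)
  qed (use Cons.prems(1-4) Js' in auto)
  then show ?case using JK Js' by simp
qed

lemma chain_factorization_unique:
  assumes I: "r_ideal r I" "nontrivial I"
  shows "\<exists>!Js. (\<forall>J\<in>set Js. radical_r_ideal r J \<and> J \<noteq> UNIV) \<and> sorted_wrt (\<subseteq>) Js \<and> I = r_prod r Js"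
proof (rule ex_ex1I)
  show "\<exists>Js. (\<forall>J\<in>set Js. radical_r_ideal r J \<and> J \<noteq> UNIV) \<and> sorted_wrt (\<subseteq>) Js \<and> I = r_prod r Js"
    by (rule chain_factorization[OF I])
  \<comment> \<open>Each factor contains the product \<open>I\<close> and inherits its
    nontriviality, so its orders are meaningful.\<close>
  have nt: "radical_r_ideal r J \<and> nontrivial J \<and> J \<noteq> UNIV"
    if "\<forall>J\<in>set Js. radical_r_ideal r J \<and> J \<noteq> UNIV" "I = r_prod r Js" "J \<in> set Js" for J Js
  proof -
    have "prod_list Js = J * prod_list (remove1 J Js)"
      using that(3) by (rule prod_list_remove1)
    moreover have "r_ideal r J" using that by (simp add: radical_r_ideal_def)
    ultimately have "I \<subseteq> J" using that(2) closure_times_subset_left by (simp add: r_prod_def)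
    then show ?thesis using that nontrivial_mono[OF I(2)] by blast
  qed
  fix Js Js'
  assume Js: "(\<forall>J\<in>set Js. radical_r_ideal r J \<and> J \<noteq> UNIV) \<and> sorted_wrt (\<subseteq>) Js \<and> I = r_prod r Js"
    and Js': "(\<forall>J\<in>set Js'. radical_r_ideal r J \<and> J \<noteq> UNIV) \<and> sorted_wrt (\<subseteq>) Js' \<and> I = r_prod r Js'"
  have sum: "sum_list (map (ideal_ord M) Ks) = ideal_ord M I"
    if "\<forall>J\<in>set Ks. radical_r_ideal r J \<and> J \<noteq> UNIV" "I = r_prod r Ks" "M \<in> max_spec" for Ks M
    using ideal_ord_r_prod(2)[of Ks M] nt[OF that(1,2)] that(2,3) by (simp add: radical_r_ideal_def)
  show "Js = Js'"
  proof (rule chain_unique)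
    show "radical_r_ideal r J \<and> nontrivial J \<and> J \<noteq> UNIV" if "J \<in> set Js" for J
      using Js that by (intro nt[of Js]) simp_all
    show "radical_r_ideal r J \<and> nontrivial J \<and> J \<noteq> UNIV" if "J \<in> set Js'" for J
      using Js' that by (intro nt[of Js']) simp_all
    show "sorted_wrt (\<subseteq>) Js" "sorted_wrt (\<subseteq>) Js'" using Js Js' by simp_all
    fix M assume "M \<in> max_spec"
    then show "sum_list (map (ideal_ord M) Js) = sum_list (map (ideal_ord M) Js')"
      using sum[of Js M] sum[of Js' M] Js Js' by metis
  qed
qed

lemma exists_chain_factorization:
  assumes "r_ideal r I"
  shows "\<exists>Js. (\<forall>J\<in>set Js. radical_r_ideal r J) \<and> sorted_wrt (\<subseteq>) Js \<and> I = r_prod r Js"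
proof (cases "nontrivial I")
  case True
  then show ?thesis using chain_factorization[OF assms] by blast
next
  case False
  then have "radical_r_ideal r I" using not_nontrivial[OF assms] radical_r_ideal_trivial assms by metis
  then show ?thesis using r_prod_singleton[OF assms] by (intro exI[of _ "[I]"]) auto
qed

end

lemma sum_list_enat: "sum_list (map (\<lambda>x. enat (h x)) xs) = enat (sum_list (map h xs))"
  by (induction xs) (simp_all add: zero_enat_def)

context cancellative_ideal_system
begin

section \<open>Upper semicontinuous functions\<close>

lemma usc_bottom_le: "x \<in> topspace X \<Longrightarrow> f x \<le> usc_bottom X x"
  by (simp add: usc_bottom_def)

text \<open>A function in \<open>U(X)\<close> is a finite sum of indicators of its compact level
  sets. Pulling these back factors the ideal, since the ideals of zero-one functions are
  radical.\<close>

lemma isomorphic_imp_SP: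
  assumes iso: "mult_lattice_isomorphic (r_ideal_lattice r) (usc_lattice (r_max_inv r))"
  shows "r_SP_monoid r"
proof -
  let ?X = "r_max_inv r"
  note top = topspace_r_max_inv
  obtain \<phi> where bij: "bij_betw \<phi> {I. r_ideal r I} (insert (usc_bottom ?X) (usc_functions ?X))"
    and le: "\<And>I J. r_ideal r I \<Longrightarrow> r_ideal r J \<Longrightarrow> I \<subseteq> J \<longleftrightarrow> (\<forall>M\<in>r_max r. \<phi> J M \<le> \<phi> I M)"
    and mult: "\<And>I J. r_ideal r I \<Longrightarrow> r_ideal r J \<Longrightarrow> \<phi> (r (I * J)) = (\<lambda>M\<in>r_max r. \<phi> I M + \<phi> J M)"
    and unit: "\<phi> UNIV = (\<lambda>M\<in>r_max r. 0)"
    using iso unfolding mult_lattice_isomorphic_def r_ideal_lattice_def usc_lattice_def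
    by (auto simp: top)
  \<comment> \<open>The image of \<open>x ^ n\<close> vanishes wherever that of \<open>x\<close>
    does, so a function bounded by one that is below the former is below the latter.\<close>
  have zero_one_radical: "radical_r_ideal r J"
    if J: "r_ideal r J" and le1: "\<And>M. M \<in> r_max r \<Longrightarrow> \<phi> J M \<le> 1" for J
    unfolding radical_r_ideal_def
  proof (intro conjI allI impI J, elim conjE)
    fix x n assume xn: "x ^ n \<in> J"
    have "\<phi> J M \<le> \<phi> (x *o UNIV) M" if M: "M \<in> r_max r" for M
    proof (cases "\<phi> (x *o UNIV) M = 0")
      case True
      have "\<phi> (x ^ m *o UNIV) M = 0" for m
      proof (induction m)
        case 0
        then show ?case using unit M by (simp add: elt_set_times_def)
      next
        case (Suc m)
        have "\<phi> (x ^ Suc m *o UNIV) = (\<lambda>M\<in>r_max r. \<phi> (x *o UNIV) M + \<phi> (x ^ m *o UNIV) M)"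
          using mult[of "x *o UNIV" "x ^ m *o UNIV"] by (simp add: closure_principal_times)
        then show ?case using True Suc M by simp
      qed
      moreover have "\<phi> J M \<le> \<phi> (x ^ n *o UNIV) M"
        using le[OF r_ideal_principal J] principal_subset[OF J] xn M by blast
      ultimately show ?thesis by simp
    next
      case False
      then have "1 \<le> \<phi> (x *o UNIV) M" 
        using ileI1[of 0 "\<phi> (x *o UNIV) M"] by (simp add: one_eSuc zero_less_iff_neq_zero)
      then show ?thesis using le1[OF M] order_trans by blast
    qed
    then show "x \<in> J" using le[OF r_ideal_principal J] principal_subset[OF J] by blast
  qed
  have \<phi>_prod: "\<phi> (r_prod r Js) M = sum_list (map (\<lambda>J. \<phi> J M) Js)"
    if "\<forall>J\<in>set Js. r_ideal r J" "M \<in> r_max r" for Js M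
    using that
  proof (induction Js)
    case Nil
    then show ?case using unit by (simp add: r_prod_Nil)
  next
    case (Cons J Js)
    then show ?case using mult[of J "r_prod r Js"] r_ideal_r_prod by (simp add: r_prod_Cons)
  qed
  show ?thesis unfolding r_SP_monoid_def
  proof (intro allI impI)
    fix I assume I: "r_ideal r I"
    show "\<exists>Js. (\<forall>J\<in>set Js. radical_r_ideal r J) \<and> I = r_prod r Js"
    proof (cases "\<phi> I = usc_bottom ?X")
      case True
      \<comment> \<open>An ideal sent to the bottom function is below every ideal, and the least
        ideal is radical.\<close>
      then have "I \<subseteq> r {}" using le[OF I r_ideal_closure] usc_bottom_le[of _ ?X] top by auto
      then have "I = r {}" using closure_least[OF I, of "{}"] by blast
      then show ?thesis
        using radical_r_ideal_closure_empty r_prod_singleton[OF I] by (intro exI[of _ "[I]"]) simp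
    next
      case False
      then have usc: "\<phi> I \<in> usc_functions ?X" using bij I by (auto dest!: bij_betwE)
      define g where "g M = the_enat (\<phi> I M)" for M
      have g: "\<phi> I M = enat (g M)" if "M \<in> r_max r" for M
        using usc that by (auto simp: usc_functions_def PiE_def Pi_def top g_def)
      have level: "{M \<in> r_max r. enat k \<le> \<phi> I M} = {M \<in> r_max r. k \<le> g M}" for k
        using g by auto
      have comp: "compactin ?X {M \<in> r_max r. k \<le> g M}" if "1 \<le> k" for k
        using usc that unfolding usc_functions_def top level[symmetric] by blast
      have "\<exists>n. \<forall>M\<in>r_max r. g M \<le> n"
      proof (rule levels_bounded[OF subset_refl])
        fix k M assume "1 \<le> k" "M \<in> r_max r" "\<Inter>{N \<in> r_max r. k \<le> g N} \<subseteq> M"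
        then show "k \<le> g M" using compact_Inter_subset_r_max[OF comp] by blast
      qed
      then obtain n where n: "\<And>M. M \<in> r_max r \<Longrightarrow> g M \<le> n" by blast
      \<comment> \<open>The indicator of the level set at \<open>k\<close>: its level at 1 is that
        compact set and its higher levels are empty.\<close>
      define ind where "ind k = (\<lambda>M\<in>r_max r. if k \<le> g M then 1 else 0 :: enat)" for k
      have ind_usc: "ind k \<in> usc_functions ?X" if k: "1 \<le> k" for k
        unfolding usc_functions_def top
      proof (intro CollectI conjI allI impI)
        show "ind k \<in> r_max r \<rightarrow>\<^sub>E range enat"
          by (auto simp: ind_def one_enat_def zero_enat_def)
        fix j :: nat assume j: "1 \<le> j"
        have "{M \<in> r_max r. enat j \<le> ind k M} = (if j = 1 then {M \<in> r_max r. k \<le> g M} else {})"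
          using j by (auto simp: ind_def one_enat_def zero_enat_def)
        then show "compactin ?X {M \<in> r_max r. enat j \<le> ind k M}" using comp[OF k] by simp
      qed
      have "\<forall>k\<in>{1..}. \<exists>J. r_ideal r J \<and> \<phi> J = ind k"
        using ind_usc bij unfolding bij_betw_def by (auto simp: image_iff set_eq_iff) metis
      then obtain J where J: "\<And>k. 1 \<le> k \<Longrightarrow> r_ideal r (J k) \<and> \<phi> (J k) = ind k"
        by (metis atLeast_iff)
      let ?Js = "map J [1..<Suc n]"
      have JsI: "\<forall>J\<in>set ?Js. r_ideal r J" using J by auto
      have rad: "\<forall>J\<in>set ?Js. radical_r_ideal r J"
      proof
        fix L assume "L \<in> set ?Js"
        then obtain k where k: "1 \<le> k" "L = J k" by auto
        show "radical_r_ideal r L"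
          using J[OF k(1)] by (intro zero_one_radical) (auto simp: k(2) ind_def)
      qed
      have "\<phi> (r_prod r ?Js) M = \<phi> I M" if M: "M \<in> r_max r" for M
      proof -
        have "\<phi> (r_prod r ?Js) M = sum_list (map (\<lambda>J. \<phi> J M) ?Js)"
          by (rule \<phi>_prod[OF JsI M])
        also have "\<dots> = sum_list (map (\<lambda>k. enat (if k \<le> g M then 1 else 0)) [1..<Suc n])"
          unfolding map_map
        proof (rule arg_cong[where f = sum_list], rule map_cong[OF refl])
          fix k assume "k \<in> set [1..<Suc n]"
          then have "1 \<le> k" by auto
          then show "((\<lambda>J. \<phi> J M) \<circ> J) k = enat (if k \<le> g M then 1 else 0)"
            using J M by (simp add: ind_def one_enat_def zero_enat_def)
        qed
        also have "\<dots> = enat (sum_list (map (\<lambda>k. if k \<le> g M then 1 else 0) [1..<Suc n]))"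
          by (rule sum_list_enat)
        also have "\<dots> = \<phi> I M" unfolding sum_list_indicator_le using n[OF M] g[OF M] by simp
        finally show ?thesis .
      qed
      then have "I = r_prod r ?Js"
        using le[OF I r_ideal_r_prod] le[OF r_ideal_r_prod I] by (intro subset_antisym) auto
      then show ?thesis using rad by blast
    qed
  qed
qed

end

context SP_ideal_system
begin

text \<open>
  Let \<open>R\<close> be the radical of a principal ideal inside \<open>J\<close>. A member \<open>V(F)\<close> of the cover is cut down
  to \<open>V(C)\<close> with \<open>C = (F \<union> R)\<^sub>r\<close>; within \<open>V(R)\<close> the set \<open>V(C)\<close> is complementary to \<open>V(R : C)\<close>, so
  the covering property says that \<open>J\<close> and the ideals \<open>(R : C)\<close> generate \<open>H\<close>.
\<close>

lemma compactin_above_ideal: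
  assumes J: "r_ideal r J" "nontrivial J" and nt: "r {} \<notin> r_max r"
  shows "compactin (r_max_inv r) {M \<in> r_max r. J \<subseteq> M}"
  unfolding compactin_def
proof (intro conjI allI impI)
  show "{M \<in> r_max r. J \<subseteq> M} \<subseteq> topspace (r_max_inv r)" by (auto simp: topspace_r_max_inv)
  fix \<U> assume \<U>: "(\<forall>U\<in>\<U>. openin (r_max_inv r) U) \<and> {M \<in> r_max r. J \<subseteq> M} \<subseteq> \<Union>\<U>"
  then have op: "\<forall>U\<in>\<U>. openin (r_max_inv r) U" and cov: "{M \<in> r_max r. J \<subseteq> M} \<subseteq> \<Union>\<U>"
    by (rule conjunct1, rule conjunct2)
  let ?V = "{M \<in> r_max r. J \<subseteq> M}"
  have spec: "M \<in> max_spec" if "M \<in> ?V" for M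
    using that nontrivial_r_max[OF nt] by (simp add: max_spec_def)
  obtain y where y: "y \<in> J" "y \<notin> absorbing" using J nontrivial_iff by blast
  define R where "R = radical (y *o UNIV)"
  have yfg: "r_fin_gen r (y *o UNIV)" by (simp add: r_invertible_r_fin_gen r_invertible_principal y(2))
  have Rinv: "r_invertible r R"
    unfolding R_def by (rule radical_invertible[OF yfg nontrivial_principal[OF y(2)]])
  have Rrad: "radical_r_ideal r R" unfolding R_def by (rule radical_r_ideal_radical[OF r_ideal_principal])
  have Rnt: "nontrivial R" by (rule r_invertible_nontrivial[OF Rinv])
  have RI: "r_ideal r R" by (rule r_invertible_r_ideal[OF Rinv])
  have RM: "R \<subseteq> M" if M: "M \<in> ?V" for M
  proof -
    have "y *o UNIV \<subseteq> M" using y(1) M principal_subset[OF max_spec_r_ideal[OF spec[OF M]]] by blast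
    then show ?thesis
      unfolding R_def by (rule radical_least[OF prime_radical_r_ideal[OF max_spec_prime[OF spec[OF M]]]])
  qed
  define Q where "Q M U C \<longleftrightarrow>
      U \<in> \<U> \<and> R \<subseteq> C \<and> {N \<in> r_max r. C \<subseteq> N} \<subseteq> U \<and> \<not> residual R C \<subseteq> M" for M U C
  have "\<exists>U C. Q M U C" if M: "M \<in> ?V" for M
  proof -
    note Ms = spec[OF M]
    obtain U where U: "U \<in> \<U>" "M \<in> U" using cov M by blast
    then obtain F where F: "r_fin_gen r F" "F \<subseteq> M" "{N \<in> r_max r. F \<subseteq> N} \<subseteq> U"
      using openin_r_max_inv_nhd op by metis
    obtain E where E: "finite E" "E \<subseteq> F" "F = r E" using F(1) unfolding r_fin_gen_def by metis
    obtain E' where E': "finite E'" "E' \<subseteq> R" "R = r E'"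
      using r_invertible_r_fin_gen[OF Rinv] unfolding r_fin_gen_def by metis
    define C where "C = r (E \<union> E')"
    have "r E \<subseteq> C" "r E' \<subseteq> C" unfolding C_def by (rule closure_mono, simp)+
    then have FC: "F \<subseteq> C" and RC: "R \<subseteq> C" using E(3) E'(3) by simp_all
    have CM: "C \<subseteq> M"
      unfolding C_def using E(2) F(2) E'(2) RM[OF M] by (intro closure_least[OF max_spec_r_ideal[OF Ms]]) auto
    have "r_fin_gen r C"
      unfolding r_fin_gen_def C_def using E(1) E'(1) closure_extensive by (metis finite_UnI r_ideal_closure)
    then have Cinv: "r_invertible r C" by (rule r_fin_gen_invertible[OF _ nontrivial_mono[OF Rnt RC]])
    note res = ideal_ord_residual[OF Cinv RI Rnt RC Ms]
    \<comment> \<open>Orders add up: \<open>R\<close> has order at most one at \<open>M\<close> and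
      \<open>C\<close> uses it up, so nothing is left for \<open>residual R C\<close>.\<close>
    have "ideal_ord M R \<le> 1" using ideal_ord_radical[OF Ms Rrad Rnt] by simp
    moreover have "ideal_ord M C \<noteq> 0"
      using ideal_ord_eq_0_iff[OF Ms r_invertible_r_ideal[OF Cinv] r_invertible_nontrivial[OF Cinv]] CM by simp
    ultimately have "ideal_ord M (residual R C) = 0" using res(1) by simp
    then have "\<not> residual R C \<subseteq> M" using ideal_ord_eq_0_iff[OF Ms res(2,3)] by simp
    moreover have "{N \<in> r_max r. C \<subseteq> N} \<subseteq> {N \<in> r_max r. F \<subseteq> N}" using FC by auto
    ultimately show ?thesis using U(1) RC F(3) unfolding Q_def by (meson subset_trans)
  qed
  then obtain U C where "\<forall>M\<in>?V. Q M (U M) (C M)" by metis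
  then have UC: "\<forall>M\<in>?V. U M \<in> \<U> \<and> R \<subseteq> C M \<and>
      {N \<in> r_max r. C M \<subseteq> N} \<subseteq> U M \<and> \<not> residual R (C M) \<subseteq> M"
    unfolding Q_def .
  \<comment> \<open>A maximal ideal above \<open>?G\<close> contains \<open>J\<close>, so it is one
    of the indices \<open>M\<close>, and its own residual escapes it.\<close>
  let ?G = "J \<union> (\<Union>M\<in>?V. residual R (C M))"
  have "r ?G = UNIV"
  proof (rule ccontr)
    assume "r ?G \<noteq> UNIV"
    then obtain M where M: "M \<in> r_max r" "r ?G \<subseteq> M" by (rule exists_r_max[OF r_ideal_closure])
    then have GM: "?G \<subseteq> M" using closure_extensive by (meson subset_trans)
    then have "M \<in> ?V" using M(1) by simp
    then have "\<not> residual R (C M) \<subseteq> M" "residual R (C M) \<subseteq> ?G" using UC by auto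
    then show False using GM by (meson subset_trans)
  qed
  then have "1 \<in> r ?G" by simp
  then obtain E where E: "finite E" "E \<subseteq> ?G" "1 \<in> r E"
    using mem_closure_finite[of 1 ?G] by (elim iffD1[THEN exE] exE conjE) auto
  have "\<forall>e\<in>E - J. \<exists>M\<in>?V. e \<in> residual R (C M)" using E(2) by blast
  then obtain m where m: "\<forall>e\<in>E - J. m e \<in> ?V \<and> e \<in> residual R (C (m e))" by metis
  \<comment> \<open>Elements of \<open>E\<close> in \<open>J\<close> lie in every \<open>N\<close>
    of \<open>?V\<close>. As \<open>E\<close> generates H, some other \<open>e\<close> avoids
    \<open>N\<close>, and \<open>e * c\<close> in \<open>R\<close> forces \<open>C (m e)\<close>
    into \<open>N\<close>.\<close>
  let ?\<F> = "(\<lambda>e. U (m e)) ` (E - J)"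
  have "?V \<subseteq> \<Union>?\<F>"
  proof
    fix N assume N: "N \<in> ?V"
    have "\<not> E \<subseteq> N"
    proof
      assume "E \<subseteq> N"
      then have "r E \<subseteq> N" by (rule closure_least[OF max_spec_r_ideal[OF spec[OF N]]])
      then show False using E(3) one_notin_prime[OF max_spec_prime[OF spec[OF N]]] by blast
    qed
    then obtain e where e: "e \<in> E - J" "e \<notin> N" using N by blast
    have "C (m e) \<subseteq> N"
    proof
      fix c assume "c \<in> C (m e)"
      then have "e * c \<in> R" using m e(1) unfolding residual_def by blast
      then have "e * c \<in> N" using RM[OF N] by blast
      then show "c \<in> N" using e(2) prime_mult_iff[OF max_spec_prime[OF spec[OF N]]] by blast
    qed
    moreover have "{N \<in> r_max r. C (m e) \<subseteq> N} \<subseteq> U (m e)" using UC m e(1) by blast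
    ultimately have "N \<in> U (m e)" using N by blast
    then show "N \<in> \<Union>?\<F>" using e(1) by blast
  qed
  moreover have "finite ?\<F>" using E(1) by simp
  moreover have "?\<F> \<subseteq> \<U>" using UC m by blast
  ultimately show "\<exists>\<F>. finite \<F> \<and> \<F> \<subseteq> \<U> \<and> ?V \<subseteq> \<Union>\<F>" by blast
qed

text \<open>The isomorphism sends a nontrivial ideal to its order function. As \<open>r {}\<close>
  is not maximal, every point of the space carries a valuation.\<close>

lemma isomorphic_usc_lattice:
  assumes nt: "r {} \<notin> r_max r"
  shows "mult_lattice_isomorphic (r_ideal_lattice r) (usc_lattice (r_max_inv r))"
proof -
  let ?X = "r_max_inv r"
  note top = topspace_r_max_inv
  have spec: "max_spec = r_max r" using nontrivial_r_max[OF nt] by (auto simp: max_spec_def)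
  define \<phi> where "\<phi> I = (if nontrivial I then (\<lambda>M\<in>r_max r. enat (ideal_ord M I)) else usc_bottom ?X)" for I
  have ex_max: "\<exists>M. M \<in> r_max r" if "r_ideal r I" "\<not> nontrivial I" for I
  proof -
    have "I \<noteq> UNIV" using that(2) nontrivial_UNIV by blast
    then show ?thesis using exists_r_max[OF that(1)] by metis
  qed
  have le: "I \<subseteq> J \<longleftrightarrow> (\<forall>M\<in>r_max r. \<phi> J M \<le> \<phi> I M)" if I: "r_ideal r I" and J: "r_ideal r J" for I J
  proof (cases "nontrivial I")
    case nI: True
    show ?thesis
    proof (cases "nontrivial J")
      case True
      then show ?thesis using nI ideal_subset_iff[OF I nI J True] by (simp add: \<phi>_def spec)
    next
      case False
      then have "\<not> I \<subseteq> J" using nI nontrivial_mono by blast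
      moreover obtain M where "M \<in> r_max r" using ex_max[OF J False] by blast
      ultimately show ?thesis using nI False by (auto simp: \<phi>_def usc_bottom_def top)
    qed
  next
    case False
    then have "I \<subseteq> J" using not_nontrivial[OF I] absorbing_subset[OF J] by simp
    then show ?thesis using False by (simp add: \<phi>_def usc_bottom_def top)
  qed
  have ext: "\<phi> I \<in> extensional (r_max r)" for I by (auto simp: \<phi>_def usc_bottom_def top)
  have inj: "inj_on \<phi> {I. r_ideal r I}"
  proof (rule inj_onI)
    fix I J assume "I \<in> {I. r_ideal r I}" "J \<in> {I. r_ideal r I}" "\<phi> I = \<phi> J"
    then show "I = J" using le[of I J] le[of J I] by auto
  qed
  have in_usc: "\<phi> I \<in> usc_functions ?X" if I: "r_ideal r I" "nontrivial I" for I
    unfolding usc_functions_def top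
  proof (intro CollectI conjI allI impI)
    show "\<phi> I \<in> r_max r \<rightarrow>\<^sub>E range enat" using I(2) by (auto simp: \<phi>_def)
    fix k :: nat assume k: "1 \<le> k"
    let ?J = "\<Inter>{M \<in> max_spec. k \<le> ideal_ord M I}"
    have JI: "r_ideal r ?J" by (rule r_ideal_Inter) (auto dest: max_spec_r_ideal)
    have "I \<subseteq> ?J" using k ideal_ord_eq_0_iff[OF _ I] by fastforce
    then have Jnt: "nontrivial ?J" by (rule nontrivial_mono[OF I(2)])
    \<comment> \<open>The level set consists of all maximal ideals above its own intersection, so
      its compactness is that of the set above a single nontrivial ideal.\<close>
    have "{M \<in> r_max r. enat k \<le> \<phi> I M} = {M \<in> r_max r. ?J \<subseteq> M}"
    proof (intro Collect_cong conj_cong refl)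
      fix M assume "M \<in> r_max r"
      then have M: "M \<in> max_spec" by (simp add: spec)
      have "enat k \<le> \<phi> I M \<longleftrightarrow> k \<le> ideal_ord M I" using I(2) M by (simp add: \<phi>_def spec)
      also have "\<dots> \<longleftrightarrow> ?J \<subseteq> M" using Inter_level_subset[OF I M] M by blast
      finally show "enat k \<le> \<phi> I M \<longleftrightarrow> ?J \<subseteq> M" .
    qed
    then show "compactin ?X {M \<in> r_max r. enat k \<le> \<phi> I M}"
      using compactin_above_ideal[OF JI Jnt nt] by simp
  qed
  have img: "\<phi> ` {I. r_ideal r I} = insert (usc_bottom ?X) (usc_functions ?X)"
  proof
    show "\<phi> ` {I. r_ideal r I} \<subseteq> insert (usc_bottom ?X) (usc_functions ?X)"
      using in_usc by (auto simp: \<phi>_def)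
    show "insert (usc_bottom ?X) (usc_functions ?X) \<subseteq> \<phi> ` {I. r_ideal r I}"
    proof
      fix f assume f: "f \<in> insert (usc_bottom ?X) (usc_functions ?X)"
      have "\<exists>I. r_ideal r I \<and> \<phi> I = f"
      proof (cases "f = usc_bottom ?X")
        case True
        show ?thesis
        proof (cases "nontrivial (r {})")
          case True
          \<comment> \<open>Here H is the only r-ideal and the space is empty, so the bottom and the
            zero function coincide.\<close>
          then have "r {} = UNIV" using closure_empty by (auto simp: nontrivial_def)
          then have "I = UNIV" if "r_ideal r I" for I using closure_least[OF that, of "{}"] by auto
          then have "r_max r = {}" by (auto simp: r_max_def)
          then show ?thesis using \<open>f = usc_bottom ?X\<close> True
            by (intro exI[of _ "r {}"]) (simp add: \<phi>_def usc_bottom_def top restrict_def)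
        next
          case False
          then show ?thesis using \<open>f = usc_bottom ?X\<close> by (intro exI[of _ "r {}"]) (simp add: \<phi>_def)
        qed
      next
        case False
        then have usc: "f \<in> usc_functions ?X" using f by simp
        define g where "g M = the_enat (f M)" for M
        have g: "f M = enat (g M)" if "M \<in> r_max r" for M
          using usc that by (auto simp: usc_functions_def PiE_def Pi_def top g_def)
        have level: "{M \<in> r_max r. enat k \<le> f M} = {M \<in> max_spec. k \<le> g M}" for k
          using g by (auto simp: spec)
        have comp: "compactin ?X {M \<in> max_spec. k \<le> g M}" if "1 \<le> k" for k
          using usc that unfolding usc_functions_def top level[symmetric] by blast
        \<comment> \<open>For a compact level the closedness demanded by
          \<open>exists_ideal_with_ord\<close> is automatic.\<close>
        have closed: "k \<le> g M" if "1 \<le> k" "M \<in> max_spec" "\<Inter>{N \<in> max_spec. k \<le> g N} \<subseteq> M" for k M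
          using compact_Inter_subset_r_max[OF comp[OF that(1)] _ that(3)] that(2) by (auto simp: spec)
        have gnt: "nontrivial (\<Inter>{N \<in> max_spec. k \<le> g N})" if "1 \<le> k" for k
          by (rule compact_Inter_nontrivial[OF comp[OF that] nontrivial_r_max[OF nt]])
        obtain Js where Js: "\<forall>J\<in>set Js. radical_r_ideal r J \<and> J \<noteq> UNIV" "sorted_wrt (\<subseteq>) Js"
          "nontrivial (r_prod r Js)" "\<forall>M\<in>max_spec. ideal_ord M (r_prod r Js) = g M"
          by (rule exists_ideal_with_ord[of g, OF closed gnt])
        have "\<phi> (r_prod r Js) = f"
        proof (rule extensionalityI[OF ext])
          show "f \<in> extensional (r_max r)" using usc by (simp add: usc_functions_def top PiE_def)
          fix M assume M: "M \<in> r_max r"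
          then show "\<phi> (r_prod r Js) M = f M" using Js(3,4) g[OF M] by (simp add: \<phi>_def spec)
        qed
        then show ?thesis using r_ideal_r_prod by blast
      qed
      then show "f \<in> \<phi> ` {I. r_ideal r I}" by blast
    qed
  qed
  have mult: "\<phi> (r (I * J)) = (\<lambda>M\<in>r_max r. \<phi> I M + \<phi> J M)" if I: "r_ideal r I" and J: "r_ideal r J" for I J
  proof (cases "nontrivial I \<and> nontrivial J")
    case True
    then have "nontrivial (r (I * J))" using nontrivial_times[OF I J] by blast
    then show ?thesis using True ideal_ord_times[OF _ I _ J] by (auto simp: \<phi>_def spec intro!: restrict_ext)
  next
    case False
    then have "\<not> nontrivial (r (I * J))"
      using closure_times_subset_left[OF I, of J] closure_times_subset_right[OF J, of I] nontrivial_mono by blast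
    then show ?thesis using False by (auto simp: \<phi>_def usc_bottom_def top intro!: restrict_ext)
  qed
  have unit: "\<phi> UNIV = (\<lambda>M\<in>r_max r. 0)"
    using nontrivial_UNIV ideal_ord_UNIV by (auto simp: \<phi>_def spec zero_enat_def intro!: restrict_ext)
  show ?thesis unfolding mult_lattice_isomorphic_def
  proof (intro exI[of _ \<phi>] conjI)
    show "bij_betw \<phi> (elems (r_ideal_lattice r)) (elems (usc_lattice ?X))"
      using inj img by (simp add: bij_betw_def r_ideal_lattice_def usc_lattice_def)
    show "\<forall>I\<in>elems (r_ideal_lattice r). \<forall>J\<in>elems (r_ideal_lattice r).
        leq (r_ideal_lattice r) I J \<longleftrightarrow> leq (usc_lattice ?X) (\<phi> I) (\<phi> J)"
      using le by (simp add: r_ideal_lattice_def usc_lattice_def top)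
    show "\<forall>I\<in>elems (r_ideal_lattice r). \<forall>J\<in>elems (r_ideal_lattice r).
        \<phi> (mul (r_ideal_lattice r) I J) = mul (usc_lattice ?X) (\<phi> I) (\<phi> J)"
      using mult by (simp add: r_ideal_lattice_def usc_lattice_def top)
    show "\<phi> (top_unit (r_ideal_lattice r)) = top_unit (usc_lattice ?X)"
      using unit by (simp add: r_ideal_lattice_def usc_lattice_def top)
  qed
qed

lemma Prufer: "r_Prufer_monoid r"
  using r_fin_gen_invertible nontrivial_iff
  by (auto simp: r_Prufer_monoid_def regular_r_ideal_def regular_elem_iff)

lemma SP: "r_SP_monoid r"
  using exists_chain_factorization unfolding r_SP_monoid_def by blast

end

section \<open>Conditions (5) and (7), and the equivalences\<close>

context cancellative_ideal_system
begin

lemma SP_ideal_systemI: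
  assumes "r_dim r \<le> 1"
    and "\<forall>P. prime_r_ideal r P \<and> nontrivial P \<longrightarrow>
      (\<exists>I. r_invertible r I \<and> radical_r_ideal r I \<and> I \<subseteq> P)"
  shows "SP_ideal_system r"
  using assms by unfold_locales (auto simp: r_dim_le_one_iff)

lemma radicals_invertible_imp_SP_ideal_system:
  assumes inv: "\<forall>I. r_fin_gen r I \<and> nontrivial I \<longrightarrow> r_invertible r (radical I)"
  shows "SP_ideal_system r"
proof (rule SP_ideal_systemI)
  show "r_dim r \<le> 1"
    unfolding r_dim_le_one_iff by (rule radicals_invertible_one_dimensional) (use inv in blast)
  show "\<forall>P. prime_r_ideal r P \<and> nontrivial P \<longrightarrow>
      (\<exists>I. r_invertible r I \<and> radical_r_ideal r I \<and> I \<subseteq> P)"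
  proof (intro allI impI, elim conjE)
    fix P assume P: "prime_r_ideal r P" "nontrivial P"
    then obtain x where x: "x \<in> P" "x \<notin> absorbing" using nontrivial_iff prime_r_idealD by blast
    have "x *o UNIV \<subseteq> P" using x(1) principal_subset[OF prime_r_idealD[OF P(1)]] by simp
    then have "radical (x *o UNIV) \<subseteq> P" by (rule radical_least[OF prime_radical_r_ideal[OF P(1)]])
    moreover have "r_invertible r (radical (x *o UNIV))"
      using inv r_invertible_r_fin_gen[OF r_invertible_principal[OF x(2)]] nontrivial_principal[OF x(2)]
      by blast
    moreover have "radical_r_ideal r (radical (x *o UNIV))"
      by (rule radical_r_ideal_radical[OF r_ideal_principal])
    ultimately show "\<exists>I. r_invertible r I \<and> radical_r_ideal r I \<and> I \<subseteq> P" by blast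
  qed
qed

text \<open>Forwards the invertibility of ideals that need not be radical comes from
  \<open>SP_ideal_system\<close>. Backwards the radical of a nontrivial ideal is regular, because
  regular means non-absorbing.\<close>

lemma Prufer_radicals_iff:
  "(\<forall>I. r_fin_gen r I \<and> nontrivial I \<longrightarrow> r_invertible r (radical I)) \<longleftrightarrow>
    r_Prufer_monoid r \<and> (\<forall>I. r_fin_gen r I \<longrightarrow> r_fin_gen r (radical I))"
proof (intro iffI conjI allI impI)
  assume inv: "\<forall>I. r_fin_gen r I \<and> nontrivial I \<longrightarrow> r_invertible r (radical I)"
  then show "r_Prufer_monoid r" by (intro SP_ideal_system.Prufer radicals_invertible_imp_SP_ideal_system)
  fix I assume I: "r_fin_gen r I"
  show "r_fin_gen r (radical I)"
  proof (cases "nontrivial I")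
    case True
    then show ?thesis using inv I r_invertible_r_fin_gen by blast
  next
    case False
    then have "I = absorbing" using I not_nontrivial by (simp add: r_fin_gen_def)
    then show ?thesis using I radical_trivial by simp
  qed
next
  fix I
  assume Pr: "r_Prufer_monoid r \<and> (\<forall>I. r_fin_gen r I \<longrightarrow> r_fin_gen r (radical I))"
    and I: "r_fin_gen r I \<and> nontrivial I"
  have fg: "r_fin_gen r (radical I)" using Pr I by blast
  then have RI: "r_ideal r (radical I)" by (simp add: r_fin_gen_def)
  have "nontrivial (radical I)" using I nontrivial_mono subset_radical by blast
  then have "regular_r_ideal r (radical I)"
    using RI nontrivial_iff by (simp add: regular_r_ideal_def regular_elem_iff)
  then show "r_invertible r (radical I)" using Pr fg by (simp add: r_Prufer_monoid_def)
qed

end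

theorem corollary8p5:
  fixes r :: "'a::comm_monoid_mult set \<Rightarrow> 'a set"
  assumes more_than_one: "\<exists>x y :: 'a. x \<noteq> y"
    and cancellative_monoid: "\<forall>x :: 'a. x \<notin> absorbing \<longrightarrow> cancellative x"
    and "ideal_system r" and "finitary r" and "modular r"
  shows
    "(r_SP_monoid r \<longleftrightarrow>
        r_dim r \<le> 1 \<and>
        (\<forall>I. r_invertible r I \<longrightarrow>
           (\<exists>Js. (\<forall>J\<in>set Js. radical_r_ideal r J) \<and> I = r_prod r Js))) \<and>
     (r_SP_monoid r \<longleftrightarrow>
        r_dim r \<le> 1 \<and>
        (\<forall>P. prime_r_ideal r P \<and> nontrivial P \<longrightarrow>
           (\<exists>I. r_invertible r I \<and> radical_r_ideal r I \<and> I \<subseteq> P))) \<and>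
     (r_SP_monoid r \<longleftrightarrow>
        (\<forall>I. r_ideal r I \<longrightarrow>
           (\<exists>Js. (\<forall>J\<in>set Js. radical_r_ideal r J) \<and> sorted_wrt (\<subseteq>) Js \<and> I = r_prod r Js)) \<and>
        (\<forall>I. r_ideal r I \<and> nontrivial I \<longrightarrow>
           (\<exists>!Js. (\<forall>J\<in>set Js. radical_r_ideal r J \<and> J \<noteq> UNIV) \<and> sorted_wrt (\<subseteq>) Js \<and>
                  I = r_prod r Js))) \<and>
     (r_SP_monoid r \<longleftrightarrow>
        (\<forall>I. r_fin_gen r I \<and> nontrivial I \<longrightarrow> r_invertible r (radical I))) \<and>
     \<comment> \<open>If the bottom element \<open>r {}\<close> is maximal, there are just two \<open>r\<close>-ideals, while the lattice
       of functions on the one-point space is infinite.\<close>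
     (r {} \<notin> r_max r \<longrightarrow>
        (r_SP_monoid r \<longleftrightarrow>
           mult_lattice_isomorphic (r_ideal_lattice r) (usc_lattice (r_max_inv r)))) \<and>
     (r_SP_monoid r \<longleftrightarrow>
        r_Prufer_monoid r \<and> (\<forall>I. r_fin_gen r I \<longrightarrow> r_fin_gen r (radical I)))"
proof -
  interpret cancellative_ideal_system r by unfold_locales (fact assms)+
  let ?dim = "r_dim r \<le> 1"
  let ?two = "\<forall>I. r_invertible r I \<longrightarrow> (\<exists>Js. (\<forall>J\<in>set Js. radical_r_ideal r J) \<and> I = r_prod r Js)"
  let ?three = "\<forall>P. prime_r_ideal r P \<and> nontrivial P \<longrightarrow>
    (\<exists>I. r_invertible r I \<and> radical_r_ideal r I \<and> I \<subseteq> P)"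
  let ?four = "(\<forall>I. r_ideal r I \<longrightarrow>
      (\<exists>Js. (\<forall>J\<in>set Js. radical_r_ideal r J) \<and> sorted_wrt (\<subseteq>) Js \<and> I = r_prod r Js)) \<and>
    (\<forall>I. r_ideal r I \<and> nontrivial I \<longrightarrow>
      (\<exists>!Js. (\<forall>J\<in>set Js. radical_r_ideal r J \<and> J \<noteq> UNIV) \<and> sorted_wrt (\<subseteq>) Js \<and> I = r_prod r Js))"
  let ?five = "\<forall>I. r_fin_gen r I \<and> nontrivial I \<longrightarrow> r_invertible r (radical I)"
  have dim: ?dim if "r_SP_monoid r"
    using SP_one_dimensional[OF \<open>modular r\<close> that] by (simp add: r_dim_le_one_iff)
  have SP_two: ?two if "r_SP_monoid r"
    using that r_invertible_r_ideal unfolding r_SP_monoid_def by blast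
  have two_three: ?three if two: ?two
  proof (intro allI impI, elim conjE)
    fix P assume "prime_r_ideal r P" "nontrivial P"
    then show "\<exists>I. r_invertible r I \<and> radical_r_ideal r I \<and> I \<subseteq> P"
      using two by (intro prime_contains_invertible_radical) blast+
  qed
  \<comment> \<open>The locale is the meeting point through which the conditions are
    compared.\<close>
  have SP_iff: "r_SP_monoid r \<longleftrightarrow> SP_ideal_system r"
  proof
    assume SP: "r_SP_monoid r"
    show "SP_ideal_system r" by (rule SP_ideal_systemI[OF dim[OF SP] two_three[OF SP_two[OF SP]]])
  qed (rule SP_ideal_system.SP)
  have two: "r_SP_monoid r \<longleftrightarrow> ?dim \<and> ?two"
    using dim SP_two two_three SP_ideal_systemI SP_iff by metis
  have three: "r_SP_monoid r \<longleftrightarrow> ?dim \<and> ?three"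
    using dim SP_two two_three SP_ideal_systemI SP_iff by metis
  have four: "r_SP_monoid r \<longleftrightarrow> ?four"
  proof
    assume "r_SP_monoid r"
    then interpret SP_ideal_system r using SP_iff by simp
    show ?four using exists_chain_factorization chain_factorization_unique by simp
  next
    assume ?four
    then show "r_SP_monoid r" unfolding r_SP_monoid_def by blast
  qed
  have five: "r_SP_monoid r \<longleftrightarrow> ?five"
    unfolding SP_iff using SP_ideal_system.radical_invertible radicals_invertible_imp_SP_ideal_system
    by blast
  have six: "r_SP_monoid r \<longleftrightarrow>
      mult_lattice_isomorphic (r_ideal_lattice r) (usc_lattice (r_max_inv r))" if "r {} \<notin> r_max r"
    using isomorphic_imp_SP SP_ideal_system.isomorphic_usc_lattice[OF _ that] SP_iff by blast
  have seven: "r_SP_monoid r \<longleftrightarrow>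
      r_Prufer_monoid r \<and> (\<forall>I. r_fin_gen r I \<longrightarrow> r_fin_gen r (radical I))"
    using five Prufer_radicals_iff by simp
  show ?thesis
    by (intro conjI two three four five six seven impI)
qed

end
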